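(* Let $p$ and $q$ be prime numbers such that $p\mid q-1$, let $r\in\mathbb{Z}_q^{\times}$ be an element of order $p$, and let $\zeta\in\mathbb{C}$ be a primitive $p$-th root of unity. Let $\mathcal{B}_{p,q}(\zeta)$ be the Hopf algebra over $\mathbb{Q}(\zeta)$ defined in the context. Then the complex semisimple Hopf algebra $\mathcal{B}_{p,q}(\zeta)\otimes_{\mathbb{Q}(\zeta)}\mathbb{C}$ does not admit a Hopf order over any number ring.
   Context: Definition of $\mathcal{B}_{p,q}(\zeta)$ over a field $K$ (here $K=\mathbb{Q}(\zeta)$). Consider the finite group $$G=\big\langle \sigma,\tau,a,b : \sigma^p=\tau^p=1,\ a^q=b^q=1,\ \sigma a\sigma^{-1}=a^r,\ \tau b\tau^{-1}=b^r,\ [\sigma,b]=[\tau,a]=[a,b]=[\sigma,\tau]=1\big\rangle,$$ which is isomorphic to $(\mathbb{Z}_q\times\mathbb{Z}_q)\rtimes(\mathbb{Z}_p\times\mathbb{Z}_p)$. The element $$J=\frac{1}{p}\sum_{u,v=0}^{p-1}\zeta^{-uv}\,\tau^u\otimes\sigma^v\in KG\otimes KG$$ is a twist for the group Hopf algebra $KG$ (i.e. it is invertible, $(1\otimes J)(\mathrm{id}\otimes\Delta)(J)=(J\otimes 1)(\Delta\otimes \mathrm{id})(J)$ and $(\varepsilon\otimes \mathrm{id})(J)=(\mathrm{id}\otimes\varepsilon)(J)=1$), with inverse $J^{-1}=\frac{1}{p}\sum_{u,v=0}^{p-1}\zeta^{uv}\tau^u\otimes\sigma^v$. The Hopf algebra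 $\mathcal{B}_{p,q}(\zeta)=(KG)_J$ is the Drinfel'd twist of $KG$ by $J$: it equals $KG$ as an algebra, has the same counit as $KG$ ($\varepsilon(g)=1$ for $g\in G$), comultiplication $\Delta_J(g)=J(g\otimes g)J^{-1}$ and antipode $S_J(g)=U_J g^{-1}U_J^{-1}$ for $g\in G$, where $U_J=\sum J^{(1)}S(J^{(2)})$ for $J=\sum J^{(1)}\otimes J^{(2)}$, and $S$ is the antipode of $KG$. Hopf orders. Let $H$ be a finite dimensional Hopf algebra over a field $F$ (here $F=\mathbb{C}$) and $R$ a subring of $F$. A Hopf order of $H$ over $R$ is a finitely generated projective $R$-submodule $X$ of $H$ such that the natural map $X\otimes_R F\to H$ is an isomorphism, $1_H\in X$, $XX\subseteq X$, $\Delta(X)\subseteq X\otimes_R X$ (where $X\otimes_R X$ is viewed inside $H\otimes H$), $\varepsilon(X)\subseteq R$ and $S(X)\subseteq X$. A number ring is the ring of algebraic integers of a number field (a subfield of $\mathbb{C}$ of finite degree over $\mathbb{Q}$). *)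

theory Defs
  imports
    "HOL-Algebra.Algebra"
    "HOL-Algebra.Algebraic_Closure_Type"
    "HOL-Number_Theory.Number_Theory"
    "HOL-Library.Multiset"
begin

section \<open>Groups given by generators and relations\<close>

text \<open>The letter \<open>(x, True)\<close> stands for \<open>x\<close> and \<open>(x, False)\<close> for \<open>x\<inverse>\<close>.\<close>

type_synonym 'x gword = "('x \<times> bool) list"

inductive pres_eq :: "('x gword \<times> 'x gword) set \<Rightarrow> 'x gword \<Rightarrow> 'x gword \<Rightarrow> bool"
  for rels where
  pres_rel: "(u, v) \<in> rels \<Longrightarrow> pres_eq rels u v"
| pres_cancel: "pres_eq rels [(x, e), (x, \<not> e)] []"
| pres_refl: "pres_eq rels u u"
| pres_sym: "pres_eq rels u v \<Longrightarrow> pres_eq rels v u"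
| pres_trans: "pres_eq rels u v \<Longrightarrow> pres_eq rels v w \<Longrightarrow> pres_eq rels u w"
| pres_append: "pres_eq rels u u' \<Longrightarrow> pres_eq rels v v' \<Longrightarrow> pres_eq rels (u @ v) (u' @ v')"

definition pres_class :: "('x gword \<times> 'x gword) set \<Rightarrow> 'x gword \<Rightarrow> 'x gword set" where
  "pres_class rels u = {v. pres_eq rels u v}"

definition presented_group :: "('x gword \<times> 'x gword) set \<Rightarrow> 'x gword set monoid" where
  "presented_group rels =
     \<lparr>carrier = range (pres_class rels),
      monoid.mult = (\<lambda>A B. \<Union>u\<in>A. \<Union>v\<in>B. pres_class rels (u @ v)),
      monoid.one = pres_class rels []\<rparr>"

lemma pres_class_eq_iff: "pres_class rels u = pres_class rels v \<longleftrightarrow> pres_eq rels u v"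
  by (auto simp: pres_class_def set_eq_iff intro: pres_refl elim: pres_trans[OF pres_sym] pres_trans)

lemma presented_group_mult:
  "pres_class rels u \<otimes>\<^bsub>presented_group rels\<^esub> pres_class rels v = pres_class rels (u @ v)"
proof -
  have eq: "pres_class rels (u' @ v') = pres_class rels (u @ v)"
    if "u' \<in> pres_class rels u" "v' \<in> pres_class rels v" for u' v'
  proof -
    from that have "pres_eq rels u u'" "pres_eq rels v v'" by (simp_all add: pres_class_def)
    then show ?thesis unfolding pres_class_eq_iff by (intro pres_sym[OF pres_append])
  qed
  have "(\<Union>u'\<in>pres_class rels u. \<Union>v'\<in>pres_class rels v. pres_class rels (u' @ v')) =
      (\<Union>u'\<in>pres_class rels u. \<Union>v'\<in>pres_class rels v. pres_class rels (u @ v))"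
    by (intro SUP_cong refl eq)
  also have "u \<in> pres_class rels u" "v \<in> pres_class rels v"
    by (simp_all add: pres_class_def pres_refl)
  then have "(\<Union>u'\<in>pres_class rels u. \<Union>v'\<in>pres_class rels v. pres_class rels (u @ v)) =
      pres_class rels (u @ v)" by blast
  finally show ?thesis by (simp add: presented_group_def)
qed

lemma presented_group_left_inverse:
  "pres_eq rels (rev (map (\<lambda>(x, e). (x, \<not> e)) u) @ u) []"
proof (induction u)
  case Nil
  show ?case by (simp add: pres_refl)
next
  case (Cons l u)
  obtain x e where l: "l = (x, e)" by (cases l)
  let ?w = "rev (map (\<lambda>(x, e). (x, \<not> e)) u)"
  have "pres_eq rels [(x, \<not> e), (x, e)] []" using pres_cancel[of rels x "\<not> e"] by simp
  then have "pres_eq rels ([(x, \<not> e), (x, e)] @ u) ([] @ u)"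
    by (rule pres_append[OF _ pres_refl])
  then have "pres_eq rels (?w @ [(x, \<not> e), (x, e)] @ u) (?w @ [] @ u)"
    by (rule pres_append[OF pres_refl])
  then have "pres_eq rels (rev (map (\<lambda>(x, e). (x, \<not> e)) (l # u)) @ (l # u)) (?w @ u)"
    by (simp add: l)
  then show ?case using Cons.IH by (rule pres_trans)
qed

lemma group_presented_group: "group (presented_group rels)"
proof (rule groupI)
  show "\<one>\<^bsub>presented_group rels\<^esub> \<in> carrier (presented_group rels)"
    by (simp add: presented_group_def)
next
  fix A B assume "A \<in> carrier (presented_group rels)" "B \<in> carrier (presented_group rels)"
  then obtain u v where "A = pres_class rels u" "B = pres_class rels v"
    by (auto simp: presented_group_def)
  then show "A \<otimes>\<^bsub>presented_group rels\<^esub> B \<in> carrier (presented_group rels)"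
    by (simp only: presented_group_mult) (simp add: presented_group_def)
next
  fix A B C assume "A \<in> carrier (presented_group rels)" "B \<in> carrier (presented_group rels)"
    "C \<in> carrier (presented_group rels)"
  then obtain u v w where "A = pres_class rels u" "B = pres_class rels v" "C = pres_class rels w"
    by (auto simp: presented_group_def)
  then show "A \<otimes>\<^bsub>presented_group rels\<^esub> B \<otimes>\<^bsub>presented_group rels\<^esub> C =
      A \<otimes>\<^bsub>presented_group rels\<^esub> (B \<otimes>\<^bsub>presented_group rels\<^esub> C)"
    by (simp add: presented_group_mult)
next
  have one: "\<one>\<^bsub>presented_group rels\<^esub> = pres_class rels []"
    by (simp add: presented_group_def)
  fix A assume "A \<in> carrier (presented_group rels)"
  then obtain u where u: "A = pres_class rels u"
    by (auto simp: presented_group_def)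
  show "\<one>\<^bsub>presented_group rels\<^esub> \<otimes>\<^bsub>presented_group rels\<^esub> A = A"
    by (simp add: one u presented_group_mult)
  have "pres_class rels (rev (map (\<lambda>(x, e). (x, \<not> e)) u)) \<otimes>\<^bsub>presented_group rels\<^esub> A =
      \<one>\<^bsub>presented_group rels\<^esub>"
    by (simp add: one u presented_group_mult pres_class_eq_iff presented_group_left_inverse)
  then show "\<exists>B\<in>carrier (presented_group rels).
      B \<otimes>\<^bsub>presented_group rels\<^esub> A = \<one>\<^bsub>presented_group rels\<^esub>"
    by (auto simp: presented_group_def)
qed

section \<open>Modules: homomorphisms, projectivity, tensor products\<close>

text \<open>Modules are records of the library type \<open>module\<close>; the fields \<open>mult\<close> and \<open>one\<close>, which that
  type inherits from rings, play no role for a module and are left undefined.\<close>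

definition mod_hom ::
  "('a, 'r) ring_scheme \<Rightarrow> ('a, 'b, 'm) module_scheme \<Rightarrow> ('a, 'c, 'n) module_scheme \<Rightarrow> ('b \<Rightarrow> 'c) set"
  where "mod_hom R M N =
    {f \<in> carrier M \<rightarrow> carrier N.
       (\<forall>x\<in>carrier M. \<forall>y\<in>carrier M. f (x \<oplus>\<^bsub>M\<^esub> y) = f x \<oplus>\<^bsub>N\<^esub> f y) \<and>
       (\<forall>c\<in>carrier R. \<forall>x\<in>carrier M. f (c \<odot>\<^bsub>M\<^esub> x) = c \<odot>\<^bsub>N\<^esub> f x)}"

definition free_module :: "('a, 'r) ring_scheme \<Rightarrow> nat \<Rightarrow> ('a, nat \<Rightarrow> 'a) module" where
  "free_module R n =
     \<lparr>carrier = {..<n} \<rightarrow>\<^sub>E carrier R, monoid.mult = undefined, monoid.one = undefined,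
      ring.zero = (\<lambda>i\<in>{..<n}. \<zero>\<^bsub>R\<^esub>),
      ring.add = (\<lambda>x y. \<lambda>i\<in>{..<n}. x i \<oplus>\<^bsub>R\<^esub> y i),
      module.smult = (\<lambda>c x. \<lambda>i\<in>{..<n}. c \<otimes>\<^bsub>R\<^esub> x i)\<rparr>"

text \<open>Finitely generated projective: (isomorphic to) a direct summand of some \<open>R\<^sup>n\<close>.\<close>

definition fg_projective :: "('a, 'r) ring_scheme \<Rightarrow> ('a, 'b, 'm) module_scheme \<Rightarrow> bool" where
  "fg_projective R M \<longleftrightarrow>
     (\<exists>n. \<exists>i \<in> mod_hom R M (free_module R n). \<exists>\<pi> \<in> mod_hom R (free_module R n) M.
        \<forall>x\<in>carrier M. \<pi> (i x) = x)"

text \<open>The multiset \<open>{#(x\<^sub>1, y\<^sub>1), \<dots>, (x\<^sub>k, y\<^sub>k)#}\<close> represents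
  \<open>x\<^sub>1 \<otimes> y\<^sub>1 + \<dots> + x\<^sub>k \<otimes> y\<^sub>k\<close>. Formal negatives are not needed,
  since \<open>(- x) \<otimes> y\<close> is an additive inverse of \<open>x \<otimes> y\<close>.\<close>

inductive tensor_cong ::
  "('a, 'r) ring_scheme \<Rightarrow> ('a, 'b, 'm) module_scheme \<Rightarrow> ('a, 'c, 'n) module_scheme \<Rightarrow>
     ('b \<times> 'c) multiset \<Rightarrow> ('b \<times> 'c) multiset \<Rightarrow> bool"
  for R M N where
  tc_refl: "set_mset A \<subseteq> carrier M \<times> carrier N \<Longrightarrow> tensor_cong R M N A A"
| tc_sym: "tensor_cong R M N A B \<Longrightarrow> tensor_cong R M N B A"
| tc_trans: "tensor_cong R M N A B \<Longrightarrow> tensor_cong R M N B C \<Longrightarrow> tensor_cong R M N A C"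
| tc_plus: "tensor_cong R M N A B \<Longrightarrow> tensor_cong R M N C D \<Longrightarrow> tensor_cong R M N (A + C) (B + D)"
| tc_zero: "y \<in> carrier N \<Longrightarrow> tensor_cong R M N {#(\<zero>\<^bsub>M\<^esub>, y)#} {#}"
| tc_add_left: "x \<in> carrier M \<Longrightarrow> x' \<in> carrier M \<Longrightarrow> y \<in> carrier N \<Longrightarrow>
    tensor_cong R M N {#(x \<oplus>\<^bsub>M\<^esub> x', y)#} {#(x, y), (x', y)#}"
| tc_add_right: "x \<in> carrier M \<Longrightarrow> y \<in> carrier N \<Longrightarrow> y' \<in> carrier N \<Longrightarrow>
    tensor_cong R M N {#(x, y \<oplus>\<^bsub>N\<^esub> y')#} {#(x, y), (x, y')#}"
| tc_smult: "c \<in> carrier R \<Longrightarrow> x \<in> carrier M \<Longrightarrow> y \<in> carrier N \<Longrightarrow>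
    tensor_cong R M N {#(c \<odot>\<^bsub>M\<^esub> x, y)#} {#(x, c \<odot>\<^bsub>N\<^esub> y)#}"

definition tensor_product ::
  "('a, 'r) ring_scheme \<Rightarrow> ('a, 'b, 'm) module_scheme \<Rightarrow> ('a, 'c, 'n) module_scheme \<Rightarrow>
     ('b \<times> 'c) multiset set set"
  where "tensor_product R M N =
    {A. set_mset A \<subseteq> carrier M \<times> carrier N} // {(A, B). tensor_cong R M N A B}"

section \<open>Subrings of the complex numbers\<close>

abbreviation complex_ring :: "complex ring" where
  "complex_ring \<equiv> ring_of_type_algebra"

definition scalar_ring :: "complex set \<Rightarrow> complex ring" where
  "scalar_ring R = complex_ring\<lparr>carrier := R\<rparr>"

definition number_field :: "complex set \<Rightarrow> bool" where
  "number_field K \<longleftrightarrow> subfield K complex_ring \<and> ring.finite_dimension complex_ring \<rat> K"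

definition number_ring :: "complex set \<Rightarrow> bool" where
  "number_ring R \<longleftrightarrow> (\<exists>K. number_field K \<and> R = {x \<in> K. algebraic_int x})"

definition primitive_root_of_unity :: "nat \<Rightarrow> complex \<Rightarrow> bool" where
  "primitive_root_of_unity n \<zeta> \<longleftrightarrow> \<zeta> ^ n = 1 \<and> (\<forall>k. 0 < k \<and> k < n \<longrightarrow> \<zeta> ^ k \<noteq> 1)"

section \<open>Finite dimensional Hopf algebras with a chosen basis\<close>

text \<open>
  For \<open>F \<subseteq> \<complex>\<close>, the \<open>F\<close>-space with finite basis \<open>B\<close> is realised as the space
  \<open>coord_space F B\<close> of coordinate functions, and the tensor product of the spaces with bases
  \<open>B\<close> and \<open>C\<close> as the space with basis \<open>B \<times> C\<close>, where \<open>vtensor x y\<close> is \<open>x \<otimes> y\<close>.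
\<close>

definition coord_space :: "complex set \<Rightarrow> 'b set \<Rightarrow> ('b \<Rightarrow> complex) set" where
  "coord_space F B = {x. (\<forall>b\<in>B. x b \<in> F) \<and> (\<forall>b. b \<notin> B \<longrightarrow> x b = 0)}"

definition unit_vec :: "'b \<Rightarrow> 'b \<Rightarrow> complex" where
  "unit_vec b = (\<lambda>c. if c = b then 1 else 0)"

definition vtensor :: "('b \<Rightarrow> complex) \<Rightarrow> ('c \<Rightarrow> complex) \<Rightarrow> 'b \<times> 'c \<Rightarrow> complex" where
  "vtensor x y = (\<lambda>(b, c). x b * y c)"

definition lin_ext :: "'b set \<Rightarrow> ('b \<Rightarrow> 'c \<Rightarrow> complex) \<Rightarrow> ('b \<Rightarrow> complex) \<Rightarrow> 'c \<Rightarrow> complex" where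
  "lin_ext B \<phi> x = (\<lambda>c. \<Sum>b\<in>B. x b * \<phi> b c)"

definition bilin_ext :: "'b set \<Rightarrow> ('b \<Rightarrow> 'b \<Rightarrow> 'b \<Rightarrow> complex) \<Rightarrow>
    ('b \<Rightarrow> complex) \<Rightarrow> ('b \<Rightarrow> complex) \<Rightarrow> 'b \<Rightarrow> complex" where
  "bilin_ext B \<mu> x y = (\<lambda>c. \<Sum>a\<in>B. \<Sum>b\<in>B. x a * y b * \<mu> a b c)"

text \<open>The structure maps are given by their values on the basis.\<close>

record 'b hopf_data =
  scalars :: "complex set"
  basis :: "'b set"
  bmult :: "'b \<Rightarrow> 'b \<Rightarrow> 'b \<Rightarrow> complex"
  hone :: "'b \<Rightarrow> complex"
  bcomult :: "'b \<Rightarrow> 'b \<times> 'b \<Rightarrow> complex"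
  bcounit :: "'b \<Rightarrow> complex"
  bantipode :: "'b \<Rightarrow> 'b \<Rightarrow> complex"

definition hspace :: "'b hopf_data \<Rightarrow> ('b \<Rightarrow> complex) set" where
  "hspace H = coord_space (scalars H) (basis H)"

definition hspace2 :: "'b hopf_data \<Rightarrow> ('b \<times> 'b \<Rightarrow> complex) set" where
  "hspace2 H = coord_space (scalars H) (basis H \<times> basis H)"

definition hmult :: "'b hopf_data \<Rightarrow> ('b \<Rightarrow> complex) \<Rightarrow> ('b \<Rightarrow> complex) \<Rightarrow> 'b \<Rightarrow> complex" where
  "hmult H = bilin_ext (basis H) (bmult H)"

definition hmult2 :: "'b hopf_data \<Rightarrow> ('b \<times> 'b \<Rightarrow> complex) \<Rightarrow> ('b \<times> 'b \<Rightarrow> complex) \<Rightarrow>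
    'b \<times> 'b \<Rightarrow> complex" where
  "hmult2 H = bilin_ext (basis H \<times> basis H)
     (\<lambda>(a, a') (b, b'). vtensor (bmult H a b) (bmult H a' b'))"

definition hcomult :: "'b hopf_data \<Rightarrow> ('b \<Rightarrow> complex) \<Rightarrow> 'b \<times> 'b \<Rightarrow> complex" where
  "hcomult H = lin_ext (basis H) (bcomult H)"

definition hcounit :: "'b hopf_data \<Rightarrow> ('b \<Rightarrow> complex) \<Rightarrow> complex" where
  "hcounit H x = (\<Sum>b\<in>basis H. x b * bcounit H b)"

definition hantipode :: "'b hopf_data \<Rightarrow> ('b \<Rightarrow> complex) \<Rightarrow> 'b \<Rightarrow> complex" where
  "hantipode H = lin_ext (basis H) (bantipode H)"

definition hinverse :: "'b hopf_data \<Rightarrow> ('b \<Rightarrow> complex) \<Rightarrow> 'b \<Rightarrow> complex" where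
  "hinverse H x = (THE y. y \<in> hspace H \<and> hmult H x y = hone H \<and> hmult H y x = hone H)"

definition hinverse2 :: "'b hopf_data \<Rightarrow> ('b \<times> 'b \<Rightarrow> complex) \<Rightarrow> 'b \<times> 'b \<Rightarrow> complex" where
  "hinverse2 H s = (THE t. t \<in> hspace2 H \<and>
     hmult2 H s t = vtensor (hone H) (hone H) \<and> hmult2 H t s = vtensor (hone H) (hone H))"

text \<open>If \<open>B\<close> is a \<open>K\<close>-basis of \<open>H\<close>, then \<open>{b \<otimes> 1 | b \<in> B}\<close> is an \<open>L\<close>-basis of
  \<open>H \<otimes>\<^sub>K L\<close>, and the structure constants with respect to it are the same.\<close>

definition base_change :: "complex set \<Rightarrow> 'b hopf_data \<Rightarrow> 'b hopf_data" where
  "base_change L H = H\<lparr>scalars := L\<rparr>"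

definition group_hopf :: "complex set \<Rightarrow> 'g monoid \<Rightarrow> 'g hopf_data" where
  "group_hopf K G =
     \<lparr>scalars = K, basis = carrier G,
      bmult = (\<lambda>g h. unit_vec (g \<otimes>\<^bsub>G\<^esub> h)),
      hone = unit_vec \<one>\<^bsub>G\<^esub>,
      bcomult = (\<lambda>g. unit_vec (g, g)),
      bcounit = (\<lambda>g. 1),
      bantipode = (\<lambda>g. unit_vec (inv\<^bsub>G\<^esub> g))\<rparr>"

text \<open>The element \<open>U\<^sub>J = \<Sum> J\<^sup>(\<^sup>1\<^sup>) S(J\<^sup>(\<^sup>2\<^sup>))\<close>.\<close>

definition twist_U :: "'b hopf_data \<Rightarrow> ('b \<times> 'b \<Rightarrow> complex) \<Rightarrow> 'b \<Rightarrow> complex" where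
  "twist_U H J =
     lin_ext (basis H \<times> basis H) (\<lambda>(a, b). hmult H (unit_vec a) (bantipode H b)) J"

definition drinfeld_twist :: "'b hopf_data \<Rightarrow> ('b \<times> 'b \<Rightarrow> complex) \<Rightarrow> 'b hopf_data" where
  "drinfeld_twist H J = H\<lparr>
     bcomult := (\<lambda>b. hmult2 H (hmult2 H J (bcomult H b)) (hinverse2 H J)),
     bantipode := (\<lambda>b. hmult H (hmult H (twist_U H J) (bantipode H b))
                         (hinverse H (twist_U H J)))\<rparr>"

section \<open>Hopf orders\<close>

definition coord_module :: "('b \<Rightarrow> complex) set \<Rightarrow> (complex, 'b \<Rightarrow> complex) module" where
  "coord_module Y =
     \<lparr>carrier = Y, monoid.mult = undefined, monoid.one = undefined, ring.zero = (\<lambda>_. 0),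
      ring.add = (\<lambda>x y b. x b + y b), module.smult = (\<lambda>c x b. c * x b)\<rparr>"

definition scalar_module :: "complex set \<Rightarrow> (complex, complex) module" where
  "scalar_module F =
     \<lparr>carrier = F, monoid.mult = undefined, monoid.one = undefined, ring.zero = 0, 
      ring.add = (+), module.smult = (*)\<rparr>"

text \<open>The natural map \<open>Y \<otimes>\<^sub>R F \<rightarrow> H\<close>, \<open>x \<otimes> c \<mapsto> c x\<close>. The class \<open>T\<close> is sent to the common
  value of its representatives.\<close>

definition natural_map :: "(('b \<Rightarrow> complex) \<times> complex) multiset set \<Rightarrow> 'b \<Rightarrow> complex" where
  "natural_map T = the_elem ((\<lambda>A. \<lambda>b. \<Sum>(x, c)\<in>#A. c * x b) ` T)"

text \<open>The image of \<open>Y \<otimes>\<^sub>R Y\<close> in \<open>H \<otimes> H\<close>.\<close>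

definition tensor_square_image :: "('b \<Rightarrow> complex) set \<Rightarrow> ('b \<times> 'b \<Rightarrow> complex) set" where
  "tensor_square_image Y =
     {(\<lambda>b. \<Sum>(x, y)\<in>#A. vtensor x y b) | A. set_mset A \<subseteq> Y \<times> Y}"

definition hopf_order :: "'b hopf_data \<Rightarrow> complex set \<Rightarrow> ('b \<Rightarrow> complex) set \<Rightarrow> bool" where
  "hopf_order H R Y \<longleftrightarrow>
     subring R (scalar_ring (scalars H)) \<and>
     submodule Y (scalar_ring R) (coord_module (hspace H)) \<and>
     fg_projective (scalar_ring R) (coord_module Y) \<and>
     bij_betw natural_map
       (tensor_product (scalar_ring R) (coord_module Y) (scalar_module (scalars H))) (hspace H) \<and>
     hone H \<in> Y \<and>
     (\<forall>x\<in>Y. \<forall>y\<in>Y. hmult H x y \<in> Y) \<and>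
     (\<forall>x\<in>Y. hcomult H x \<in> tensor_square_image Y) \<and>
     (\<forall>x\<in>Y. hcounit H x \<in> R) \<and>
     (\<forall>x\<in>Y. hantipode H x \<in> Y)"

section \<open>The Hopf algebra \<open>\<B>\<^sub>p\<^sub>,\<^sub>q(\<zeta>)\<close>\<close>

datatype bgen = Sigma_gen | Tau_gen | A_gen | B_gen

definition gpow :: "'x \<Rightarrow> nat \<Rightarrow> 'x gword" where
  "gpow x n = replicate n (x, True)"

definition gconj :: "'x \<Rightarrow> 'x \<Rightarrow> 'x gword" where
  "gconj x y = [(x, True), (y, True), (x, False)]"

definition gcomm :: "'x \<Rightarrow> 'x \<Rightarrow> 'x gword" where
  "gcomm x y = [(x, True), (y, True), (x, False), (y, False)]"

definition Bpq_relations :: "nat \<Rightarrow> nat \<Rightarrow> nat \<Rightarrow> (bgen gword \<times> bgen gword) set" where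
  "Bpq_relations p q r =
     {(gpow Sigma_gen p, []), (gpow Tau_gen p, []), (gpow A_gen q, []), (gpow B_gen q, []),
      (gconj Sigma_gen A_gen, gpow A_gen r), (gconj Tau_gen B_gen, gpow B_gen r),
      (gcomm Sigma_gen B_gen, []), (gcomm Tau_gen A_gen, []),
      (gcomm A_gen B_gen, []), (gcomm Sigma_gen Tau_gen, [])}"

definition Bpq_group :: "nat \<Rightarrow> nat \<Rightarrow> nat \<Rightarrow> bgen gword set monoid" where
  "Bpq_group p q r = presented_group (Bpq_relations p q r)"

definition Bpq_gen :: "nat \<Rightarrow> nat \<Rightarrow> nat \<Rightarrow> bgen \<Rightarrow> bgen gword set" where
  "Bpq_gen p q r x = pres_class (Bpq_relations p q r) [(x, True)]"

definition Bpq_twist :: "nat \<Rightarrow> nat \<Rightarrow> nat \<Rightarrow> complex \<Rightarrow>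
    bgen gword set \<times> bgen gword set \<Rightarrow> complex" where
  "Bpq_twist p q r \<zeta> = (\<lambda>z. 1 / of_nat p * (\<Sum>u<p. \<Sum>v<p. inverse \<zeta> ^ (u * v) *
     vtensor (unit_vec (Bpq_gen p q r Tau_gen [^]\<^bsub>Bpq_group p q r\<^esub> u))
             (unit_vec (Bpq_gen p q r Sigma_gen [^]\<^bsub>Bpq_group p q r\<^esub> v)) z))"

definition Bpq :: "nat \<Rightarrow> nat \<Rightarrow> nat \<Rightarrow> complex \<Rightarrow> bgen gword set hopf_data" where
  "Bpq p q r \<zeta> =
     drinfeld_twist (group_hopf (generate_field complex_ring {\<zeta>}) (Bpq_group p q r))
       (Bpq_twist p q r \<zeta>)"

end

theory Submission
  imports Defs "Jordan_Normal_Form.Schur_Decomposition"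
begin

text \<open>
  Let \<open>X\<close> be a Hopf order. A dual basis of \<open>X\<close> consists of elements of \<open>X\<close> and of functionals that are
  integral on \<open>X\<close>; call an element of the Hopf algebra integral if all these functionals take
  algebraic integers on it. The character of a finite dimensional comodule is integral: the functionals act on the
  comodule, the eigenvalues of their matrices are algebraic integers because the functionals span
  a finite module closed under convolution, and the trace is the sum of the eigenvalues.

  With \<open>e\<^sub>0 = p\<^sup>-\<^sup>1 \<Sum> \<tau>\<^sup>w\<close> and \<open>f\<^sub>0 = p\<^sup>-\<^sup>1 \<Sum> \<sigma>\<^sup>w\<close>, the cocharacters
  \<open>x = e\<^sub>0 \<Sum> \<sigma>\<^sup>i a \<sigma>\<^sup>-\<^sup>i\<close> and \<open>y = f\<^sub>0 \<Sum> \<tau>\<^sup>i b \<tau>\<^sup>-\<^sup>i\<close> are therefore integral, and so is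
  \<open>(y \<otimes> y) \<Delta>(x)\<close>. In a tensor product of two representations induced from characters of
  \<open>\<langle>a, b\<rangle>\<close> this element has a vector fixed by all powers of \<open>\<sigma>\<close> and \<open>\<tau>\<close> as an eigenvector, with eigenvalue
  \<open>\<alpha>\<^sub>c \<alpha>\<^sub>d \<alpha>\<^sub>c\<^sub>' \<alpha>\<^sub>d\<^sub>' / p\<close>, where \<open>\<alpha>\<^sub>c = \<Sum>\<^sub>x \<eta> ^ (c r\<^sup>x)\<close> is a Gauss period for a
  primitive \<open>q\<close>-th root of unity \<open>\<eta>\<close>. Since \<open>\<Sum>\<^sub>c \<eta>\<^sup>-\<^sup>c \<alpha>\<^sub>c = q\<close>, a combination of these
  eigenvalues is \<open>q\<^sup>4 / p\<close>, which is not an algebraic integer.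
\<close>

text \<open>The denominator comes from the coupling of the two tensor factors. On a single induced
  representation y x acts on the fixed vector by \<alpha>_c \<alpha>_d, which is integral anyway.
  \<Delta>(x), however, acts by the sum over i < p of the product of the i-th conjugates of the two
  characters of a, and this does not factor. The factor y \<otimes> y averages over the powers of
  \<sigma> in each tensor factor separately and replaces either conjugate by \<alpha> / p; so p
  terms with denominator p^2 leave 1 / p. The role of the twist is to make x and y cocharacters in
  spite of the denominators of e_0 and f_0. A single eigenvalue proves nothing by itself: for
  trivial characters it is p^3. Summing against the powers \<eta>^(-c) replaces a study of the
  primes that divide the Gauss periods. An order is only known to be projective, so the functionals
  of its dual basis replace coordinates, and eigenvectors are formed from values at possibly
  dependent generators.\<close>

hide_const (open) Matrix.unit_vec LinearCombinations.mod_hom LinearCombinations.submodule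
hide_fact (open) Matrix.unit_vec_def LinearCombinations.mod_hom_def LinearCombinations.submodule_def

section \<open>Algebraic integers\<close>

text \<open>Integrality is handled through finitely generated additive subgroups of the complex
  numbers, which are spans in this module.\<close>

interpretation int_module: Modules.module "\<lambda>(c::int) (x::complex). of_int c * x"
  by unfold_locales (simp_all add: algebra_simps)

lemma int_span_mult:
  assumes "x \<in> int_module.span V" "\<And>v. v \<in> V \<Longrightarrow> w * v \<in> int_module.span U"
  shows "w * x \<in> int_module.span U"
  using assms(1)
proof (induction rule: int_module.span_induct_alt)
  case base
  then show ?case by (simp add: int_module.span_zero)
next
  case (step c x y)
  have "w * (of_int c * x + y) = of_int c * (w * x) + w * y" by (simp add: algebra_simps)
  then show ?case using step assms(2)
    by (metis int_module.span_add int_module.span_scale)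
qed

text \<open>The powers of \<open>x\<close> below the degree of a monic polynomial annihilating
  \<open>x\<close> generate the stable module; the next power is rewritten by that
  polynomial.\<close>

lemma algebraic_int_imp_int_span:
  assumes "algebraic_int (x::complex)"
  obtains W where "finite W" "1 \<in> W" "\<And>w. w \<in> W \<Longrightarrow> x * w \<in> int_module.span W"
proof -
  from assms obtain P where P: "lead_coeff P = 1" "\<And>i. coeff P i \<in> \<int>" "poly P x = 0"
    by (auto elim: algebraic_int.cases)
  \<comment> \<open>Excludes an empty \<open>W\<close>, which could not contain 1 = x^0.\<close>
  have deg: "degree P > 0"
  proof (rule ccontr)
    assume "\<not> 0 < degree P"
    then have "P = [:coeff P 0:]" by (metis degree_eq_zeroE gr0I coeff_pCons_0)
    with P show False by (metis degree_pCons_0 mult_zero_right poly_0 poly_pCons add.right_neutral zero_neq_one)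
  qed
  define W where "W = (\<lambda>i. x ^ i) ` {..<degree P}"
  have "x * w \<in> int_module.span W" if "w \<in> W" for w
  proof -
    from that obtain i where i: "i < degree P" "w = x ^ i" by (auto simp: W_def)
    show ?thesis
    proof (cases "Suc i < degree P")
      case True
      then have "x ^ Suc i \<in> W" unfolding W_def by blast
      then show ?thesis by (simp add: i int_module.span_base)
    next
      case False
      then have n: "Suc i = degree P" using i by simp
      have "0 = (\<Sum>k\<le>degree P. coeff P k * x ^ k)" using P by (simp add: poly_altdef)
      also have "\<dots> = (\<Sum>k<degree P. coeff P k * x ^ k) + x ^ degree P"
        using P(1) by (simp add: lessThan_Suc_atMost[symmetric])
      finally have "x ^ degree P = - (\<Sum>k<degree P. coeff P k * x ^ k)"
        by (metis add.commute add_eq_0_iff)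
      moreover have "x * w = x ^ degree P" by (simp add: i(2) n[symmetric])
      ultimately have "x * w = (\<Sum>k<degree P. - coeff P k * x ^ k)" by (simp add: sum_negf)
      \<comment> \<open>The coefficients are only known to lie in \<int>; the floor of the real part
        names the integer.\<close>
      also have "\<dots> = (\<Sum>k<degree P. of_int (\<lfloor>Re (- coeff P k)\<rfloor>) * x ^ k)"
      proof (rule sum.cong, simp)
        fix k
        from P(2)[of k] obtain m where m: "coeff P k = of_int m" by (auto elim: Ints_cases)
        have "Re (- coeff P k) = of_int (- m)" by (simp add: m)
        then have "\<lfloor>Re (- coeff P k)\<rfloor> = - m" by (metis floor_of_int)
        then show "- coeff P k * x ^ k = of_int (\<lfloor>Re (- coeff P k)\<rfloor>) * x ^ k" by (simp add: m)
      qed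
      also have "\<dots> \<in> int_module.span W"
        by (intro int_module.span_sum int_module.span_scale int_module.span_base) (auto simp: W_def)
      finally show ?thesis .
    qed
  qed
  moreover have "finite W" "1 \<in> W" using deg by (auto simp: W_def intro!: image_eqI[of _ _ 0])
  ultimately show ?thesis using that by blast
qed

text \<open>Determinant trick: the generators form an eigenvector with eigenvalue \<open>x\<close>
  of an integer matrix, whose characteristic polynomial is monic. The generator \<open>w0\<close>
  keeps this vector from being zero.\<close>

lemma int_span_imp_algebraic_int:
  fixes x :: complex
  assumes W: "finite W" "w0 \<in> W" "w0 \<noteq> 0" and stable: "\<And>w. w \<in> W \<Longrightarrow> x * w \<in> int_module.span W"
  shows "algebraic_int x"
proof -
  obtain ws where ws: "set ws = W" "distinct ws" using finite_distinct_list[OF W(1)] by blast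
  let ?n = "length ws"
  have "\<exists>c. x * w = (\<Sum>v\<in>W. of_int (c v) * v)" if "w \<in> W" for w
    using stable[OF that] unfolding int_module.span_finite[OF W(1)] by auto
  then obtain c where c: "\<And>w. w \<in> W \<Longrightarrow> x * w = (\<Sum>v\<in>W. of_int (c w v) * v)" by metis
  define M where "M = mat ?n ?n (\<lambda>(i, k). c (ws ! i) (ws ! k))"
  have M: "M \<in> carrier_mat ?n ?n" by (simp add: M_def)
  have "eigenvector (map_mat of_int M) (vec_of_list ws) x"
    unfolding eigenvector_def
  proof (intro conjI)
    show "vec_of_list ws \<in> carrier_vec (dim_row (map_mat complex_of_int M))"
      unfolding M_def by (rule carrier_vecI) simp
    from W(2) ws obtain i where "i < ?n" "ws ! i = w0" by (metis in_set_conv_nth)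
    then have "vec_of_list ws $ i \<noteq> 0" "i < ?n" using W(3) by (simp_all add: vec_of_list_index)
    then show "vec_of_list ws \<noteq> 0\<^sub>v (dim_row (map_mat complex_of_int M))"
      unfolding M_def by (metis dim_row_mat(1) index_map_mat(2) index_zero_vec(1))
    show "map_mat complex_of_int M *\<^sub>v vec_of_list ws = x \<cdot>\<^sub>v vec_of_list ws"
    proof (rule eq_vecI)
      fix i assume "i < dim_vec (x \<cdot>\<^sub>v vec_of_list ws)"
      then have i: "i < ?n" by simp
      then have "(map_mat complex_of_int M *\<^sub>v vec_of_list ws) $ i =
          (\<Sum>k<?n. of_int (c (ws ! i) (ws ! k)) * ws ! k)"
        using M by (simp add: scalar_prod_def M_def vec_of_list_index lessThan_atLeast0)
      also have "\<dots> = (\<Sum>v\<in>W. of_int (c (ws ! i) v) * v)"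
        using ws by (intro sum.reindex_bij_betw[of "(!) ws"] ) (auto intro!: bij_betw_nth)
      also have "\<dots> = x * ws ! i" using c i ws by (metis nth_mem)
      finally show "(map_mat complex_of_int M *\<^sub>v vec_of_list ws) $ i = (x \<cdot>\<^sub>v vec_of_list ws) $ i"
        using i by (simp add: vec_of_list_index)
    qed (use M in simp)
  qed
  then have "eigenvalue (map_mat of_int M) x" by (auto simp: eigenvalue_def)
  then have "poly (char_poly (map_mat of_int M)) x = 0"
    using eigenvalue_root_char_poly[of "map_mat of_int M" ?n x] M by simp
  then have "poly (map_poly of_int (char_poly M)) x = 0"
    by (simp add: of_int_hom.char_poly_hom[OF M])
  moreover have "lead_coeff (char_poly M) = 1" using degree_monic_char_poly[OF M] by simp
  ultimately show ?thesis by (auto simp: algebraic_int_altdef_ipoly)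
qed

text \<open>One module serves all of \<open>S\<close> at once: adding an element multiplies the
  generators pairwise, which preserves stability in either factor.\<close>

lemma finite_algebraic_int_int_span:
  assumes "finite S" "\<And>s. s \<in> S \<Longrightarrow> algebraic_int (s::complex)"
  shows "\<exists>W. finite W \<and> 1 \<in> W \<and> (\<forall>s\<in>S. \<forall>w\<in>W. s * w \<in> int_module.span W)"
  using assms
proof (induction rule: finite_induct)
  case empty
  then show ?case by (intro exI[of _ "{1}"]) auto
next
  case (insert x S)
  from insert obtain W where W: "finite W" "1 \<in> W" "\<forall>s\<in>S. \<forall>w\<in>W. s * w \<in> int_module.span W"
    by auto
  from insert.prems have "algebraic_int x" by simp
  then obtain V where V: "finite V" "1 \<in> V" "\<And>v. v \<in> V \<Longrightarrow> x * v \<in> int_module.span V"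
    using algebraic_int_imp_int_span by blast
  define U where "U = (\<lambda>(v, w). v * w) ` (V \<times> W)"
  have U: "v * w \<in> int_module.span U" if "v \<in> V" "w \<in> W" for v w
    using that by (auto simp: U_def intro!: int_module.span_base)
  have "x * (v * w) \<in> int_module.span U" if "v \<in> V" "w \<in> W" for v w
  proof -
    have "w * (x * v) \<in> int_module.span U"
      using that V U by (intro int_span_mult[of "x * v" V]) (auto simp: mult.commute[of w])
    then show ?thesis by (simp add: mult.left_commute mult.commute)
  qed
  moreover have "s * (v * w) \<in> int_module.span U" if "v \<in> V" "w \<in> W" "s \<in> S" for v w s
  proof -
    have "v * (s * w) \<in> int_module.span U"
      using that W U by (intro int_span_mult[of "s * w" W]) auto
    then show ?thesis by (simp add: mult.left_commute mult.commute)
  qed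
  moreover have "finite U" "1 \<in> U" using V W by (auto simp: U_def intro!: image_eqI[of _ _ "(1, 1)"])
  ultimately show ?case
    by (intro exI[of _ U] conjI ballI) (auto simp: U_def)
qed

text \<open>If the span of \<open>W\<close> is stable under all entries of \<open>M\<close>, then
  the span of the products u_i w is stable under \<open>x\<close>. This bypasses polynomials with
  algebraic integer coefficients.\<close>

lemma algebraic_int_eigenvalue:
  fixes u :: "'i \<Rightarrow> complex"
  assumes I: "finite I" "i0 \<in> I" "u i0 \<noteq> 0"
    and M: "\<And>i k. i \<in> I \<Longrightarrow> k \<in> I \<Longrightarrow> algebraic_int (M i k)"
    and eq: "\<And>i. i \<in> I \<Longrightarrow> x * u i = (\<Sum>k\<in>I. M i k * u k)"
  shows "algebraic_int x"
proof -
  have "\<exists>W. finite W \<and> 1 \<in> W \<and> (\<forall>s\<in>(\<lambda>(i, k). M i k) ` (I \<times> I). \<forall>w\<in>W. s * w \<in> int_module.span W)"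
    using I M by (intro finite_algebraic_int_int_span) auto
  then obtain W where W: "finite W" "1 \<in> W"
    "\<And>i k w. i \<in> I \<Longrightarrow> k \<in> I \<Longrightarrow> w \<in> W \<Longrightarrow> M i k * w \<in> int_module.span W" by auto
  define U where "U = (\<lambda>(i, w). u i * w) ` (I \<times> W)"
  have U: "u i * w \<in> int_module.span U" if "i \<in> I" "w \<in> W" for i w
    using that by (auto simp: U_def intro!: int_module.span_base)
  show ?thesis
  proof (rule int_span_imp_algebraic_int)
    show "finite U" using I W by (simp add: U_def)
    show "u i0 \<in> U" using I W by (auto simp: U_def intro!: image_eqI[of _ _ "(i0, 1)"])
    fix z assume "z \<in> U"
    then obtain i w where z: "z = u i * w" "i \<in> I" "w \<in> W" by (auto simp: U_def)
    have "x * z = (\<Sum>k\<in>I. u k * (M i k * w))"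
    proof -
      have "x * z = (x * u i) * w" by (simp add: z(1) mult.assoc)
      also have "\<dots> = (\<Sum>k\<in>I. M i k * u k * w)" by (simp add: eq[OF z(2)] sum_distrib_right)
      also have "\<dots> = (\<Sum>k\<in>I. u k * (M i k * w))" by (simp add: mult_ac)
      finally show ?thesis .
    qed
    also have "\<dots> \<in> int_module.span U"
    proof (rule int_module.span_sum)
      fix k assume "k \<in> I"
      then show "u k * (M i k * w) \<in> int_module.span U"
        using W(3)[OF z(2) _ z(3)] U by (intro int_span_mult[of "M i k * w" W "u k"])
    qed
    finally show "x * z \<in> int_module.span U" .
  qed (use I in simp)
qed

lemma
  assumes "algebraic_int (x::complex)" "algebraic_int y"
  shows algebraic_int_add: "algebraic_int (x + y)" and algebraic_int_mult: "algebraic_int (x * y)"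
proof -
  obtain W where W: "finite W" "1 \<in> W" "\<forall>s\<in>{x, y}. \<forall>w\<in>W. s * w \<in> int_module.span W"
    using finite_algebraic_int_int_span[of "{x, y}"] assms by auto
  show "algebraic_int (x + y)" using W
    by (intro int_span_imp_algebraic_int[OF W(1,2)]) (auto simp: distrib_right int_module.span_add)
  show "algebraic_int (x * y)" using W
    by (intro int_span_imp_algebraic_int[OF W(1,2)]) (auto simp: mult.assoc intro: int_span_mult)
qed

lemma algebraic_int_sum:
  "(\<And>i. i \<in> A \<Longrightarrow> algebraic_int (f i :: complex)) \<Longrightarrow> algebraic_int (sum f A)"
  by (induction A rule: infinite_finite_induct) (auto intro: algebraic_int_add)

text \<open>The trace is the sum of the eigenvalues, by triangularisation.\<close>

lemma algebraic_int_trace: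
  fixes A :: "nat \<Rightarrow> nat \<Rightarrow> complex"
  assumes ev: "\<And>x v i. i < n \<Longrightarrow> v i \<noteq> 0 \<Longrightarrow> (\<And>i. i < n \<Longrightarrow> x * v i = (\<Sum>k<n. A i k * v k)) \<Longrightarrow>
      algebraic_int x"
  shows "algebraic_int (\<Sum>i<n. A i i)"
proof -
  define M where "M = mat n n (\<lambda>(i, k). A i k)"
  have M: "M \<in> carrier_mat n n" by (simp add: M_def)
  obtain es where es: "char_poly M = (\<Prod>e\<leftarrow>es. [:- e, 1:])" "length es = n"
    using char_poly_factorized[OF M] by blast
  obtain B P Q where "schur_decomposition M es = (B, P, Q)" by (metis prod_cases3)
  from schur_decomposition[OF M es(1) this]
  have sim: "similar_mat_wit M B P Q" and diag: "diag_mat B = es" by auto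
  note simD = similar_mat_witD2[OF M sim]
  have *: "Q * P = 1\<^sub>m n" "M = P * B * Q" "B \<in> carrier_mat n n" "P \<in> carrier_mat n n"
    "Q \<in> carrier_mat n n"
    by (fact simD)+
  have QP: "(\<Sum>i<n. Q $$ (l, i) * P $$ (i, k)) = (if l = k then 1 else 0)" if "l < n" "k < n" for l k
  proof -
    have "(Q * P) $$ (l, k) = (\<Sum>i<n. Q $$ (l, i) * P $$ (i, k))"
      using *(4,5) that by (simp add: scalar_prod_def lessThan_atLeast0)
    then show ?thesis using that by (simp add: *(1))
  qed
  have "(\<Sum>i<n. A i i) = (\<Sum>i<n. M $$ (i, i))" by (simp add: M_def)
  also have "\<dots> = (\<Sum>i<n. \<Sum>k<n. P $$ (i, k) * (\<Sum>l<n. B $$ (k, l) * Q $$ (l, i)))"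
    using *(3-5) by (intro sum.cong refl) (simp add: *(2) scalar_prod_def lessThan_atLeast0)
  also have "\<dots> = (\<Sum>i<n. \<Sum>k<n. \<Sum>l<n. B $$ (k, l) * (Q $$ (l, i) * P $$ (i, k)))"
    unfolding sum_distrib_left by (intro sum.cong refl) (simp add: mult_ac)
  also have "\<dots> = (\<Sum>k<n. \<Sum>i<n. \<Sum>l<n. B $$ (k, l) * (Q $$ (l, i) * P $$ (i, k)))"
    by (rule sum.swap)
  also have "\<dots> = (\<Sum>k<n. \<Sum>l<n. \<Sum>i<n. B $$ (k, l) * (Q $$ (l, i) * P $$ (i, k)))"
    by (intro sum.cong refl sum.swap)
  also have "\<dots> = (\<Sum>k<n. \<Sum>l<n. B $$ (k, l) * (if l = k then 1 else 0))"
    by (intro sum.cong refl) (simp add: QP flip: sum_distrib_left)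
  also have "\<dots> = (\<Sum>l<n. B $$ (l, l))"
    by (intro sum.cong refl) (simp add: if_distrib cong: if_cong)
  finally have tr: "(\<Sum>i<n. A i i) = (\<Sum>l<n. B $$ (l, l))" .
  have "algebraic_int (B $$ (l, l))" if "l < n" for l
  proof -
    have "B $$ (l, l) \<in> set es" using that *(3) by (auto simp: diag[symmetric] diag_mat_def)
    then have "poly (char_poly M) (B $$ (l, l)) = 0"
      unfolding es(1) poly_prod_list by (auto simp: prod_list_zero_iff)
    then have "eigenvalue M (B $$ (l, l))" by (simp add: eigenvalue_root_char_poly[OF M])
    then obtain v where v: "v \<in> carrier_vec n" "v \<noteq> 0\<^sub>v n" "M *\<^sub>v v = B $$ (l, l) \<cdot>\<^sub>v v"
      using M by (auto simp: eigenvalue_def eigenvector_def)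
    then obtain i where i: "i < n" "v $ i \<noteq> 0" by (metis carrier_vecD eq_vecI index_zero_vec)
    show ?thesis
    proof (rule ev[of i "\<lambda>i. v $ i"])
      fix i assume i: "i < n"
      have "(M *\<^sub>v v) $ i = (\<Sum>k<n. A i k * v $ k)"
        using i v(1) by (simp add: M_def scalar_prod_def lessThan_atLeast0)
      then show "B $$ (l, l) * v $ i = (\<Sum>k<n. A i k * v $ k)" using v i by simp
    qed (use i in auto)
  qed
  then show ?thesis unfolding tr by (intro algebraic_int_sum) auto
qed

section \<open>Dual bases of orders\<close>

text \<open>A functional is stored by its values on the basis \<open>B\<close>, so every function is
  one and linearity is automatic.\<close>

definition pairing :: "'b set \<Rightarrow> ('b \<Rightarrow> complex) \<Rightarrow> ('b \<Rightarrow> complex) \<Rightarrow> complex" where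
  "pairing B F h = (\<Sum>b\<in>B. F b * h b)"

lemma pairing_sum:
  "pairing B F (\<lambda>b. \<Sum>i\<in>I. c i * h i b) = (\<Sum>i\<in>I. c i * pairing B F (h i))"
  unfolding pairing_def sum_distrib_left by (subst sum.swap) (simp add: mult_ac)

lemma pairing_sum_mset:
  "pairing B F (\<lambda>b. \<Sum>(x, c)\<in>#A. c * x b) = (\<Sum>(x, c)\<in>#A. c * pairing B F x)"
  by (induction A) (auto simp: pairing_def algebra_simps sum.distrib sum_distrib_left)

lemma pairing_vtensor:
  "pairing (B \<times> C) (vtensor F G) (vtensor x y) = pairing B F x * pairing C G y"
  unfolding pairing_def vtensor_def sum_product sum.cartesian_product
  by (intro sum.cong) auto

lemma coord_space_UNIV_iff: "x \<in> coord_space UNIV B \<longleftrightarrow> (\<forall>b. b \<notin> B \<longrightarrow> x b = 0)"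
  by (simp add: coord_space_def)

lemma coord_space_UNIV_expand:
  assumes "finite B" "x \<in> coord_space UNIV B"
  shows "x = (\<lambda>c. \<Sum>b\<in>B. x b * unit_vec b c)"
  using assms by (auto simp: fun_eq_iff unit_vec_def coord_space_UNIV_iff if_distrib cong: if_cong)

definition linear_comb :: "(('b \<Rightarrow> complex) \<times> complex) multiset \<Rightarrow> 'b \<Rightarrow> complex" where
  "linear_comb A = (\<lambda>b. \<Sum>(x, c)\<in>#A. c * x b)"

lemma tensor_cong_linear_comb:
  assumes "tensor_cong R (coord_module Y) (scalar_module F) A B"
  shows "linear_comb A = linear_comb B"
  using assms
  by induction (auto simp: linear_comb_def coord_module_def scalar_module_def algebra_simps fun_eq_iff)

text \<open>An R-linear \<phi> extends to Y \<otimes> F by x \<otimes> c \<mapsto> c \<phi>(x); this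
  is the independence of the representative.\<close>

lemma tensor_cong_sum_mset:
  assumes "tensor_cong (scalar_ring R) (coord_module Y) (scalar_module F) A B"
    and "\<And>x y. x \<in> Y \<Longrightarrow> y \<in> Y \<Longrightarrow> \<phi> (\<lambda>b. x b + y b) = \<phi> x + \<phi> y"
    and "\<And>c x. c \<in> R \<Longrightarrow> x \<in> Y \<Longrightarrow> \<phi> (\<lambda>b. c * x b) = c * \<phi> x"
    and "\<phi> (\<lambda>b. 0) = 0"
  shows "(\<Sum>(x, c)\<in>#A. c * \<phi> x) = (\<Sum>(x, c)\<in>#B. c * (\<phi> x :: complex))"
  using assms(1)
proof induction
  case (tc_add_left x x' y)
  then show ?case using assms(2) by (simp add: coord_module_def algebra_simps)
next
  case (tc_smult c x y)
  then show ?case using assms(3) by (simp add: coord_module_def scalar_module_def scalar_ring_def)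
qed (auto simp: coord_module_def scalar_module_def algebra_simps assms(4))

lemma natural_map_class:
  assumes "set_mset A \<subseteq> Y \<times> F"
  shows "natural_map ({(A, B). tensor_cong R (coord_module Y) (scalar_module F) A B} `` {A}) =
    linear_comb A"
proof -
  have "tensor_cong R (coord_module Y) (scalar_module F) A A"
    using assms by (intro tc_refl) (auto simp: coord_module_def scalar_module_def)
  then have "A \<in> {(A, B). tensor_cong R (coord_module Y) (scalar_module F) A B} `` {A}" by simp
  moreover have "linear_comb C = linear_comb A"
    if "C \<in> {(A, B). tensor_cong R (coord_module Y) (scalar_module F) A B} `` {A}" for C
    using that tensor_cong_linear_comb[of R Y F A C] by simp
  ultimately have "linear_comb ` ({(A, B). tensor_cong R (coord_module Y) (scalar_module F) A B} `` {A}) =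
      {linear_comb A}"
    by (metis (no_types, lifting) empty_iff image_cong image_constant_conv)
  then show ?thesis by (simp add: natural_map_def linear_comb_def[abs_def])
qed

lemma
  assumes "bij_betw natural_map (tensor_product R (coord_module Y) (scalar_module F)) V"
  shows natural_map_surjD: "h \<in> V \<Longrightarrow> \<exists>A. set_mset A \<subseteq> Y \<times> F \<and> h = linear_comb A"
    and natural_map_injD: "set_mset A \<subseteq> Y \<times> F \<Longrightarrow> set_mset A' \<subseteq> Y \<times> F \<Longrightarrow>
      linear_comb A = linear_comb A' \<Longrightarrow> tensor_cong R (coord_module Y) (scalar_module F) A A'"
proof -
  let ?r = "{(A, B). tensor_cong R (coord_module Y) (scalar_module F) A B}"
  have T: "tensor_product R (coord_module Y) (scalar_module F) = {A. set_mset A \<subseteq> Y \<times> F} // ?r"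
    by (simp add: tensor_product_def coord_module_def scalar_module_def)
  show "\<exists>A. set_mset A \<subseteq> Y \<times> F \<and> h = linear_comb A" if "h \<in> V"
  proof -
    from assms that have "h \<in> natural_map ` ({A. set_mset A \<subseteq> Y \<times> F} // ?r)"
      by (simp add: bij_betw_def T)
    then obtain A where "set_mset A \<subseteq> Y \<times> F" "h = natural_map (?r `` {A})"
      by (auto elim!: quotientE)
    then show ?thesis using natural_map_class by blast
  qed
  assume A: "set_mset A \<subseteq> Y \<times> F" "set_mset A' \<subseteq> Y \<times> F" and eq: "linear_comb A = linear_comb A'"
  have inj: "inj_on natural_map ({A. set_mset A \<subseteq> Y \<times> F} // ?r)"
    using assms by (simp add: bij_betw_def T)
  have "?r `` {A} = ?r `` {A'}"
  proof (rule inj_onD[OF inj])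
    show "natural_map (?r `` {A}) = natural_map (?r `` {A'})"
      by (simp only: natural_map_class A eq)
  qed (use A in \<open>auto intro!: quotientI simp del: Image_Collect_case_prod\<close>)
  moreover have "tensor_cong R (coord_module Y) (scalar_module F) A' A'"
    using A by (intro tc_refl) (auto simp: coord_module_def scalar_module_def)
  ultimately show "tensor_cong R (coord_module Y) (scalar_module F) A A'" by blast
qed

text \<open>Dual basis lemma: the \<open>x k\<close> are the images of the standard vectors under
  the projection, the \<open>\<phi> k\<close> are the coordinates of the embedding.\<close>

lemma fg_projective_dual_basis:
  assumes proj: "fg_projective (scalar_ring R) (coord_module Y)"
    and R: "0 \<in> R" "1 \<in> R"
  obtains n :: nat and x \<phi> where "\<And>k. k < n \<Longrightarrow> x k \<in> Y"
    "\<And>k y. k < n \<Longrightarrow> y \<in> Y \<Longrightarrow> \<phi> k y \<in> R"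
    "\<And>k y z. k < n \<Longrightarrow> y \<in> Y \<Longrightarrow> z \<in> Y \<Longrightarrow> \<phi> k (\<lambda>b. y b + z b) = \<phi> k y + \<phi> k z"
    "\<And>k c y. k < n \<Longrightarrow> c \<in> R \<Longrightarrow> y \<in> Y \<Longrightarrow> \<phi> k (\<lambda>b. c * y b) = c * \<phi> k y"
    "\<And>y. y \<in> Y \<Longrightarrow> y = (\<lambda>b. \<Sum>k<n. \<phi> k y * x k b)"
proof -
  from proj obtain n i \<pi> where i: "i \<in> mod_hom (scalar_ring R) (coord_module Y) (free_module (scalar_ring R) n)"
    and \<pi>: "\<pi> \<in> mod_hom (scalar_ring R) (free_module (scalar_ring R) n) (coord_module Y)"
    and \<pi>i: "\<And>y. y \<in> Y \<Longrightarrow> \<pi> (i y) = y"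
    unfolding fg_projective_def by (auto simp: coord_module_def)
  let ?free = "{..<n} \<rightarrow>\<^sub>E R"
  have ops: "\<zero>\<^bsub>scalar_ring R\<^esub> = 0" "carrier (scalar_ring R) = R"
    "x \<oplus>\<^bsub>scalar_ring R\<^esub> y = x + y" "x \<otimes>\<^bsub>scalar_ring R\<^esub> y = x * y" for x y
    by (simp_all add: scalar_ring_def ring_of_type_algebra_def)
  define e where "e k = (\<lambda>j\<in>{..<n}. if j = k then 1 else (0::complex))" for k
  have e: "e k \<in> ?free" for k using R by (auto simp: e_def)
  have \<pi>_in: "\<pi> c \<in> Y" if "c \<in> ?free" for c
    using \<pi> that by (auto simp: mod_hom_def free_module_def coord_module_def ops)
  have \<pi>_add: "\<pi> (\<lambda>j\<in>{..<n}. c j + d j) = (\<lambda>b. \<pi> c b + \<pi> d b)" if "c \<in> ?free" "d \<in> ?free" for c d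
    using \<pi> that by (auto simp: mod_hom_def free_module_def coord_module_def ops)
  have \<pi>_smult: "\<pi> (\<lambda>j\<in>{..<n}. a * c j) = (\<lambda>b. a * \<pi> c b)" if "a \<in> R" "c \<in> ?free" for a c
    using \<pi> that by (auto simp: mod_hom_def free_module_def coord_module_def ops)
  \<comment> \<open>Additivity is given for two summands only, hence the induction on the number
    \<open>m\<close> of coordinates that are kept.\<close>
  have expand: "\<pi> (\<lambda>j\<in>{..<n}. if j < m then c j else 0) = (\<lambda>b. \<Sum>k<m. c k * \<pi> (e k) b)"
    if c: "c \<in> ?free" and m: "m \<le> n" for c m
    using m
  proof (induction m)
    case 0
    \<comment> \<open>The zero vector is 0 times a vector, so homogeneity shows that \<pi> maps it
      to 0.\<close>
    have "(\<lambda>j\<in>{..<n}. 0 * e 0 j) = (\<lambda>j\<in>{..<n}. if j < 0 then c j else 0)" by auto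
    then show ?case by (metis (no_types, lifting) \<pi>_smult[OF R(1) e, of 0] lessThan_0 mult_zero_left sum.empty)
  next
    case (Suc m)
    have cm: "c m \<in> R" using PiE_mem[OF c, of m] Suc.prems by simp
    let ?c = "\<lambda>j\<in>{..<n}. if j < m then c j else 0" and ?d = "\<lambda>j\<in>{..<n}. c m * e m j"
    have "?d = (\<lambda>j\<in>{..<n}. if j = m then c m else 0)" by (auto simp: e_def)
    then have d: "?d \<in> ?free" using R(1) cm by (simp add: PiE_iff)
    have c': "?c \<in> ?free" using R(1) c by (simp add: PiE_iff)
    have eq: "(\<lambda>j\<in>{..<n}. if j < Suc m then c j else 0) = (\<lambda>j\<in>{..<n}. ?c j + ?d j)"
      by (rule restrict_ext) (auto simp: e_def less_Suc_eq)
    have IH: "\<pi> ?c = (\<lambda>b. \<Sum>k<m. c k * \<pi> (e k) b)"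
      using Suc.prems by (intro Suc.IH) simp
    show ?case
      unfolding eq \<pi>_add[OF c' d] IH \<pi>_smult[OF cm e[of m]] by simp
  qed
  have i_in: "i y \<in> ?free" if "y \<in> Y" for y
    using i that by (auto simp: mod_hom_def free_module_def coord_module_def ops)
  show ?thesis
  proof (rule that[of n "\<lambda>k. \<pi> (e k)" "\<lambda>k y. i y k"])
    show "i y k \<in> R" if "k < n" "y \<in> Y" for k y using i_in that by auto
    show "i (\<lambda>b. y b + z b) k = i y k + i z k" if "k < n" "y \<in> Y" "z \<in> Y" for k y z
      using i that by (auto simp: mod_hom_def free_module_def coord_module_def ops)
    show "i (\<lambda>b. c * y b) k = c * i y k" if "k < n" "c \<in> R" "y \<in> Y" for k c y
      using i that by (auto simp: mod_hom_def free_module_def coord_module_def ops)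
    show "y = (\<lambda>b. \<Sum>k<n. i y k * \<pi> (e k) b)" if y: "y \<in> Y" for y
    proof -
      have "(\<lambda>j\<in>{..<n}. if j < n then i y j else 0) = i y"
        using i_in[OF y] by (auto simp: fun_eq_iff PiE_def extensional_def)
      then show ?thesis using expand[OF i_in[OF y], of n] \<pi>i[OF y] by simp
    qed
  qed (use \<pi>_in e in auto)
qed

text \<open>Bijectivity of the natural map lets the dual basis functionals of \<open>Y\<close> extend to \<open>V\<close>.\<close>

lemma order_dual_basis:
  assumes proj: "fg_projective (scalar_ring R) (coord_module Y)"
    and R: "0 \<in> R" "1 \<in> R" and zero: "(\<lambda>b. 0) \<in> Y" and YV: "Y \<subseteq> coord_space UNIV B"
    and bij: "bij_betw natural_map
      (tensor_product (scalar_ring R) (coord_module Y) (scalar_module UNIV)) (coord_space UNIV B)"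
    and B: "finite B"
  obtains n :: nat and x F where "\<And>k. k < n \<Longrightarrow> x k \<in> Y"
    "\<And>k y. k < n \<Longrightarrow> y \<in> Y \<Longrightarrow> pairing B (F k) y \<in> R"
    "\<And>h. h \<in> coord_space UNIV B \<Longrightarrow> h = (\<lambda>b. \<Sum>k<n. pairing B (F k) h * x k b)"
proof -
  obtain n :: nat and x \<phi> where x: "\<And>k. k < n \<Longrightarrow> x k \<in> Y"
    and \<phi>_in: "\<And>k y. k < n \<Longrightarrow> y \<in> Y \<Longrightarrow> \<phi> k y \<in> R"
    and \<phi>_add: "\<And>k y z. k < n \<Longrightarrow> y \<in> Y \<Longrightarrow> z \<in> Y \<Longrightarrow> \<phi> k (\<lambda>b. y b + z b) = \<phi> k y + \<phi> k z"
    and \<phi>_smult: "\<And>k c y. k < n \<Longrightarrow> c \<in> R \<Longrightarrow> y \<in> Y \<Longrightarrow> \<phi> k (\<lambda>b. c * y b) = c * \<phi> k y"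
    and expand: "\<And>y. y \<in> Y \<Longrightarrow> y = (\<lambda>b. \<Sum>k<n. \<phi> k y * x k b)"
    using fg_projective_dual_basis[OF proj R] by blast
  have \<phi>_zero: "\<phi> k (\<lambda>b. 0) = 0" if "k < n" for k
    using \<phi>_smult[OF that R(1) zero] by simp
  have "\<exists>A. set_mset A \<subseteq> Y \<times> UNIV \<and> unit_vec b = linear_comb A" if "b \<in> B" for b
    by (rule natural_map_surjD[OF bij]) (use that in \<open>auto simp: coord_space_UNIV_iff unit_vec_def\<close>)
  then obtain A where A: "\<And>b. b \<in> B \<Longrightarrow> set_mset (A b) \<subseteq> Y \<times> UNIV"
    "\<And>b. b \<in> B \<Longrightarrow> unit_vec b = linear_comb (A b)" by metis
  \<comment> \<open>The extended functional, evaluated at a basis vector through a chosen preimage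
    of that vector in the tensor product.\<close>
  define F where "F k b = (\<Sum>(x, c)\<in>#A b. c * \<phi> k x)" for k b
  have pair: "pairing B (F k) y = \<phi> k y" if k: "k < n" and y: "y \<in> Y" for k y
  proof -
    \<comment> \<open>\<open>A'\<close> assembles the chosen preimages with the coordinates of
      \<open>y\<close>. Both \<open>A'\<close> and y \<otimes> 1 are mapped to \<open>y\<close>, so
      injectivity of the natural map makes them congruent and the extension of
      \<open>\<phi> k\<close> agrees on them.\<close>
    define A' where "A' = (\<Sum>b\<in>B. image_mset (\<lambda>(x, c). (x, y b * c)) (A b))"
    have scale: "(\<Sum>(x, c)\<in>#image_mset (\<lambda>(x, c). (x, a * c)) M. c * \<psi> x) =
        a * (\<Sum>(x, c)\<in>#M. c * \<psi> x)" for a M and \<psi> :: "('a \<Rightarrow> complex) \<Rightarrow> complex"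
      by (induction M) (auto simp: algebra_simps)
    have sum: "(\<Sum>(x, c)\<in>#A'. c * \<psi> x) = (\<Sum>b\<in>B. y b * (\<Sum>(x, c)\<in>#A b. c * \<psi> x))"
      for \<psi> :: "('a \<Rightarrow> complex) \<Rightarrow> complex"
      unfolding A'_def using B
      by (induction B rule: finite_induct) (auto simp: scale)
    have "linear_comb A' = (\<lambda>b'. \<Sum>b\<in>B. y b * unit_vec b b')"
      using A(2) by (auto simp: linear_comb_def sum fun_eq_iff intro!: sum.cong)
    also have "\<dots> = linear_comb {#(y, 1)#}"
      using coord_space_UNIV_expand[OF B, of y] YV y by (simp add: linear_comb_def subset_iff)
    finally have "tensor_cong (scalar_ring R) (coord_module Y) (scalar_module UNIV) A' {#(y, 1)#}"
    proof (rule natural_map_injD[OF bij, rotated 2])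
      show "set_mset A' \<subseteq> Y \<times> UNIV" using A(1) B by (fastforce simp: A'_def set_mset_sum)
    qed (use y in auto)
    then have "(\<Sum>(x, c)\<in>#A'. c * \<phi> k x) = (\<Sum>(x, c)\<in>#{#(y, 1)#}. c * \<phi> k x)"
      by (rule tensor_cong_sum_mset) (use k \<phi>_add \<phi>_smult \<phi>_zero in auto)
    then show ?thesis by (simp add: sum pairing_def F_def mult.commute)
  qed
  show ?thesis
  proof (rule that[of n x F])
    show "h = (\<lambda>b. \<Sum>k<n. pairing B (F k) h * x k b)" if h: "h \<in> coord_space UNIV B" for h
    proof
      fix b
      obtain M where M: "set_mset M \<subseteq> Y \<times> UNIV" "h = linear_comb M"
        using natural_map_surjD[OF bij h] by blast
      have "(\<Sum>(y, c)\<in>#M. c * y b) = (\<Sum>k<n. (\<Sum>(y, c)\<in>#M. c * pairing B (F k) y) * x k b)"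
        using M(1)
      proof (induction M)
        case (add yc M)
        obtain y c where yc: "yc = (y, c)" by (cases yc)
        then have y: "y \<in> Y" using add.prems by auto
        have "y b = (\<Sum>k<n. pairing B (F k) y * x k b)"
          using fun_cong[OF expand[OF y], of b] pair y by simp
        then have "c * y b = (\<Sum>k<n. c * pairing B (F k) y * x k b)"
          by (simp add: sum_distrib_left mult.assoc)
        then show ?case using add by (simp add: yc distrib_right sum.distrib)
      qed simp
      then show "h b = (\<Sum>k<n. pairing B (F k) h * x k b)"
        by (simp add: M(2) linear_comb_def pairing_sum_mset)
    qed
  qed (use x pair \<phi>_in in auto)
qed

section \<open>Integral elements of a Hopf algebra\<close>

lemma bilin_ext_sum:
  "bilin_ext B \<mu> (\<lambda>b. \<Sum>i\<in>I. c i * u i b) (\<lambda>b. \<Sum>j\<in>J. d j * v j b) =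
    (\<lambda>e. \<Sum>i\<in>I. \<Sum>j\<in>J. c i * d j * bilin_ext B \<mu> (u i) (v j) e)"
proof
  fix e
  have "bilin_ext B \<mu> (\<lambda>b. \<Sum>i\<in>I. c i * u i b) (\<lambda>b. \<Sum>j\<in>J. d j * v j b) e =
      (\<Sum>a\<in>B. \<Sum>b\<in>B. \<Sum>i\<in>I. \<Sum>j\<in>J. c i * d j * (u i a * v j b * \<mu> a b e))"
    unfolding bilin_ext_def sum_product sum_distrib_right
    by (intro sum.cong refl) (simp add: sum_distrib_left mult_ac)
  also have "\<dots> = (\<Sum>a\<in>B. \<Sum>i\<in>I. \<Sum>b\<in>B. \<Sum>j\<in>J. c i * d j * (u i a * v j b * \<mu> a b e))"
    by (intro sum.cong refl sum.swap)
  also have "\<dots> = (\<Sum>i\<in>I. \<Sum>a\<in>B. \<Sum>b\<in>B. \<Sum>j\<in>J. c i * d j * (u i a * v j b * \<mu> a b e))"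
    by (rule sum.swap)
  also have "\<dots> = (\<Sum>i\<in>I. \<Sum>a\<in>B. \<Sum>j\<in>J. \<Sum>b\<in>B. c i * d j * (u i a * v j b * \<mu> a b e))"
    by (intro sum.cong refl sum.swap)
  also have "\<dots> = (\<Sum>i\<in>I. \<Sum>j\<in>J. \<Sum>a\<in>B. \<Sum>b\<in>B. c i * d j * (u i a * v j b * \<mu> a b e))"
    by (intro sum.cong refl sum.swap)
  also have "\<dots> = (\<Sum>i\<in>I. \<Sum>j\<in>J. c i * d j * bilin_ext B \<mu> (u i) (v j) e)"
    unfolding bilin_ext_def sum_distrib_left ..
  finally show "bilin_ext B \<mu> (\<lambda>b. \<Sum>i\<in>I. c i * u i b) (\<lambda>b. \<Sum>j\<in>J. d j * v j b) e =
    (\<Sum>i\<in>I. \<Sum>j\<in>J. c i * d j * bilin_ext B \<mu> (u i) (v j) e)" .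
qed

lemma lin_ext_sum:
  "lin_ext B \<phi> (\<lambda>b. \<Sum>i\<in>I. c i * u i b) = (\<lambda>e. \<Sum>i\<in>I. c i * lin_ext B \<phi> (u i) e)"
  unfolding lin_ext_def sum_distrib_left sum_distrib_right
  by (subst sum.swap) (simp add: mult_ac)

lemma hmult2_vtensor:
  "hmult2 H (vtensor a b) (vtensor c d) = vtensor (hmult H a c) (hmult H b d)"
proof
  fix e :: "'a \<times> 'a"
  let ?B = "basis H"
  have "hmult2 H (vtensor a b) (vtensor c d) e =
    (\<Sum>u\<in>?B. \<Sum>u'\<in>?B. \<Sum>v\<in>?B. \<Sum>v'\<in>?B. a u * b u' * (c v * d v') * (bmult H u v (fst e) * bmult H u' v' (snd e)))"
    unfolding hmult2_def bilin_ext_def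
    by (cases e) (simp add: sum.cartesian_product' vtensor_def)
  also have "\<dots> = (\<Sum>u\<in>?B. \<Sum>v\<in>?B. \<Sum>u'\<in>?B. \<Sum>v'\<in>?B. a u * c v * bmult H u v (fst e) * (b u' * d v' * bmult H u' v' (snd e)))"
    by (rule sum.cong[OF refl], subst sum.swap) (simp add: mult_ac)
  also have "\<dots> = vtensor (hmult H a c) (hmult H b d) e"
    unfolding vtensor_def hmult_def bilin_ext_def case_prod_beta sum_distrib_right
    unfolding sum_distrib_left ..
  finally show "hmult2 H (vtensor a b) (vtensor c d) e = vtensor (hmult H a c) (hmult H b d) e" .
qed

lemma coord_space_sum:
  "(\<And>i. i \<in> I \<Longrightarrow> u i \<in> coord_space UNIV B) \<Longrightarrow> (\<lambda>b. \<Sum>i\<in>I. c i * u i b) \<in> coord_space UNIV B"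
  by (auto simp: coord_space_UNIV_iff)

lemma vtensor_coord_space:
  "x \<in> coord_space UNIV B \<Longrightarrow> y \<in> coord_space UNIV C \<Longrightarrow> vtensor x y \<in> coord_space UNIV (B \<times> C)"
  by (auto simp: coord_space_UNIV_iff vtensor_def)

text \<open>What survives of an order over a number ring: generators \<open>x k\<close> and
  functionals \<open>F k\<close> for which the structure constants of product and coproduct are
  algebraic integers. The \<open>x k\<close> may be dependent, so coefficients are always those
  given by \<open>expand\<close>.\<close>

locale integral_frame =
  fixes H :: "'b hopf_data" and n :: nat and x F :: "nat \<Rightarrow> 'b \<Rightarrow> complex"
  assumes fin: "finite (basis H)" and scal: "scalars H = UNIV"
    and x_space: "k < n \<Longrightarrow> x k \<in> hspace H"
    and expand: "h \<in> hspace H \<Longrightarrow> h = (\<lambda>b. \<Sum>k<n. pairing (basis H) (F k) h * x k b)"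
    and int_mult: "i < n \<Longrightarrow> j < n \<Longrightarrow> k < n \<Longrightarrow>
      algebraic_int (pairing (basis H) (F k) (hmult H (x i) (x j)))"
    and int_comult: "i < n \<Longrightarrow> j < n \<Longrightarrow> k < n \<Longrightarrow>
      algebraic_int (pairing (basis H \<times> basis H) (vtensor (F j) (F k)) (hcomult H (x i)))"
    and bmult_space: "a \<in> basis H \<Longrightarrow> b \<in> basis H \<Longrightarrow> bmult H a b \<in> hspace H"
    and bcomult_space: "a \<in> basis H \<Longrightarrow> bcomult H a \<in> hspace2 H"
begin

abbreviation (input) B where "B \<equiv> basis H"

definition integral_elements :: "('b \<Rightarrow> complex) set" where
  "integral_elements = {h \<in> hspace H. \<forall>k<n. algebraic_int (pairing B (F k) h)}"

definition integral_elements2 :: "('b \<times> 'b \<Rightarrow> complex) set" where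
  "integral_elements2 = {h \<in> hspace2 H. \<forall>k<n. \<forall>l<n.
     algebraic_int (pairing (B \<times> B) (vtensor (F k) (F l)) h)}"

lemma hspace_eq: "hspace H = coord_space UNIV B" "hspace2 H = coord_space UNIV (B \<times> B)"
  by (simp_all add: hspace_def hspace2_def scal)

lemma hmult_space: "hmult H u v \<in> hspace H"
  using bmult_space by (auto simp: hmult_def bilin_ext_def hspace_eq coord_space_UNIV_iff)

lemma hmult2_space: "hmult2 H u v \<in> hspace2 H"
  using bmult_space
  by (auto simp: hmult2_def bilin_ext_def hspace_eq coord_space_UNIV_iff vtensor_def
      sum.cartesian_product')

lemma hcomult_space: "hcomult H u \<in> hspace2 H"
  using bcomult_space by (auto simp: hcomult_def lin_ext_def hspace_eq coord_space_UNIV_iff)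

text \<open>\<open>expand\<close> is used in the left factor for a fixed right coordinate, and then
  in the right factor for \<open>S k\<close>, the contraction of \<open>T\<close> with
  \<open>F k\<close> on the left.\<close>

lemma expand2:
  assumes "T \<in> hspace2 H"
  shows "T = (\<lambda>e. \<Sum>i\<in>{..<n} \<times> {..<n}.
    pairing (B \<times> B) (vtensor (F (fst i)) (F (snd i))) T * vtensor (x (fst i)) (x (snd i)) e)"
proof
  fix e :: "'b \<times> 'b"
  obtain b c where e: "e = (b, c)" by (cases e)
  have T: "T (b', c') = 0" if "b' \<notin> B \<or> c' \<notin> B" for b' c'
    using assms that by (auto simp: hspace_eq coord_space_UNIV_iff)
  define S where "S k c = pairing B (F k) (\<lambda>b. T (b, c))" for k c
  have "(\<lambda>b. T (b, c)) \<in> hspace H" using T by (auto simp: hspace_eq coord_space_UNIV_iff)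
  from fun_cong[OF expand[OF this], of b] have 1: "T (b, c) = (\<Sum>k<n. S k c * x k b)"
    by (simp add: S_def)
  have "S k \<in> hspace H" for k using T by (auto simp: S_def pairing_def hspace_eq coord_space_UNIV_iff)
  from fun_cong[OF expand[OF this], of _ c] have 2: "S k c = (\<Sum>l<n. pairing B (F l) (S k) * x l c)" for k .
  have 3: "pairing B (F l) (S k) = pairing (B \<times> B) (vtensor (F k) (F l)) T" for k l
    unfolding pairing_def S_def sum_distrib_left
    by (subst sum.swap) (simp add: vtensor_def sum.cartesian_product mult_ac case_prod_beta)
  show "T e = (\<Sum>i\<in>{..<n} \<times> {..<n}.
    pairing (B \<times> B) (vtensor (F (fst i)) (F (snd i))) T * vtensor (x (fst i)) (x (snd i)) e)"
    unfolding e 1 sum.cartesian_product'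
    by (subst 2) (simp add: 3 sum_distrib_left vtensor_def[of "x _"] mult_ac)
qed

lemma integral_elements2I:
  assumes "finite I" "\<And>i. i \<in> I \<Longrightarrow> algebraic_int (c i)" "\<And>i. i \<in> I \<Longrightarrow> u i \<in> integral_elements2"
  shows "(\<lambda>e. \<Sum>i\<in>I. c i * u i e) \<in> integral_elements2"
  using assms
  by (auto simp: integral_elements2_def pairing_sum hspace_eq intro!: coord_space_sum
      algebraic_int_sum algebraic_int_mult)

lemma vtensor_integral:
  "u \<in> integral_elements \<Longrightarrow> v \<in> integral_elements \<Longrightarrow> vtensor u v \<in> integral_elements2"
  by (auto simp: integral_elements_def integral_elements2_def hspace_eq pairing_vtensor
      intro: vtensor_coord_space algebraic_int_mult)

lemma x_mult_integral: "i < n \<Longrightarrow> j < n \<Longrightarrow> hmult H (x i) (x j) \<in> integral_elements"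
  by (auto simp: integral_elements_def hmult_space int_mult)

lemma hcomult_integral:
  assumes "u \<in> integral_elements"
  shows "hcomult H u \<in> integral_elements2"
proof -
  have "hcomult H u = hcomult H (\<lambda>b. \<Sum>k<n. pairing B (F k) u * x k b)"
    using expand[of u] assms by (simp add: integral_elements_def)
  also have "\<dots> = (\<lambda>e. \<Sum>k<n. pairing B (F k) u * hcomult H (x k) e)"
    by (simp add: hcomult_def lin_ext_sum)
  also have "\<dots> \<in> integral_elements2"
    using assms
    by (intro integral_elements2I)
      (auto simp: integral_elements2_def integral_elements_def hcomult_space int_comult)
  finally show ?thesis .
qed

lemma hmult2_integral:
  assumes "S \<in> integral_elements2" "T \<in> integral_elements2"
  shows "hmult2 H S T \<in> integral_elements2"
proof -
  define c where "c T i = pairing (B \<times> B) (vtensor (F (fst i)) (F (snd i))) T" for T and i :: "nat \<times> nat"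
  define y where "y i = vtensor (x (fst i)) (x (snd i))" for i
  let ?I = "{..<n} \<times> {..<n}"
  have exp: "T = (\<lambda>e. \<Sum>i\<in>?I. c T i * y i e)" if "T \<in> integral_elements2" for T
    unfolding c_def y_def by (rule expand2) (use that in \<open>simp add: integral_elements2_def\<close>)
  have int: "algebraic_int (c T i)" if "T \<in> integral_elements2" "i \<in> ?I" for T i
    using that by (auto simp: integral_elements2_def c_def)
  have "hmult2 H S T = hmult2 H (\<lambda>e. \<Sum>i\<in>?I. c S i * y i e) (\<lambda>e. \<Sum>i\<in>?I. c T i * y i e)"
    by (rule arg_cong2[of _ _ _ _ "hmult2 H", OF exp exp]) (fact assms)+
  also have "\<dots> = (\<lambda>e. \<Sum>i\<in>?I. \<Sum>j\<in>?I. c S i * c T j * hmult2 H (y i) (y j) e)"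
    by (simp add: hmult2_def bilin_ext_sum)
  also have "\<dots> = (\<lambda>e. \<Sum>(i, j)\<in>?I \<times> ?I. c S i * c T j * hmult2 H (y i) (y j) e)"
    by (simp add: sum.cartesian_product)
  also have "\<dots> = (\<lambda>e. \<Sum>ij\<in>?I \<times> ?I. (c S (fst ij) * c T (snd ij)) * hmult2 H (y (fst ij)) (y (snd ij)) e)"
    by (simp add: case_prod_beta)
  also have "\<dots> \<in> integral_elements2"
    using assms int
    by (intro integral_elements2I)
      (auto simp: y_def hmult2_vtensor intro!: vtensor_integral x_mult_integral algebraic_int_mult)
  finally show ?thesis .
qed

text \<open>The eigenvalues of the matrix of values of \<open>F k\<close> on a matrix coalgebra are integral because
  the span of the \<open>F k\<close> over the algebraic integers is closed under convolution.\<close>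

lemma cocharacter_integral:
  fixes E :: "nat \<Rightarrow> nat \<Rightarrow> 'b \<Rightarrow> complex" and p :: nat
  assumes E_space: "\<And>i j. i < p \<Longrightarrow> j < p \<Longrightarrow> E i j \<in> hspace H"
    and E_comult: "\<And>f g i j. i < p \<Longrightarrow> j < p \<Longrightarrow> pairing (B \<times> B) (vtensor f g) (hcomult H (E i j)) =
      (\<Sum>m<p. pairing B f (E i m) * pairing B g (E m j))"
    and E_counit: "\<And>i j. i < p \<Longrightarrow> j < p \<Longrightarrow> hcounit H (E i j) = (if i = j then 1 else 0)"
  shows "(\<lambda>b. \<Sum>i<p. E i i b) \<in> integral_elements"
proof -
  have "algebraic_int (pairing B (F k) (\<lambda>b. \<Sum>i<p. E i i b))" if k: "k < n" for k
  proof -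
    have "algebraic_int (\<Sum>i<p. pairing B (F k) (E i i))"
    proof (rule algebraic_int_trace[where A = "\<lambda>i j. pairing B (F k) (E i j)"])
      fix \<mu> v i
      assume i: "i < p" "v i \<noteq> 0" and ev: "\<And>i. i < p \<Longrightarrow> \<mu> * v i = (\<Sum>j<p. pairing B (F k) (E i j) * v j)"
      \<comment> \<open>Row \<open>i\<close> of the matrix of \<open>F l\<close>, applied to
        \<open>v\<close>. It is a row where \<open>v\<close> does not vanish, so that the counit can
        detect \<open>u\<close>.\<close>
      define u where "u l = (\<Sum>j<p. pairing B (F l) (E i j) * v j)" for l
      \<comment> \<open>The matrix of right convolution by \<open>F k\<close> on the functionals
        \<open>F l\<close>; its entries are integral by \<open>int_comult\<close>.\<close>
      define c where "c l s = pairing (B \<times> B) (vtensor (F l) (F k)) (hcomult H (x s))" for l s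
      have eps: "hcounit H h = (\<Sum>l<n. pairing B (F l) h * hcounit H (x l))" if "h \<in> hspace H" for h
        by (subst expand[OF that]) (simp add: hcounit_def sum_distrib_left sum_distrib_right mult_ac
            sum.swap[of _ _ B])
      \<comment> \<open>The counit is a combination of the \<open>F l\<close> and sends
        \<open>E\<close> to the identity matrix. Hence v_i is a combination of the u_l, and some u_l
        is nonzero.\<close>
      have "v i = (\<Sum>j<p. if i = j then v j else 0)" using i by simp
      also have "\<dots> = (\<Sum>j<p. hcounit H (E i j) * v j)"
        using i by (intro sum.cong refl) (auto simp: E_counit)
      also have "\<dots> = (\<Sum>j<p. \<Sum>l<n. hcounit H (x l) * (pairing B (F l) (E i j) * v j))"
        using i by (intro sum.cong refl) (simp add: eps E_space sum_distrib_left sum_distrib_right mult_ac)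
      also have "\<dots> = (\<Sum>l<n. hcounit H (x l) * u l)"
        by (subst sum.swap) (simp add: u_def sum_distrib_left)
      finally obtain l0 where l0: "l0 < n" "u l0 \<noteq> 0" using i(2) by (metis (no_types, lifting) lessThan_iff mult_zero_right sum.neutral)
      have E_conv: "(\<Sum>j<p. pairing B (F l) (E i j) * pairing B (F k) (E j m)) =
          (\<Sum>s<n. c l s * pairing B (F s) (E i m))" if "m < p" for l m
      proof -
        have "(\<Sum>j<p. pairing B (F l) (E i j) * pairing B (F k) (E j m)) =
            pairing (B \<times> B) (vtensor (F l) (F k)) (hcomult H (E i m))"
          using i that by (simp add: E_comult)
        also have "\<dots> = pairing (B \<times> B) (vtensor (F l) (F k))
            (hcomult H (\<lambda>b. \<Sum>s<n. pairing B (F s) (E i m) * x s b))"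
          using expand[OF E_space[OF i(1) that]] by simp
        also have "\<dots> = (\<Sum>s<n. c l s * pairing B (F s) (E i m))"
          unfolding hcomult_def lin_ext_sum pairing_sum by (simp add: c_def hcomult_def mult.commute)
        finally show ?thesis .
      qed
      show "algebraic_int \<mu>"
      proof (rule algebraic_int_eigenvalue[of "{..<n}" l0 u c])
        fix l assume "l \<in> {..<n}"
        have "\<mu> * u l = (\<Sum>j<p. pairing B (F l) (E i j) * (\<mu> * v j))"
          by (simp add: u_def sum_distrib_left mult_ac)
        also have "\<dots> = (\<Sum>j<p. \<Sum>m<p. pairing B (F l) (E i j) * pairing B (F k) (E j m) * v m)"
          by (intro sum.cong refl) (simp add: ev sum_distrib_left mult_ac)
        also have "\<dots> = (\<Sum>m<p. (\<Sum>j<p. pairing B (F l) (E i j) * pairing B (F k) (E j m)) * v m)"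
          by (subst sum.swap) (simp add: sum_distrib_right)
        also have "\<dots> = (\<Sum>m<p. \<Sum>s<n. c l s * (pairing B (F s) (E i m) * v m))"
          by (intro sum.cong refl) (simp add: E_conv sum_distrib_right mult.assoc)
        also have "\<dots> = (\<Sum>s<n. c l s * u s)"
          by (subst sum.swap) (simp add: u_def sum_distrib_left)
        finally show "\<mu> * u l = (\<Sum>s\<in>{..<n}. c l s * u s)" .
      qed (use l0 k in \<open>auto simp: c_def int_comult\<close>)
    qed
    then show ?thesis using pairing_sum[of B "F k" "\<lambda>_. 1" "\<lambda>i. E i i" "{..<p}"] by simp
  qed
  moreover have "(\<lambda>b. \<Sum>i<p. E i i b) \<in> hspace H"
    using coord_space_sum[of "{..<p}" "\<lambda>i. E i i" B "\<lambda>_. 1"] E_space by (simp add: hspace_eq)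
  ultimately show ?thesis by (simp add: integral_elements_def)
qed

text \<open>Right multiplication by \<open>Z\<close> has an algebraic integer matrix with respect to
  the generators \<open>y i\<close>, and the values of \<Theta> at these generators form an
  eigenvector of it for \<mu>; \<open>h0\<close> shows that they do not all vanish.\<close>

lemma integral_eigenvalue2:
  assumes Z: "Z \<in> integral_elements2"
    and eig: "\<And>h. h \<in> hspace2 H \<Longrightarrow>
      pairing (B \<times> B) \<Theta> (hmult2 H h Z) = \<mu> * pairing (B \<times> B) \<Theta> h"
    and h0: "h0 \<in> hspace2 H" "pairing (B \<times> B) \<Theta> h0 \<noteq> 0"
  shows "algebraic_int \<mu>"
proof -
  define c where "c T i = pairing (B \<times> B) (vtensor (F (fst i)) (F (snd i))) T" for T and i :: "nat \<times> nat"
  define y where "y i = vtensor (x (fst i)) (x (snd i))" for i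
  define u where "u i = pairing (B \<times> B) \<Theta> (y i)" for i
  let ?I = "{..<n} \<times> {..<n}"
  have exp: "T = (\<lambda>e. \<Sum>i\<in>?I. c T i * y i e)" if "T \<in> hspace2 H" for T
    unfolding c_def y_def by (rule expand2[OF that])
  have val: "pairing (B \<times> B) \<Theta> T = (\<Sum>i\<in>?I. c T i * u i)" if "T \<in> hspace2 H" for T
    by (subst exp[OF that]) (simp add: pairing_sum u_def)
  have y: "y i \<in> hspace2 H" if "i \<in> ?I" for i
    using x_space that unfolding y_def hspace_eq by (intro vtensor_coord_space) (auto simp: hspace_eq)
  from h0 val[OF h0(1)] obtain i0 where i0: "i0 \<in> ?I" "u i0 \<noteq> 0"
    by (metis (no_types, lifting) mult_zero_right sum.neutral)
  show ?thesis
  proof (rule algebraic_int_eigenvalue[of ?I i0 u "\<lambda>i j. c (hmult2 H (y i) Z) j"])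
    show "\<mu> * u i = (\<Sum>j\<in>?I. c (hmult2 H (y i) Z) j * u j)" if "i \<in> ?I" for i
      using eig[OF y[OF that]] val[OF hmult2_space] by (simp add: u_def)
    fix i j assume ij: "i \<in> ?I" "j \<in> ?I"
    show "algebraic_int (c (hmult2 H (y i) Z) j)"
    proof -
      have "hmult2 H (y i) Z = hmult2 H (\<lambda>e. \<Sum>k\<in>{i}. 1 * y k e) (\<lambda>e. \<Sum>k\<in>?I. c Z k * y k e)"
        using exp[of Z] Z by (simp add: integral_elements2_def)
      also have "\<dots> = (\<lambda>e. \<Sum>k\<in>?I. c Z k * hmult2 H (y i) (y k) e)"
        unfolding hmult2_def bilin_ext_sum by simp
      also have "\<dots> \<in> integral_elements2"
      proof (rule integral_elements2I)
        show "algebraic_int (c Z k)" if "k \<in> ?I" for k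
          using Z that by (auto simp: c_def integral_elements2_def)
        show "hmult2 H (y i) (y k) \<in> integral_elements2" if "k \<in> ?I" for k
          using ij that by (auto simp: y_def hmult2_vtensor intro!: vtensor_integral x_mult_integral)
      qed simp
      finally show ?thesis using ij by (auto simp: c_def integral_elements2_def)
    qed
  qed (use i0 in auto)
qed

end

section \<open>Sums over roots of unity\<close>

text \<open>Residues are integers rather than naturals to allow differences and negatives as
  exponents of \<open>powi\<close>.\<close>

abbreviation Zmod :: "nat \<Rightarrow> int set" where
  "Zmod p \<equiv> {0..<int p}"

lemma sum_residues: "(\<Sum>u\<in>Zmod p. f u) = (\<Sum>u<p. f (int u))"
proof -
  have "Zmod p = int ` {..<p}" by (simp add: lessThan_atLeast0 image_int_atLeastLessThan)
  then show ?thesis by (simp add: sum.reindex)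
qed

lemma periodic_mod:
  fixes f :: "int \<Rightarrow> 'a"
  assumes "\<And>k. f (k + int p) = f k"
  shows "f (k mod int p) = f k"
proof -
  have up: "f (k + int m * int p) = f k" for k m
  proof (induction m)
    case (Suc m)
    then show ?case using assms[of "k + int m * int p"] by (simp add: algebra_simps)
  qed simp
  have "f (k + j * int p) = f k" for k j
  proof (cases "j \<ge> 0")
    case True
    then show ?thesis using up[of k "nat j"] by simp
  next
    case False
    then show ?thesis using up[of "k + j * int p" "nat (- j)"] by (simp add: algebra_simps)
  qed
  from this[of "k mod int p" "k div int p"] show ?thesis by (simp add: mult.commute)
qed

lemma sum_residues_shift:
  fixes f :: "int \<Rightarrow> complex"
  assumes per: "\<And>k. f (k + int p) = f k" and p: "p > 0"
  shows "(\<Sum>k\<in>Zmod p. f (k + c)) = (\<Sum>k\<in>Zmod p. f k)"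
proof -
  have "(\<Sum>k\<in>Zmod p. f (k + c)) = (\<Sum>k\<in>Zmod p. f ((k + c) mod int p))"
    using periodic_mod[of f, OF per] by simp
  also have "\<dots> = (\<Sum>k\<in>Zmod p. f k)"
    by (rule sum.reindex_bij_witness[of _ "\<lambda>k. (k - c) mod int p" "\<lambda>k. (k + c) mod int p"])
      (use p in \<open>auto simp: mod_simps\<close>)
  finally show ?thesis .
qed

lemma sum_residues_dvd:
  fixes f :: "int \<Rightarrow> complex"
  assumes per: "\<And>k. f (k + int p) = f k" and p: "p > 0"
  shows "(\<Sum>k\<in>Zmod p. if int p dvd k + c then f k else 0) = f (- c)"
proof -
  have "(\<Sum>k\<in>Zmod p. if int p dvd k + c then f k else 0) =
      (\<Sum>k\<in>Zmod p. if k = (- c) mod int p then f k else 0)"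
  proof (intro sum.cong refl if_cong)
    fix k assume k: "k \<in> Zmod p"
    have "int p dvd k + c \<longleftrightarrow> k mod int p = (- c) mod int p"
      by (simp add: mod_eq_dvd_iff)
    then show "int p dvd k + c \<longleftrightarrow> k = (- c) mod int p" using k by simp
  qed
  also have "\<dots> = f ((- c) mod int p)" using p by simp
  finally show ?thesis using periodic_mod[of f, OF per] by simp
qed

text \<open>Used for \<zeta> of order p in the twist and for \<eta> of order q in the Gauss
  periods.\<close>

locale root_of_unity =
  fixes p :: nat and \<zeta> :: complex
  assumes prim: "primitive_root_of_unity p \<zeta>" and p_pos: "p > 0"
begin

lemma zeta_power: "\<zeta> ^ p = 1" and zeta_nonzero: "\<zeta> \<noteq> 0"
  using prim p_pos by (auto simp: primitive_root_of_unity_def power_0_left)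

lemma zeta_powi_period: "\<zeta> powi (k + int p * m) = \<zeta> powi k"
  using zeta_nonzero zeta_power by (simp add: power_int_add power_int_mult)

lemma zeta_powi_eq_1_iff: "\<zeta> powi m = 1 \<longleftrightarrow> int p dvd m"
proof
  assume 1: "\<zeta> powi m = 1"
  have "\<zeta> powi m = \<zeta> powi (m mod int p)"
    using zeta_powi_period[of "m mod int p" "m div int p"] by simp
  also have "\<dots> = \<zeta> ^ nat (m mod int p)" using p_pos by (simp add: power_int_def)
  finally have "\<zeta> ^ nat (m mod int p) = 1" using 1 by simp
  moreover have "nat (m mod int p) < p" using p_pos by (simp add: nat_less_iff)
  ultimately have "nat (m mod int p) = 0"
    using prim by (meson gr0I primitive_root_of_unity_def)
  then have "m mod int p \<le> 0" by simp
  moreover have "0 \<le> m mod int p" using p_pos by simp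
  ultimately have "m mod int p = 0" by linarith
  then show "int p dvd m" by (rule dvd_eq_mod_eq_0[THEN iffD2])
qed (auto elim!: dvdE simp: power_int_mult zeta_power)

lemma sum_zeta_powi: "(\<Sum>u\<in>Zmod p. \<zeta> powi (u * m)) = (if int p dvd m then of_nat p else 0)"
proof -
  have "\<zeta> powi (u * m) = (\<zeta> powi m) powi u" for u by (simp add: power_int_mult mult.commute)
  then have sum: "(\<Sum>u\<in>Zmod p. \<zeta> powi (u * m)) = (\<Sum>u<p. (\<zeta> powi m) ^ u)"
    by (simp add: sum_residues)
  show ?thesis
  proof (cases "int p dvd m")
    case True
    then show ?thesis unfolding sum by (simp add: zeta_powi_eq_1_iff[THEN iffD2])
  next
    case False
    have "(\<zeta> powi m) ^ p = 1" using zeta_power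
      by (metis mult.commute power_int_1_left power_int_mult power_int_of_nat)
    moreover have "\<zeta> powi m \<noteq> 1" using False zeta_powi_eq_1_iff by simp
    ultimately show ?thesis unfolding sum using False by (simp add: geometric_sum)
  qed
qed

text \<open>Conjugation by the twist has this form once the first tensor leg depends on u + u' only.
  With k = u + u' the exponent becomes k v' - u (v + v'), and summing over u forces v' = - v and
  yields a factor p.\<close>

lemma bicharacter_sum:
  fixes \<Psi> :: "int \<Rightarrow> int \<Rightarrow> int \<Rightarrow> complex"
  assumes per1: "\<And>k v w. \<Psi> (k + int p) v w = \<Psi> k v w"
    and per3: "\<And>k v w. \<Psi> k v (w + int p) = \<Psi> k v w"
  shows "(\<Sum>u\<in>Zmod p. \<Sum>v\<in>Zmod p. \<Sum>u'\<in>Zmod p. \<Sum>v'\<in>Zmod p.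
      \<zeta> powi (u' * v' - u * v) * \<Psi> (u + u') v v') =
    of_nat p * (\<Sum>v\<in>Zmod p. \<Sum>k\<in>Zmod p. \<zeta> powi (- (k * v)) * \<Psi> k v (- v))"
proof -
  let ?R = "Zmod p"
  have "(\<Sum>u\<in>?R. \<Sum>v\<in>?R. \<Sum>u'\<in>?R. \<Sum>v'\<in>?R. \<zeta> powi (u' * v' - u * v) * \<Psi> (u + u') v v') =
      (\<Sum>u\<in>?R. \<Sum>v\<in>?R. \<Sum>v'\<in>?R. \<Sum>u'\<in>?R. \<zeta> powi (u' * v' - u * v) * \<Psi> (u + u') v v')"
    by (intro sum.cong refl sum.swap)
  also have "\<dots> = (\<Sum>u\<in>?R. \<Sum>v\<in>?R. \<Sum>v'\<in>?R. \<Sum>k\<in>?R. \<zeta> powi (k * v' - u * (v + v')) * \<Psi> k v v')"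
  proof (rule sum.cong[OF refl], rule sum.cong[OF refl], rule sum.cong[OF refl])
    fix u v v'
    define f where "f k = \<zeta> powi (k * v' - u * (v + v')) * \<Psi> k v v'" for k
    have "f (k + int p) = f k" for k
      using zeta_powi_period[of "k * v' - u * (v + v')" v'] per1[of k v v']
      by (simp add: f_def algebra_simps)
    from sum_residues_shift[of f p u, OF this p_pos]
    show "(\<Sum>u'\<in>?R. \<zeta> powi (u' * v' - u * v) * \<Psi> (u + u') v v') =
        (\<Sum>k\<in>?R. \<zeta> powi (k * v' - u * (v + v')) * \<Psi> k v v')"
      by (simp add: f_def algebra_simps)
  qed
  also have "\<dots> = (\<Sum>v\<in>?R. \<Sum>u\<in>?R. \<Sum>v'\<in>?R. \<Sum>k\<in>?R. \<zeta> powi (k * v' - u * (v + v')) * \<Psi> k v v')"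
    by (rule sum.swap)
  also have "\<dots> = (\<Sum>v\<in>?R. \<Sum>v'\<in>?R. \<Sum>u\<in>?R. \<Sum>k\<in>?R. \<zeta> powi (k * v' - u * (v + v')) * \<Psi> k v v')"
    by (intro sum.cong refl sum.swap)
  also have "\<dots> = (\<Sum>v\<in>?R. \<Sum>v'\<in>?R. \<Sum>k\<in>?R. \<Sum>u\<in>?R. \<zeta> powi (k * v' - u * (v + v')) * \<Psi> k v v')"
    by (intro sum.cong refl sum.swap)
  also have "\<dots> = (\<Sum>v\<in>?R. \<Sum>v'\<in>?R. \<Sum>k\<in>?R.
      (if int p dvd v' + v then of_nat p * (\<zeta> powi (k * v') * \<Psi> k v v') else 0))"
  proof (intro sum.cong refl)
    fix v v' k
    have "(\<Sum>u\<in>?R. \<zeta> powi (k * v' - u * (v + v')) * \<Psi> k v v') =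
        (\<zeta> powi (k * v') * \<Psi> k v v') * (\<Sum>u\<in>?R. \<zeta> powi (u * (- (v + v'))))"
      unfolding sum_distrib_left using zeta_nonzero
      by (intro sum.cong refl) (simp add: power_int_diff power_int_minus power_int_add field_simps)
    moreover have "int p dvd - (v + v') \<longleftrightarrow> int p dvd v' + v"
      by (simp only: dvd_minus_iff add.commute)
    ultimately show "(\<Sum>u\<in>?R. \<zeta> powi (k * v' - u * (v + v')) * \<Psi> k v v') =
        (if int p dvd v' + v then of_nat p * (\<zeta> powi (k * v') * \<Psi> k v v') else 0)"
      by (simp only: sum_zeta_powi) simp
  qed
  also have "\<dots> = (\<Sum>v\<in>?R. \<Sum>v'\<in>?R.
      (if int p dvd v' + v then of_nat p * (\<Sum>k\<in>?R. \<zeta> powi (k * v') * \<Psi> k v v') else 0))"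
    by (intro sum.cong refl) (simp add: sum_distrib_left)
  also have "\<dots> = (\<Sum>v\<in>?R. of_nat p * (\<Sum>k\<in>?R. \<zeta> powi (k * (- v)) * \<Psi> k v (- v)))"
  proof (intro sum.cong refl)
    fix v
    define f where "f v' = of_nat p * (\<Sum>k\<in>?R. \<zeta> powi (k * v') * \<Psi> k v v')" for v'
    have "f (v' + int p) = f v'" for v'
      using zeta_powi_period[of "_ * v'"] per3 by (simp add: f_def algebra_simps)
    from sum_residues_dvd[of f p v, OF this p_pos]
    show "(\<Sum>v'\<in>?R. if int p dvd v' + v then of_nat p * (\<Sum>k\<in>?R. \<zeta> powi (k * v') * \<Psi> k v v') else 0) =
        of_nat p * (\<Sum>k\<in>?R. \<zeta> powi (k * (- v)) * \<Psi> k v (- v))"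
      unfolding f_def .
  qed
  finally show ?thesis by (simp add: sum_distrib_left)
qed

end

section \<open>The twisted group algebra\<close>

lemma pairing_unit_vec: "finite B \<Longrightarrow> b \<in> B \<Longrightarrow> pairing B P (unit_vec b) = P b"
  by (simp add: pairing_def unit_vec_def if_distrib cong: if_cong)

lemma bilin_ext_unit_vec:
  assumes "finite B" "a \<in> B" "b \<in> B"
  shows "bilin_ext B \<mu> (unit_vec a) (unit_vec b) = \<mu> a b"
proof
  fix c
  have "bilin_ext B \<mu> (unit_vec a) (unit_vec b) c =
      (\<Sum>a'\<in>B. unit_vec a a' * (\<Sum>b'\<in>B. unit_vec b b' * \<mu> a' b' c))"
    by (simp add: bilin_ext_def sum_distrib_left mult.assoc)
  also have "\<dots> = (\<Sum>a'\<in>B. if a' = a then \<Sum>b'\<in>B. if b' = b then \<mu> a' b' c else 0 else 0)"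
    by (intro sum.cong refl) (auto simp: unit_vec_def intro!: sum.cong)
  finally show "bilin_ext B \<mu> (unit_vec a) (unit_vec b) c = \<mu> a b c"
    using assms by simp
qed

lemma lin_ext_unit_vec:
  "finite B \<Longrightarrow> b \<in> B \<Longrightarrow> lin_ext B \<phi> (unit_vec b) = \<phi> b"
  by (auto simp: lin_ext_def unit_vec_def fun_eq_iff if_distrib[of "\<lambda>x. x * _"] cong: if_cong)

lemma vtensor_unit_vec: "vtensor (unit_vec a) (unit_vec b) = unit_vec (a, b)"
  by (auto simp: vtensor_def unit_vec_def fun_eq_iff)

abbreviation group_alg_mult where
  "group_alg_mult G \<equiv> bilin_ext (carrier G) (\<lambda>a b. unit_vec (a \<otimes>\<^bsub>G\<^esub> b))"

lemma (in monoid) group_alg_mult_comb: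
  assumes "finite (carrier G)" "\<And>i. i \<in> I \<Longrightarrow> g i \<in> carrier G" "\<And>j. j \<in> J \<Longrightarrow> h j \<in> carrier G"
  shows "group_alg_mult G (\<lambda>b. \<Sum>i\<in>I. c i * unit_vec (g i) b) (\<lambda>b. \<Sum>j\<in>J. d j * unit_vec (h j) b) =
    (\<lambda>b. \<Sum>i\<in>I. \<Sum>j\<in>J. c i * d j * unit_vec (g i \<otimes> h j) b)"
  unfolding bilin_ext_sum
  by (intro ext sum.cong refl) (simp add: bilin_ext_unit_vec assms)

text \<open>Serves the uniqueness of the inverse of the twist.\<close>

lemma (in monoid) group_alg_mult_assoc:
  assumes fin: "finite (carrier G)" and "x \<in> coord_space UNIV (carrier G)"
    "y \<in> coord_space UNIV (carrier G)" "z \<in> coord_space UNIV (carrier G)"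
  shows "group_alg_mult G (group_alg_mult G x y) z = group_alg_mult G x (group_alg_mult G y z)"
proof -
  let ?B = "carrier G"
  note expand = coord_space_UNIV_expand[OF fin]
  have xy: "group_alg_mult G x y = (\<lambda>b. \<Sum>ij\<in>?B \<times> ?B. (x (fst ij) * y (snd ij)) * unit_vec (fst ij \<otimes> snd ij) b)"
    if "x \<in> coord_space UNIV ?B" "y \<in> coord_space UNIV ?B" for x y
    by (subst expand[OF that(1)], subst expand[OF that(2)])
      (simp add: group_alg_mult_comb fin sum.cartesian_product')
  have "group_alg_mult G (group_alg_mult G x y) z = group_alg_mult G
      (\<lambda>b. \<Sum>ij\<in>?B \<times> ?B. (x (fst ij) * y (snd ij)) * unit_vec (fst ij \<otimes> snd ij) b)
      (\<lambda>b. \<Sum>k\<in>?B. z k * unit_vec k b)"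
    using xy[OF assms(2,3)] expand[OF assms(4)] by simp
  also have "\<dots> = (\<lambda>b. \<Sum>i\<in>?B. \<Sum>j\<in>?B. \<Sum>k\<in>?B. x i * y j * z k * unit_vec (i \<otimes> j \<otimes> k) b)"
    by (subst group_alg_mult_comb) (auto simp: fin sum.cartesian_product')
  also have "\<dots> = (\<lambda>b. \<Sum>i\<in>?B. \<Sum>jk\<in>?B \<times> ?B. x i * (y (fst jk) * z (snd jk)) * unit_vec (i \<otimes> (fst jk \<otimes> snd jk)) b)"
    by (intro ext sum.cong refl) (simp add: sum.cartesian_product' m_assoc mult.assoc)
  also have "\<dots> = group_alg_mult G (\<lambda>b. \<Sum>k\<in>?B. x k * unit_vec k b)
      (\<lambda>b. \<Sum>ij\<in>?B \<times> ?B. (y (fst ij) * z (snd ij)) * unit_vec (fst ij \<otimes> snd ij) b)"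
    by (subst group_alg_mult_comb) (auto simp: fin)
  also have "\<dots> = group_alg_mult G x (group_alg_mult G y z)"
    using xy[OF assms(3,4)] expand[OF assms(2)] by simp
  finally show ?thesis .
qed

lemma (in group) inv_commute:
  assumes "x \<in> carrier G" "y \<in> carrier G" "x \<otimes> y = y \<otimes> x"
  shows "inv x \<otimes> y = y \<otimes> inv x"
proof -
  have "inv x \<otimes> y = inv x \<otimes> (y \<otimes> x) \<otimes> inv x" using assms(1,2) by (simp add: m_assoc)
  also have "\<dots> = inv x \<otimes> (x \<otimes> y) \<otimes> inv x" by (simp add: assms(3))
  also have "\<dots> = y \<otimes> inv x" using assms(1,2) by (simp flip: m_assoc)
  finally show ?thesis .
qed

lemma (in group) int_pow_commute:
  assumes "x \<in> carrier G" "y \<in> carrier G" "x \<otimes> y = y \<otimes> x"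
  shows "x [^] (i :: int) \<otimes> y = y \<otimes> x [^] i"
proof -
  have nat: "x [^] n \<otimes> y = y \<otimes> x [^] n" for n :: nat
    by (rule group_commutes_pow) (use assms in auto)
  have "inv (x [^] n) \<otimes> y = y \<otimes> inv (x [^] n)" for n :: nat
    by (rule inv_commute) (use assms nat in auto)
  with nat show ?thesis unfolding int_pow_def2 by presburger
qed

lemma (in group) int_pow_commute2:
  assumes "x \<in> carrier G" "y \<in> carrier G" "x \<otimes> y = y \<otimes> x"
  shows "x [^] (i :: int) \<otimes> y [^] (j :: int) = y [^] j \<otimes> x [^] i"
proof -
  have "y \<otimes> x [^] i = x [^] i \<otimes> y" using int_pow_commute[OF assms] by simp
  then show ?thesis using int_pow_commute[of y "x [^] i" j] assms by simp
qed

lemma (in group) int_pow_period: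
  assumes "x \<in> carrier G" "x [^] p = \<one>"
  shows "x [^] (i + int p) = x [^] i"
  using assms by (simp add: int_pow_mult int_pow_int)

section \<open>Matrix coalgebras inside the twisted coalgebra\<close>

locale commuting_pair = group G + root_of_unity p \<zeta> for G (structure) and p \<zeta> +
  fixes s t
  assumes st: "s \<in> carrier G" "t \<in> carrier G" "s \<otimes> t = t \<otimes> s" "s [^] p = \<one>" "t [^] p = \<one>"
begin

lemma st_int: "s [^] (i :: int) \<in> carrier G" "t [^] (i :: int) \<in> carrier G"
  using st by auto

definition s_conj :: "'a \<Rightarrow> int \<Rightarrow> 'a" where
  "s_conj c x = s [^] x \<otimes> c \<otimes> s [^] (- x)"

lemma s_conj_closed [simp]: "c \<in> carrier G \<Longrightarrow> s_conj c x \<in> carrier G"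
  using st by (simp add: s_conj_def)

lemma s_conj_s_conj:
  assumes "c \<in> carrier G"
  shows "s [^] v \<otimes> s_conj c x \<otimes> s [^] (- v) = s_conj c (x + v)"
proof -
  have "s [^] v \<otimes> s_conj c x \<otimes> s [^] (- v) = (s [^] v \<otimes> s [^] x) \<otimes> c \<otimes> (s [^] (- x) \<otimes> s [^] (- v))"
    using assms st_int by (simp add: s_conj_def m_assoc)
  also have "\<dots> = s_conj c (x + v)"
    using st by (simp add: s_conj_def int_pow_mult[symmetric] add.commute)
  finally show ?thesis .
qed

lemma s_conj_period:
  assumes "c \<in> carrier G"
  shows "s_conj c (x + int p) = s_conj c x"
proof -
  have "s [^] (- (x + int p)) = s [^] (- x)"
    using int_pow_period[OF st(1,4), of "- (x + int p)"] by simp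
  then show ?thesis using int_pow_period[OF st(1,4), of x] by (simp add: s_conj_def)
qed

lemma t_s_conj:
  assumes "c \<in> carrier G" "c \<otimes> t = t \<otimes> c"
  shows "s_conj c x \<otimes> t [^] (i :: int) = t [^] i \<otimes> s_conj c x"
proof -
  have 1: "s [^] y \<otimes> t [^] i = t [^] i \<otimes> s [^] y" for y :: int using int_pow_commute2[of s t] st by auto
  have 2: "c \<otimes> t [^] i = t [^] i \<otimes> c" using int_pow_commute[of t c i] assms st by simp
  have "s_conj c x \<otimes> t [^] i = s [^] x \<otimes> c \<otimes> (s [^] (- x) \<otimes> t [^] i)"
    using assms st_int by (simp add: s_conj_def m_assoc)
  also have "\<dots> = s [^] x \<otimes> (c \<otimes> t [^] i) \<otimes> s [^] (- x)"
    using assms st_int by (simp add: 1 m_assoc)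
  also have "\<dots> = (s [^] x \<otimes> t [^] i) \<otimes> c \<otimes> s [^] (- x)"
    using assms st_int by (simp add: 2 m_assoc)
  also have "\<dots> = t [^] i \<otimes> s_conj c x"
    using assms st_int by (simp add: 1 s_conj_def m_assoc)
  finally show ?thesis .
qed

lemma twist_conj:
  fixes u u' v v' w x :: int
  assumes c: "c \<in> carrier G" "c \<otimes> t = t \<otimes> c"
  shows "t [^] u \<otimes> (t [^] w \<otimes> s_conj c x) \<otimes> t [^] u' = t [^] (u + u' + w) \<otimes> s_conj c x"
    and "s [^] v \<otimes> (t [^] w \<otimes> s_conj c x) \<otimes> s [^] v' = t [^] w \<otimes> (s [^] v \<otimes> s_conj c x \<otimes> s [^] v')"
proof -
  have "t [^] u \<otimes> (t [^] w \<otimes> s_conj c x) \<otimes> t [^] u' = t [^] u \<otimes> t [^] w \<otimes> (s_conj c x \<otimes> t [^] u')"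
    using c st_int by (simp add: m_assoc)
  also have "\<dots> = t [^] u \<otimes> t [^] w \<otimes> t [^] u' \<otimes> s_conj c x"
    using c st_int by (simp add: t_s_conj m_assoc)
  also have "\<dots> = t [^] (u + u' + w) \<otimes> s_conj c x"
    using st by (simp add: int_pow_mult[symmetric] add_ac)
  finally show "t [^] u \<otimes> (t [^] w \<otimes> s_conj c x) \<otimes> t [^] u' = t [^] (u + u' + w) \<otimes> s_conj c x" .
  have 1: "s [^] v \<otimes> t [^] w = t [^] w \<otimes> s [^] v" using int_pow_commute2[of s t v w] st by auto
  have "s [^] v \<otimes> (t [^] w \<otimes> s_conj c x) \<otimes> s [^] v' = (s [^] v \<otimes> t [^] w) \<otimes> s_conj c x \<otimes> s [^] v'"
    using c st_int by (simp add: m_assoc)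
  then show "s [^] v \<otimes> (t [^] w \<otimes> s_conj c x) \<otimes> s [^] v' = t [^] w \<otimes> (s [^] v \<otimes> s_conj c x \<otimes> s [^] v')"
    using c st_int by (simp add: 1 m_assoc)
qed

text \<open>The functional \<open>P\<close> evaluated at J (g \<otimes> g) J^(-1); the square of p
  collects the normalisations of J and of its inverse.\<close>

definition twisted_diag :: "('a \<times> 'a \<Rightarrow> complex) \<Rightarrow> 'a \<Rightarrow> complex" where
  "twisted_diag P g = (\<Sum>u\<in>Zmod p. \<Sum>v\<in>Zmod p. \<Sum>u'\<in>Zmod p. \<Sum>v'\<in>Zmod p.
     \<zeta> powi (u' * v' - u * v) * P (t [^] u \<otimes> g \<otimes> t [^] u', s [^] v \<otimes> g \<otimes> s [^] v')) / of_nat p ^ 2"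

text \<open>With c_x the conjugate of c by s^x, the coproduct of t^w c_x is 1 / p times the sum of
  \<zeta>^(-(k - w)(z - x)) t^k c_x \<otimes> t^w c_z. The indices of \<open>bicharacter_sum\<close>
  are shifted by w and x to make k an exponent of t and z an index of conjugation.\<close>

lemma twisted_diag_s_conj:
  assumes c: "c \<in> carrier G" "c \<otimes> t = t \<otimes> c"
  shows "twisted_diag P (t [^] w \<otimes> s_conj c x) =
    (\<Sum>z\<in>Zmod p. \<Sum>k\<in>Zmod p. \<zeta> powi (- ((k - w) * (z - x))) * P (t [^] k \<otimes> s_conj c x, t [^] w \<otimes> s_conj c z))
      / of_nat p"
proof -
  define \<Psi> where "\<Psi> k v v' = P (t [^] (k + w) \<otimes> s_conj c x, t [^] w \<otimes> (s [^] v \<otimes> s_conj c x \<otimes> s [^] v'))"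
    for k v v' :: int
  have "(\<Sum>u\<in>Zmod p. \<Sum>v\<in>Zmod p. \<Sum>u'\<in>Zmod p. \<Sum>v'\<in>Zmod p. \<zeta> powi (u' * v' - u * v) * \<Psi> (u + u') v v') =
    of_nat p * (\<Sum>v\<in>Zmod p. \<Sum>k\<in>Zmod p. \<zeta> powi (- (k * v)) * \<Psi> k v (- v))"
  proof (rule bicharacter_sum)
    show "\<Psi> (k + int p) v v' = \<Psi> k v v'" for k v v'
      using int_pow_period[OF st(2,5), of "k + w"] by (simp add: \<Psi>_def add_ac)
    show "\<Psi> k v (v' + int p) = \<Psi> k v v'" for k v v'
      using int_pow_period[OF st(1,4), of v'] by (simp add: \<Psi>_def)
  qed
  then have "twisted_diag P (t [^] w \<otimes> s_conj c x) =
      (\<Sum>v\<in>Zmod p. \<Sum>k\<in>Zmod p. \<zeta> powi (- (k * v)) * \<Psi> k v (- v)) / of_nat p"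
    using p_pos by (simp add: twisted_diag_def twist_conj[OF c] \<Psi>_def power2_eq_square)
  also have "(\<Sum>v\<in>Zmod p. \<Sum>k\<in>Zmod p. \<zeta> powi (- (k * v)) * \<Psi> k v (- v)) =
      (\<Sum>v\<in>Zmod p. \<Sum>k\<in>Zmod p. \<zeta> powi (- ((k - w) * v)) * P (t [^] k \<otimes> s_conj c x, t [^] w \<otimes> s_conj c (x + v)))"
  proof (rule sum.cong[OF refl])
    fix v
    define f where "f k = \<zeta> powi (- ((k - w) * v)) * P (t [^] k \<otimes> s_conj c x, t [^] w \<otimes> s_conj c (x + v))" for k
    have "f (k + int p) = f k" for k
      using zeta_powi_period[of "- ((k - w) * v)" "- v"] int_pow_period[OF st(2,5), of k]
      by (simp add: f_def algebra_simps)
    from sum_residues_shift[of f p w, OF this p_pos]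
    show "(\<Sum>k\<in>Zmod p. \<zeta> powi (- (k * v)) * \<Psi> k v (- v)) =
        (\<Sum>k\<in>Zmod p. \<zeta> powi (- ((k - w) * v)) * P (t [^] k \<otimes> s_conj c x, t [^] w \<otimes> s_conj c (x + v)))"
      unfolding f_def \<Psi>_def s_conj_s_conj[OF c(1)] by simp
  qed
  also have "\<dots> = (\<Sum>z\<in>Zmod p. \<Sum>k\<in>Zmod p. \<zeta> powi (- ((k - w) * (z - x))) *
      P (t [^] k \<otimes> s_conj c x, t [^] w \<otimes> s_conj c z))"
  proof -
    define f where "f z = (\<Sum>k\<in>Zmod p. \<zeta> powi (- ((k - w) * (z - x))) *
      P (t [^] k \<otimes> s_conj c x, t [^] w \<otimes> s_conj c z))" for z
    have "f (z + int p) = f z" for z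
      unfolding f_def
    proof (rule sum.cong[OF refl])
      fix k
      have "- ((k - w) * (z + int p - x)) = - ((k - w) * (z - x)) + int p * (w - k)"
        by (simp add: algebra_simps)
      then show "\<zeta> powi (- ((k - w) * (z + int p - x))) * P (t [^] k \<otimes> s_conj c x, t [^] w \<otimes> s_conj c (z + int p)) =
          \<zeta> powi (- ((k - w) * (z - x))) * P (t [^] k \<otimes> s_conj c x, t [^] w \<otimes> s_conj c z)"
        by (simp only: zeta_powi_period s_conj_period[OF c(1)])
    qed
    from sum_residues_shift[of f p x, OF this p_pos] show ?thesis
      unfolding f_def by (simp add: add.commute)
  qed
  finally show ?thesis .
qed

text \<open>With \<open>e\<^sub>j\<close> the idempotents of the group algebra of \<open>\<langle>t\<rangle>\<close>, \<open>matrix_entry c x y\<close> is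
  \<open>e\<^sub>y\<^sub>-\<^sub>x s\<^sup>x c s\<^sup>-\<^sup>x\<close>. If \<open>c\<close> commutes with \<open>t\<close>, these are the coefficients of a matrix coalgebra.\<close>

definition matrix_entry :: "'a \<Rightarrow> int \<Rightarrow> int \<Rightarrow> 'a \<Rightarrow> complex" where
  "matrix_entry c x y = (\<lambda>b. \<Sum>w\<in>Zmod p. (\<zeta> powi (- (w * (y - x))) / of_nat p) *
     unit_vec (t [^] w \<otimes> s_conj c x) b)"

text \<open>The value of the functional \<open>f\<close> at \<open>matrix_entry\<close>, available
  also before G is known to be finite.\<close>

definition entry_value :: "'a \<Rightarrow> ('a \<Rightarrow> complex) \<Rightarrow> int \<Rightarrow> int \<Rightarrow> complex" where
  "entry_value c f x y = (\<Sum>w\<in>Zmod p. (\<zeta> powi (- (w * (y - x))) / of_nat p) * f (t [^] w \<otimes> s_conj c x))"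

lemma pairing_matrix_entry:
  assumes "finite (carrier G)" "c \<in> carrier G"
  shows "pairing (carrier G) f (matrix_entry c x y) = entry_value c f x y"
  unfolding matrix_entry_def pairing_sum entry_value_def
  using assms st by (simp add: pairing_unit_vec)

text \<open>The Fourier exponents of the idempotents absorb that of the twist: w(y - x) + (k - w)(z
  - x) = k(z - x) + w(y - z). Hence the coproduct of entry (x, y) is the sum over z of entry (x, z)
  tensored with entry (z, y).\<close>

lemma matrix_entry_comult:
  assumes c: "c \<in> carrier G" "c \<otimes> t = t \<otimes> c"
  shows "(\<Sum>w\<in>Zmod p. (\<zeta> powi (- (w * (y - x))) / of_nat p) *
      twisted_diag (\<lambda>(a, b). f a * g b) (t [^] w \<otimes> s_conj c x)) =
    (\<Sum>z\<in>Zmod p. entry_value c f x z * entry_value c g z y)"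
proof -
  have "(\<Sum>w\<in>Zmod p. (\<zeta> powi (- (w * (y - x))) / of_nat p) *
      twisted_diag (\<lambda>(a, b). f a * g b) (t [^] w \<otimes> s_conj c x)) =
    (\<Sum>w\<in>Zmod p. \<Sum>z\<in>Zmod p. \<Sum>k\<in>Zmod p. (\<zeta> powi (- (k * (z - x))) / of_nat p * f (t [^] k \<otimes> s_conj c x)) *
      (\<zeta> powi (- (w * (y - z))) / of_nat p * g (t [^] w \<otimes> s_conj c z)))"
  proof (rule sum.cong[OF refl])
    fix w
    have aux: "\<alpha> / m * (\<beta> * (a * b) / m) = (\<gamma> / m * a) * (\<delta> / m * b)" if "\<alpha> * \<beta> = \<gamma> * \<delta>"
      for \<alpha> \<beta> \<gamma> \<delta> a b m :: complex
    proof -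
      have "\<alpha> / m * (\<beta> * (a * b) / m) = (\<alpha> * \<beta>) * (a * b) / (m * m)" by simp
      then show ?thesis by (simp add: that mult_ac)
    qed
    have "\<zeta> powi (- (w * (y - x))) * \<zeta> powi (- ((k - w) * (z - x))) =
        \<zeta> powi (- (k * (z - x))) * \<zeta> powi (- (w * (y - z)))" for k z
      using zeta_nonzero by (simp flip: power_int_add add: algebra_simps)
    then show "(\<zeta> powi (- (w * (y - x))) / of_nat p) *
      twisted_diag (\<lambda>(a, b). f a * g b) (t [^] w \<otimes> s_conj c x) =
      (\<Sum>z\<in>Zmod p. \<Sum>k\<in>Zmod p. (\<zeta> powi (- (k * (z - x))) / of_nat p * f (t [^] k \<otimes> s_conj c x)) *
      (\<zeta> powi (- (w * (y - z))) / of_nat p * g (t [^] w \<otimes> s_conj c z)))"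
      unfolding twisted_diag_s_conj[OF c] sum_distrib_left sum_divide_distrib prod.case
      by (intro sum.cong refl aux)
  qed
  also have "\<dots> = (\<Sum>z\<in>Zmod p. \<Sum>w\<in>Zmod p. \<Sum>k\<in>Zmod p. (\<zeta> powi (- (k * (z - x))) / of_nat p * f (t [^] k \<otimes> s_conj c x)) *
      (\<zeta> powi (- (w * (y - z))) / of_nat p * g (t [^] w \<otimes> s_conj c z)))"
    by (rule sum.swap)
  also have "\<dots> = (\<Sum>z\<in>Zmod p. entry_value c f x z * entry_value c g z y)"
    unfolding entry_value_def sum_product by (intro sum.cong refl sum.swap)
  finally show ?thesis .
qed

end

section \<open>The inverse of the twist and the twisted coproduct\<close>

locale group_twist = commuting_pair G p \<zeta> s t for G :: "'a monoid" (structure) and p \<zeta> s t +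
  fixes K :: "complex set"
  assumes finite_G: "finite (carrier G)" and K: "subfield K complex_ring" "\<zeta> \<in> K"
begin

definition twist :: "'a \<times> 'a \<Rightarrow> complex" where
  "twist = (\<lambda>z. 1 / of_nat p * (\<Sum>u<p. \<Sum>v<p. inverse \<zeta> ^ (u * v) *
     vtensor (unit_vec (t [^] u)) (unit_vec (s [^] v)) z))"

definition H where "H = base_change UNIV (drinfeld_twist (group_hopf K G) twist)"

lemma H_simps:
  "scalars H = UNIV" "basis H = carrier G" "bmult H = (\<lambda>g h. unit_vec (g \<otimes> h))"
  "hone H = unit_vec \<one>" "bcounit H = (\<lambda>g. 1)"
  "bcomult H = (\<lambda>g. hmult2 (group_hopf K G) (hmult2 (group_hopf K G) twist (unit_vec (g, g)))
     (hinverse2 (group_hopf K G) twist))"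
  by (simp_all add: H_def base_change_def drinfeld_twist_def group_hopf_def)

sublocale GG: group "G \<times>\<times> G" by (rule DirProd_group) unfold_locales

lemma GG_finite: "finite (carrier (G \<times>\<times> G))" using finite_G by simp

text \<open>Identifies the tensor square of the group algebra with the group algebra of the direct
  product, so that facts about one group algebra cover both.\<close>

lemma hmult2_group_hopf: "hmult2 (group_hopf K' G) = group_alg_mult (G \<times>\<times> G)"
proof -
  have "bilin_ext (carrier G \<times> carrier G)
     (\<lambda>(a, a') (b, b'). vtensor (unit_vec (a \<otimes> b)) (unit_vec (a' \<otimes> b'))) =
    bilin_ext (carrier G \<times> carrier G) (\<lambda>a b. unit_vec (a \<otimes>\<^bsub>G \<times>\<times> G\<^esub> b))"
    by (rule arg_cong[where f = "bilin_ext _"]) (auto simp: fun_eq_iff vtensor_unit_vec)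
  then show ?thesis by (simp add: hmult2_def group_hopf_def)
qed

lemma hmult2_H: "hmult2 H = group_alg_mult (G \<times>\<times> G)"
  using hmult2_group_hopf[of UNIV] by (simp add: hmult2_def H_simps group_hopf_def)

abbreviation Zmod2 where "Zmod2 \<equiv> Zmod p \<times> Zmod p"

lemma twist_eq: "twist = (\<lambda>z. \<Sum>i\<in>Zmod2. (\<zeta> powi (- (fst i * snd i)) / of_nat p) *
  unit_vec (t [^] fst i, s [^] snd i) z)"
proof
  fix z
  have "inverse \<zeta> ^ (u * v) = \<zeta> powi (- (int u * int v))" for u v
    by (metis of_nat_mult power_int_minus power_int_of_nat power_inverse)
  then show "twist z = (\<Sum>i\<in>Zmod2. (\<zeta> powi (- (fst i * snd i)) / of_nat p) *
      unit_vec (t [^] fst i, s [^] snd i) z)"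
    unfolding twist_def sum.cartesian_product' sum_residues
    by (simp add: sum_distrib_left vtensor_unit_vec int_pow_int)
qed

definition untwist :: "'a \<times> 'a \<Rightarrow> complex" where
  "untwist = (\<lambda>z. \<Sum>i\<in>Zmod2. (\<zeta> powi (fst i * snd i) / of_nat p) *
    unit_vec (t [^] fst i, s [^] snd i) z)"

lemma ts_int: "(t [^] (i :: int), s [^] (j :: int)) \<in> carrier (G \<times>\<times> G)"
  using st_int by simp

text \<open>After the collapse by \<open>bicharacter_sum\<close> the summand depends on v only
  through \<zeta>^(-k v). Summing over v leaves k = 0, and the two factors p cancel the
  normalisation.\<close>

lemma twist_untwist: "group_alg_mult (G \<times>\<times> G) twist untwist = unit_vec (\<one>, \<one>)"
proof
  fix e
  define \<Psi> where "\<Psi> k v v' = unit_vec (t [^] k, s [^] (v + v')) e" for k v v' :: int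
  have ts: "(t [^] i, s [^] j) \<otimes>\<^bsub>G \<times>\<times> G\<^esub> (t [^] i', s [^] j') = (t [^] (i + i'), s [^] (j + j'))"
    for i j i' j' :: int using st by (simp add: int_pow_mult)
  have "group_alg_mult (G \<times>\<times> G) twist untwist e =
      (\<Sum>i\<in>Zmod2. \<Sum>j\<in>Zmod2. (\<zeta> powi (- (fst i * snd i)) / of_nat p) * (\<zeta> powi (fst j * snd j) / of_nat p) *
        unit_vec (t [^] fst i \<otimes> t [^] fst j, s [^] snd i \<otimes> s [^] snd j) e)"
    unfolding twist_eq untwist_def
    by (subst GG.group_alg_mult_comb[OF GG_finite]) (use st_int in auto)
  also have "\<dots> = (\<Sum>i\<in>Zmod2. \<Sum>j\<in>Zmod2. \<zeta> powi (fst j * snd j - fst i * snd i) *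
      \<Psi> (fst i + fst j) (snd i) (snd j)) / of_nat p ^ 2"
    unfolding sum_divide_distrib \<Psi>_def using zeta_nonzero st
    by (intro sum.cong refl) (simp add: int_pow_mult power_int_diff power_int_minus field_simps power2_eq_square)
  also have "(\<Sum>i\<in>Zmod2. \<Sum>j\<in>Zmod2. \<zeta> powi (fst j * snd j - fst i * snd i) *
      \<Psi> (fst i + fst j) (snd i) (snd j)) =
    of_nat p * (\<Sum>v\<in>Zmod p. \<Sum>k\<in>Zmod p. \<zeta> powi (- (k * v)) * \<Psi> k v (- v))"
    unfolding sum.cartesian_product' fst_conv snd_conv
  proof (rule bicharacter_sum)
    show "\<Psi> (k + int p) v v' = \<Psi> k v v'" for k v v'
      using int_pow_period[OF st(2,5), of k] by (simp add: \<Psi>_def)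
    show "\<Psi> k v (v' + int p) = \<Psi> k v v'" for k v v'
      using int_pow_period[OF st(1,4), of "v + v'"] by (simp add: \<Psi>_def add_ac)
  qed
  also have "(\<Sum>v\<in>Zmod p. \<Sum>k\<in>Zmod p. \<zeta> powi (- (k * v)) * \<Psi> k v (- v)) =
      (\<Sum>k\<in>Zmod p. \<Psi> k 0 0 * (\<Sum>v\<in>Zmod p. \<zeta> powi (v * (- k))))"
    unfolding sum_distrib_left by (subst sum.swap) (simp add: \<Psi>_def mult_ac)
  also have "\<dots> = (\<Sum>k\<in>Zmod p. if k = 0 then of_nat p * \<Psi> 0 0 0 else 0)"
    unfolding sum_zeta_powi using p_pos by (intro sum.cong refl) (auto dest: zdvd_imp_le)
  also have "\<dots> = of_nat p * \<Psi> 0 0 0" using p_pos by simp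
  finally show "group_alg_mult (G \<times>\<times> G) twist untwist e = unit_vec (\<one>, \<one>) e"
    using p_pos by (simp add: \<Psi>_def power2_eq_square)
qed

text \<open>Each tensor leg involves the powers of one element only, so the two factors
  commute.\<close>

lemma untwist_twist: "group_alg_mult (G \<times>\<times> G) untwist twist = unit_vec (\<one>, \<one>)"
proof -
  have "group_alg_mult (G \<times>\<times> G) untwist twist = group_alg_mult (G \<times>\<times> G) twist untwist"
    unfolding twist_eq untwist_def GG.group_alg_mult_comb[OF GG_finite ts_int ts_int]
  proof (rule ext, subst sum.swap, rule sum.cong[OF refl], rule sum.cong[OF refl])
    fix e :: "'a \<times> 'a" and i j :: "int \<times> int"
    have "(t [^] fst j, s [^] snd j) \<otimes>\<^bsub>G \<times>\<times> G\<^esub> (t [^] fst i, s [^] snd i) =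
        (t [^] fst i, s [^] snd i) \<otimes>\<^bsub>G \<times>\<times> G\<^esub> (t [^] fst j, s [^] snd j)"
      using st by (simp add: int_pow_mult[symmetric] add.commute)
    then show "\<zeta> powi (fst j * snd j) / of_nat p * (\<zeta> powi (- (fst i * snd i)) / of_nat p) *
        unit_vec ((t [^] fst j, s [^] snd j) \<otimes>\<^bsub>G \<times>\<times> G\<^esub> (t [^] fst i, s [^] snd i)) e =
      \<zeta> powi (- (fst i * snd i)) / of_nat p * (\<zeta> powi (fst j * snd j) / of_nat p) *
        unit_vec ((t [^] fst i, s [^] snd i) \<otimes>\<^bsub>G \<times>\<times> G\<^esub> (t [^] fst j, s [^] snd j)) e"
      by (simp only: mult.commute)
  qed
  then show ?thesis using twist_untwist by (rule trans)
qed

lemma K_closed: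
  "0 \<in> K" "1 \<in> K" "\<And>x y. x \<in> K \<Longrightarrow> y \<in> K \<Longrightarrow> x + y \<in> K"
  "\<And>x y. x \<in> K \<Longrightarrow> y \<in> K \<Longrightarrow> x * y \<in> K" "\<And>x. x \<in> K \<Longrightarrow> inverse x \<in> K"
proof -
  have sub: "subring K complex_ring" by (rule subfieldE(1)[OF K(1)])
  interpret C: field complex_ring by (rule field_from_type_algebra)
  show 1: "0 \<in> K" "1 \<in> K" using subringE(2,3)[OF sub] by (simp_all add: ring_of_type_algebra_def)
  show "x + y \<in> K" "x * y \<in> K" if "x \<in> K" "y \<in> K" for x y
    using subringE(7,6)[OF sub that] by (simp_all add: ring_of_type_algebra_def)
  show "inverse x \<in> K" if "x \<in> K" for x
  proof (cases "x = 0")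
    case False
    then show ?thesis using C.subfield_m_inv_simprule[OF K(1), of x "inverse x"] that 1(2)
      by (simp add: ring_of_type_algebra_def)
  qed (use 1 in simp)
qed

lemma K_sum: "(\<And>i. i \<in> I \<Longrightarrow> f i \<in> K) \<Longrightarrow> sum f I \<in> K"
  by (induction I rule: infinite_finite_induct) (auto intro: K_closed)

text \<open>\<open>hinverse2\<close> looks for the inverse among vectors with coordinates in
  \<open>K\<close>, since the twist is taken over \<open>K\<close> and scalars are extended
  afterwards.\<close>

lemma untwist_in: "untwist \<in> hspace2 (group_hopf K G)"
proof -
  have nat: "of_nat n \<in> K" for n by (induction n) (auto intro: K_closed)
  have pow: "\<zeta> ^ n \<in> K" for n by (induction n) (auto intro: K_closed K)
  have "\<zeta> powi k \<in> K" for k by (auto simp: power_int_def power_inverse intro!: pow K_closed(5))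
  then have "untwist e \<in> K" for e unfolding untwist_def unit_vec_def
    by (intro K_sum K_closed(4)) (auto simp: divide_inverse intro!: K_closed nat)
  moreover have "untwist e = 0" if "e \<notin> carrier G \<times> carrier G" for e
    unfolding untwist_def using that st_int by (intro sum.neutral) (auto simp: unit_vec_def)
  ultimately show ?thesis by (auto simp: hspace2_def coord_space_def group_hopf_def)
qed

text \<open>The description operator asks for uniqueness, which is the monoid argument T = (J^(-1)
  J) T = J^(-1) (J T) = J^(-1).\<close>

lemma hinverse2_twist: "hinverse2 (group_hopf K G) twist = untwist"
  unfolding hinverse2_def hmult2_group_hopf
proof (rule the_equality)
  have one: "vtensor (hone (group_hopf K G)) (hone (group_hopf K G)) = unit_vec (\<one>, \<one>)"
    by (simp add: group_hopf_def vtensor_unit_vec)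
  show "untwist \<in> hspace2 (group_hopf K G) \<and>
      group_alg_mult (G \<times>\<times> G) twist untwist = vtensor (hone (group_hopf K G)) (hone (group_hopf K G)) \<and>
      group_alg_mult (G \<times>\<times> G) untwist twist = vtensor (hone (group_hopf K G)) (hone (group_hopf K G))"
    unfolding one twist_untwist untwist_twist using untwist_in by blast
  have space: "T \<in> coord_space UNIV (carrier (G \<times>\<times> G))" if "T \<in> hspace2 (group_hopf K G)" for T
    using that by (simp add: hspace2_def coord_space_def group_hopf_def)
  have twist_in: "twist \<in> coord_space UNIV (carrier (G \<times>\<times> G))"
    unfolding twist_eq using ts_int
    by (intro coord_space_sum) (auto simp: coord_space_UNIV_iff unit_vec_def)
  have id: "group_alg_mult (G \<times>\<times> G) (unit_vec (\<one>, \<one>)) T = T"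
    "group_alg_mult (G \<times>\<times> G) T (unit_vec (\<one>, \<one>)) = T"
    if "T \<in> coord_space UNIV (carrier (G \<times>\<times> G))" for T
  proof -
    have one: "unit_vec (\<one>, \<one>) = (\<lambda>b. \<Sum>i\<in>{\<one>\<^bsub>G \<times>\<times> G\<^esub>}. 1 * unit_vec i b)" by simp
    have T: "T = (\<lambda>b. \<Sum>i\<in>carrier (G \<times>\<times> G). T i * unit_vec i b)"
      by (rule coord_space_UNIV_expand[OF GG_finite that])
    have "group_alg_mult (G \<times>\<times> G) (unit_vec (\<one>, \<one>)) (\<lambda>b. \<Sum>i\<in>carrier (G \<times>\<times> G). T i * unit_vec i b) =
        (\<lambda>b. \<Sum>i\<in>carrier (G \<times>\<times> G). T i * unit_vec i b)"
      unfolding one by (subst GG.group_alg_mult_comb[OF GG_finite])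
        (auto simp del: carrier_DirProd one_DirProd mult_DirProd intro!: sum.cong)
    then show "group_alg_mult (G \<times>\<times> G) (unit_vec (\<one>, \<one>)) T = T"
      unfolding T[symmetric] .
    have "group_alg_mult (G \<times>\<times> G) (\<lambda>b. \<Sum>i\<in>carrier (G \<times>\<times> G). T i * unit_vec i b) (unit_vec (\<one>, \<one>)) =
        (\<lambda>b. \<Sum>i\<in>carrier (G \<times>\<times> G). T i * unit_vec i b)"
      unfolding one by (subst GG.group_alg_mult_comb[OF GG_finite])
        (auto simp del: carrier_DirProd one_DirProd mult_DirProd intro!: sum.cong)
    then show "group_alg_mult (G \<times>\<times> G) T (unit_vec (\<one>, \<one>)) = T"
      unfolding T[symmetric] .
  qed
  fix T
  assume T: "T \<in> hspace2 (group_hopf K G) \<and>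
      group_alg_mult (G \<times>\<times> G) twist T = vtensor (hone (group_hopf K G)) (hone (group_hopf K G)) \<and>
      group_alg_mult (G \<times>\<times> G) T twist = vtensor (hone (group_hopf K G)) (hone (group_hopf K G))"
  have "T = group_alg_mult (G \<times>\<times> G) (group_alg_mult (G \<times>\<times> G) untwist twist) T"
    unfolding untwist_twist using id(1)[OF space] T by metis
  also have "\<dots> = group_alg_mult (G \<times>\<times> G) untwist (group_alg_mult (G \<times>\<times> G) twist T)"
    using T by (intro GG.group_alg_mult_assoc GG_finite space untwist_in twist_in) blast
  also have "\<dots> = untwist" using T id(2)[OF space[OF untwist_in]] unfolding one by metis
  finally show "T = untwist" .
qed

lemma bcomult_H:
  assumes g: "g \<in> carrier G"
  shows "bcomult H g = (\<lambda>e. \<Sum>i\<in>Zmod2. \<Sum>j\<in>Zmod2.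
    (\<zeta> powi (- (fst i * snd i)) / of_nat p) * (\<zeta> powi (fst j * snd j) / of_nat p) *
    unit_vec (t [^] fst i \<otimes> g \<otimes> t [^] fst j, s [^] snd i \<otimes> g \<otimes> s [^] snd j) e)"
proof -
  have unit: "unit_vec (g, g) = (\<lambda>b. \<Sum>i\<in>{(g, g)}. 1 * unit_vec i b)" by simp
  have "group_alg_mult (G \<times>\<times> G) twist (unit_vec (g, g)) =
      (\<lambda>e. \<Sum>i\<in>Zmod2. (\<zeta> powi (- (fst i * snd i)) / of_nat p) *
        unit_vec (t [^] fst i \<otimes> g, s [^] snd i \<otimes> g) e)"
    unfolding twist_eq unit
    by (subst GG.group_alg_mult_comb[OF GG_finite]) (use st_int g in auto)
  then show ?thesis
    unfolding H_simps hinverse2_twist hmult2_group_hopf untwist_def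
    by (simp only:) (subst GG.group_alg_mult_comb[OF GG_finite], use st_int g in auto)
qed

lemma bcomult_space: "g \<in> carrier G \<Longrightarrow> bcomult H g \<in> hspace2 H"
  unfolding hspace2_def H_simps(1,2) coord_space_UNIV_iff bcomult_H using st_int
  by (auto intro!: sum.neutral simp: unit_vec_def)

lemma pairing_bcomult:
  assumes "g \<in> carrier G"
  shows "pairing (carrier G \<times> carrier G) P (bcomult H g) = twisted_diag P g"
proof -
  have "pairing (carrier G \<times> carrier G) P (bcomult H g) = (\<Sum>i\<in>Zmod2. \<Sum>j\<in>Zmod2.
    (\<zeta> powi (- (fst i * snd i)) / of_nat p) * (\<zeta> powi (fst j * snd j) / of_nat p) *
    P (t [^] fst i \<otimes> g \<otimes> t [^] fst j, s [^] snd i \<otimes> g \<otimes> s [^] snd j))"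
    (is "_ = ?S")
  proof -
    have "bcomult H g = (\<lambda>e. \<Sum>i\<in>Zmod2. 1 * (\<Sum>j\<in>Zmod2.
      ((\<zeta> powi (- (fst i * snd i)) / of_nat p) * (\<zeta> powi (fst j * snd j) / of_nat p)) *
      unit_vec (t [^] fst i \<otimes> g \<otimes> t [^] fst j, s [^] snd i \<otimes> g \<otimes> s [^] snd j) e))"
      using bcomult_H[OF assms] by simp
    then show ?thesis
      using assms st_int finite_G by (simp only: pairing_sum) (simp add: pairing_unit_vec)
  qed
  also have "?S = twisted_diag P g"
    unfolding twisted_diag_def sum.cartesian_product' sum_divide_distrib fst_conv snd_conv
    using zeta_nonzero
    by (intro sum.cong refl) (simp add: power_int_diff power_int_minus field_simps power2_eq_square)
  finally show ?thesis .
qed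

end

text \<open>Evaluating a product iterates translates of \<open>P\<close>, so that eigenvector
  identities can be checked one group element at a time.\<close>

lemma pairing_bilin_ext_group:
  assumes "finite (carrier G)" "\<And>a b. a \<in> carrier G \<Longrightarrow> b \<in> carrier G \<Longrightarrow> a \<otimes>\<^bsub>G\<^esub> b \<in> carrier G"
  shows "pairing (carrier G) P (group_alg_mult G x y) =
    pairing (carrier G) (\<lambda>a. pairing (carrier G) (\<lambda>b. P (a \<otimes>\<^bsub>G\<^esub> b)) y) x"
proof -
  have "group_alg_mult G x y = (\<lambda>e. \<Sum>a\<in>carrier G. 1 * (\<Sum>b\<in>carrier G. (x a * y b) * unit_vec (a \<otimes>\<^bsub>G\<^esub> b) e))"
    by (simp add: bilin_ext_def)
  then have "pairing (carrier G) P (group_alg_mult G x y) =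
      (\<Sum>a\<in>carrier G. \<Sum>b\<in>carrier G. (x a * y b) * P (a \<otimes>\<^bsub>G\<^esub> b))"
    using assms by (simp only: pairing_sum) (simp add: pairing_unit_vec)
  also have "\<dots> = pairing (carrier G) (\<lambda>a. pairing (carrier G) (\<lambda>b. P (a \<otimes>\<^bsub>G\<^esub> b)) y) x"
    unfolding pairing_def sum_distrib_right by (simp add: mult_ac)
  finally show ?thesis .
qed

lemma pairing_cong: "(\<And>b. b \<in> B \<Longrightarrow> f b = g b) \<Longrightarrow> pairing B f x = pairing B g x"
  by (simp add: pairing_def)

lemma pairing_mult_left: "pairing B (\<lambda>b. c * f b) x = c * pairing B f x"
  by (simp add: pairing_def sum_distrib_left mult_ac)

lemma pairing_sum_left: "pairing B (\<lambda>b. \<Sum>i\<in>I. f i b) x = (\<Sum>i\<in>I. pairing B (f i) x)"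
  unfolding pairing_def sum_distrib_right by (rule sum.swap)

lemma pairing_tensor_square_image:
  assumes T: "T \<in> tensor_square_image Y"
    and int: "\<And>y. y \<in> Y \<Longrightarrow> algebraic_int (pairing B f y)" "\<And>y. y \<in> Y \<Longrightarrow> algebraic_int (pairing C g y)"
  shows "algebraic_int (pairing (B \<times> C) (vtensor f g) T)"
proof -
  obtain A where A: "set_mset A \<subseteq> Y \<times> Y" "T = (\<lambda>b. \<Sum>(x, y)\<in>#A. vtensor x y b)"
    using T by (auto simp: tensor_square_image_def)
  have "pairing (B \<times> C) (vtensor f g) (\<lambda>b. \<Sum>(x, y)\<in>#A. vtensor x y b) =
      (\<Sum>(x, y)\<in>#A. pairing B f x * pairing C g y)"
  proof (induction A)
    case (add xy A)
    obtain x y where xy: "xy = (x, y)" by (cases xy)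
    have "pairing (B \<times> C) (vtensor f g) (\<lambda>b. vtensor x y b + (\<Sum>(x, y)\<in>#A. vtensor x y b)) =
        pairing (B \<times> C) (vtensor f g) (vtensor x y) + pairing (B \<times> C) (vtensor f g) (\<lambda>b. \<Sum>(x, y)\<in>#A. vtensor x y b)"
      by (simp add: pairing_def distrib_left sum.distrib)
    then show ?case by (simp add: xy add pairing_vtensor)
  qed (simp add: pairing_def)
  moreover have "algebraic_int (\<Sum>(x, y)\<in>#A. pairing B f x * pairing C g y)"
    using A(1) by (induction A) (auto intro!: algebraic_int_add algebraic_int_mult int)
  ultimately show ?thesis by (simp add: A(2))
qed

section \<open>Integral elements from a Hopf order\<close>

context group_twist
begin

lemma hopf_order_integral_frame:
  assumes order: "hopf_order H R Y" and R: "\<And>r. r \<in> R \<Longrightarrow> algebraic_int r"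
  obtains n x F where "integral_frame H n x F"
proof -
  have scal: "hspace H = coord_space UNIV (basis H)" by (simp add: hspace_def H_simps)
  have sub: "subring R (scalar_ring UNIV)" and Y: "submodule Y (scalar_ring R) (coord_module (hspace H))"
    and proj: "fg_projective (scalar_ring R) (coord_module Y)"
    and bij: "bij_betw natural_map (tensor_product (scalar_ring R) (coord_module Y) (scalar_module UNIV)) (hspace H)"
    and mult: "\<And>x y. x \<in> Y \<Longrightarrow> y \<in> Y \<Longrightarrow> hmult H x y \<in> Y"
    and comult: "\<And>x. x \<in> Y \<Longrightarrow> hcomult H x \<in> tensor_square_image Y"
    using order by (auto simp: hopf_order_def H_simps)
  have R01: "0 \<in> R" "1 \<in> R"
    using subringE(2,3)[OF sub] by (simp_all add: scalar_ring_def ring_of_type_algebra_def)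
  have subgrp: "subgroup Y (add_monoid (coord_module (hspace H)))" using Y by (simp add: submodule_def)
  have Y_space: "Y \<subseteq> hspace H" and zero: "(\<lambda>b. 0) \<in> Y"
    using subgroup.subset[OF subgrp] subgroup.one_closed[OF subgrp] by (simp_all add: coord_module_def)
  have finB: "finite (basis H)" using finite_G by (simp add: H_simps)
  obtain n :: nat and x F where x: "\<And>k. k < n \<Longrightarrow> x k \<in> Y"
    and F: "\<And>k y. k < n \<Longrightarrow> y \<in> Y \<Longrightarrow> pairing (basis H) (F k) y \<in> R"
    and exp: "\<And>h. h \<in> coord_space UNIV (basis H) \<Longrightarrow> h = (\<lambda>b. \<Sum>k<n. pairing (basis H) (F k) h * x k b)"
    using order_dual_basis[OF proj R01 zero _ _ finB] Y_space bij unfolding scal by blast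
  have "integral_frame H n x F"
  proof
    show "algebraic_int (pairing (basis H \<times> basis H) (vtensor (F j) (F k)) (hcomult H (x i)))"
      if "i < n" "j < n" "k < n" for i j k
      by (rule pairing_tensor_square_image[OF comult[OF x[OF that(1)]]]) (use F R that in auto)
    show "x k \<in> hspace H" if "k < n" for k using x[OF that] Y_space by blast
    show "h = (\<lambda>b. \<Sum>k<n. pairing (basis H) (F k) h * x k b)" if "h \<in> hspace H" for h
      using exp that unfolding scal by blast
    show "algebraic_int (pairing (basis H) (F k) (hmult H (x i) (x j)))" if "i < n" "j < n" "k < n" for i j k
      using F[OF that(3) mult[OF x[OF that(1)] x[OF that(2)]]] R by blast
    show "bmult H a b \<in> hspace H" if "a \<in> basis H" "b \<in> basis H" for a b
      using that unfolding scal by (auto simp: H_simps coord_space_UNIV_iff unit_vec_def)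
    show "bcomult H a \<in> hspace2 H" if "a \<in> basis H" for a
      using that bcomult_space unfolding H_simps(2) by blast
  qed (fact finB, fact H_simps(1))
  then show ?thesis by (rule that)
qed

lemma pairing_hcomult_entry:
  assumes c: "c \<in> carrier G"
  shows "pairing (carrier G \<times> carrier G) P (hcomult H (matrix_entry c x y)) =
    (\<Sum>w\<in>Zmod p. (\<zeta> powi (- (w * (y - x))) / of_nat p) * twisted_diag P (t [^] w \<otimes> s_conj c x))"
proof -
  have g: "t [^] w \<otimes> s_conj c x \<in> carrier G" for w :: int using c st_int by simp
  show ?thesis
    unfolding hcomult_def matrix_entry_def lin_ext_sum pairing_sum H_simps(2)
    by (intro sum.cong refl) (simp only: lin_ext_unit_vec[OF finite_G g] pairing_bcomult[OF g])
qed

lemma matrix_entry_space: "c \<in> carrier G \<Longrightarrow> matrix_entry c x y \<in> coord_space UNIV (carrier G)"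
  unfolding matrix_entry_def using st_int
  by (intro coord_space_sum) (auto simp: coord_space_UNIV_iff unit_vec_def)

lemma hcounit_entry:
  assumes c: "c \<in> carrier G" and ij: "i < p" "j < p"
  shows "hcounit H (matrix_entry c (int i) (int j)) = (if i = j then 1 else 0)"
proof -
  have "hcounit H (matrix_entry c (int i) (int j)) = pairing (carrier G) (\<lambda>_. 1) (matrix_entry c (int i) (int j))"
    by (simp add: hcounit_def H_simps pairing_def)
  also have "\<dots> = (\<Sum>w\<in>Zmod p. \<zeta> powi (w * (int i - int j))) / of_nat p"
    by (simp add: pairing_matrix_entry[OF finite_G c] entry_value_def sum_divide_distrib algebra_simps)
  also have "\<dots> = (if i = j then 1 else 0)"
  proof -
    have "int p dvd int i - int j \<longleftrightarrow> i = j"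
      using ij by (metis mod_eq_dvd_iff mod_less of_nat_eq_iff of_nat_mod)
    then show ?thesis unfolding sum_zeta_powi using p_pos by simp
  qed
  finally show ?thesis .
qed

text \<open>For c = a this is the element x: every diagonal entry carries the idempotent of index 0,
  so the trace of the matrix coalgebra is e_0 times the sum of the conjugates.\<close>

lemma cocharacter_s_integral:
  assumes "integral_frame H n x F" and c: "c \<in> carrier G" "c \<otimes> t = t \<otimes> c"
  shows "(\<lambda>b. \<Sum>i<p. matrix_entry c (int i) (int i) b) \<in> integral_frame.integral_elements H n F"
proof -
  interpret integral_frame H n x F by fact
  show ?thesis
  proof (rule cocharacter_integral[where E = "\<lambda>i j. matrix_entry c (int i) (int j)"])
    fix f g i j
    show "pairing (basis H \<times> basis H) (vtensor f g) (hcomult H (matrix_entry c (int i) (int j))) =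
      (\<Sum>m<p. pairing (basis H) f (matrix_entry c (int i) (int m)) * pairing (basis H) g (matrix_entry c (int m) (int j)))"
      unfolding H_simps(2) pairing_hcomult_entry[OF c(1)] pairing_matrix_entry[OF finite_G c(1)] vtensor_def
        matrix_entry_comult[OF c]
      unfolding sum_residues ..
  qed (use c matrix_entry_space hcounit_entry in \<open>auto simp: hspace_eq H_simps\<close>)
qed

text \<open>The locale is symmetric in s and t, so the constructions made for \<open>a\<close> apply
  to \<open>b\<close> with the two exchanged.\<close>

lemma swapped: "commuting_pair G p \<zeta> t s"
  by unfold_locales (use st in auto)

text \<open>The exponent u' v' - u v is symmetric in the two legs, so exchanging s and t amounts to
  exchanging the tensor factors.\<close>

lemma twisted_diag_swap:
  "twisted_diag P g = commuting_pair.twisted_diag G p \<zeta> t s (\<lambda>(a, b). P (b, a)) g"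
proof -
  interpret sw: commuting_pair G p \<zeta> t s by (rule swapped)
  let ?f = "\<lambda>u v u' v'. \<zeta> powi (u' * v' - u * v) * P (t [^] u \<otimes> g \<otimes> t [^] u', s [^] v \<otimes> g \<otimes> s [^] v')"
  have "(\<Sum>u\<in>Zmod p. \<Sum>v\<in>Zmod p. \<Sum>u'\<in>Zmod p. \<Sum>v'\<in>Zmod p. ?f u v u' v') =
      (\<Sum>v\<in>Zmod p. \<Sum>u\<in>Zmod p. \<Sum>u'\<in>Zmod p. \<Sum>v'\<in>Zmod p. ?f u v u' v')"
    by (rule sum.swap)
  also have "\<dots> = (\<Sum>v\<in>Zmod p. \<Sum>u\<in>Zmod p. \<Sum>v'\<in>Zmod p. \<Sum>u'\<in>Zmod p. ?f u v u' v')"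
    by (rule sum.cong[OF refl], rule sum.cong[OF refl], rule sum.swap)
  finally show ?thesis
    unfolding twisted_diag_def sw.twisted_diag_def prod.case by (simp only: mult.commute)
qed

text \<open>The exchange of tensor factors reverses the coproduct, so the matrix coalgebra is the
  transpose of the one built in \<open>sw\<close>. The diagonal, and with it y for c = b, is
  unaffected.\<close>

lemma cocharacter_t_integral:
  assumes "integral_frame H n x F" and c: "c \<in> carrier G" "c \<otimes> s = s \<otimes> c"
  shows "(\<lambda>b. \<Sum>i<p. commuting_pair.matrix_entry G p \<zeta> t s c (int i) (int i) b)
    \<in> integral_frame.integral_elements H n F"
proof -
  interpret integral_frame H n x F by fact
  interpret sw: commuting_pair G p \<zeta> t s by (rule swapped)
  have g: "s [^] w \<otimes> sw.s_conj c y \<in> carrier G" for w y :: int using c st_int by simp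
  show ?thesis
  proof (rule cocharacter_integral[where E = "\<lambda>i j. sw.matrix_entry c (int j) (int i)"])
    fix f g' i j
    show "sw.matrix_entry c (int j) (int i) \<in> hspace H"
      unfolding sw.matrix_entry_def hspace_eq H_simps(2) using g
      by (intro coord_space_sum) (auto simp: coord_space_UNIV_iff unit_vec_def)
    have "pairing (basis H \<times> basis H) (vtensor f g') (hcomult H (sw.matrix_entry c (int j) (int i))) =
        (\<Sum>w\<in>Zmod p. (\<zeta> powi (- (w * (int i - int j))) / of_nat p) *
          twisted_diag (vtensor f g') (s [^] w \<otimes> sw.s_conj c (int j)))"
      unfolding hcomult_def sw.matrix_entry_def lin_ext_sum pairing_sum H_simps(2)
      by (intro sum.cong refl) (simp only: lin_ext_unit_vec[OF finite_G g] pairing_bcomult[OF g])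
    also have "\<dots> = (\<Sum>w\<in>Zmod p. (\<zeta> powi (- (w * (int i - int j))) / of_nat p) *
          sw.twisted_diag (\<lambda>(a, b). g' a * f b) (s [^] w \<otimes> sw.s_conj c (int j)))"
      unfolding twisted_diag_swap vtensor_def prod.case by (simp only: mult.commute)
    also have "\<dots> = (\<Sum>m<p. sw.entry_value c g' (int j) (int m) * sw.entry_value c f (int m) (int i))"
      unfolding sw.matrix_entry_comult[OF c] unfolding sum_residues ..
    finally show "pairing (basis H \<times> basis H) (vtensor f g') (hcomult H (sw.matrix_entry c (int j) (int i))) =
      (\<Sum>m<p. pairing (basis H) f (sw.matrix_entry c (int m) (int i)) *
        pairing (basis H) g' (sw.matrix_entry c (int j) (int m)))"
      by (simp only: H_simps(2) sw.pairing_matrix_entry[OF finite_G c(1)] mult.commute)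
    assume ij: "i < p" "j < p"
    have "hcounit H (sw.matrix_entry c (int j) (int i)) = pairing (carrier G) (\<lambda>_. 1) (sw.matrix_entry c (int j) (int i))"
      by (simp add: hcounit_def H_simps pairing_def)
    \<comment> \<open>The counit is 1 at every group element, so it cannot tell the two kinds of
      entries apart.\<close>
    also have "\<dots> = pairing (carrier G) (\<lambda>_. 1) (matrix_entry c (int j) (int i))"
      by (simp add: sw.pairing_matrix_entry[OF finite_G c(1)] pairing_matrix_entry[OF finite_G c(1)]
          entry_value_def sw.entry_value_def)
    also have "\<dots> = hcounit H (matrix_entry c (int j) (int i))"
      by (simp add: hcounit_def H_simps pairing_def)
    finally show "hcounit H (sw.matrix_entry c (int j) (int i)) = (if i = j then 1 else 0)"
      using hcounit_entry[OF c(1) ij(2,1)] by auto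
  qed
qed

end

section \<open>The eigenvalue\<close>

text \<open>\<theta> is a matrix coefficient of an induced representation; \<omega> g and \<omega>'
  g are the scalars that \<open>a\<close> and \<open>b\<close> contribute after g. \<omega> is
  followed through \<open>b\<close> because y, which is built from \<open>b\<close>, stands to the
  left of \<Delta>(x).\<close>

locale state_action = commuting_pair G p \<zeta> s t for G :: "'a monoid" (structure) and p \<zeta> s t +
  fixes a b :: 'a and r :: nat and \<theta> \<omega> \<omega>' :: "'a \<Rightarrow> complex" and \<alpha> \<alpha>' :: complex
  assumes ab: "a \<in> carrier G" "b \<in> carrier G"
    and theta: "\<And>g. g \<in> carrier G \<Longrightarrow> \<theta> (g \<otimes> s) = \<theta> g" "\<And>g. g \<in> carrier G \<Longrightarrow> \<theta> (g \<otimes> t) = \<theta> g"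
      "\<And>g. g \<in> carrier G \<Longrightarrow> \<theta> (g \<otimes> a) = \<theta> g * \<omega> g" "\<And>g. g \<in> carrier G \<Longrightarrow> \<theta> (g \<otimes> b) = \<theta> g * \<omega>' g"
      "\<theta> \<one> = 1"
    and omega: "\<And>g. g \<in> carrier G \<Longrightarrow> \<omega> (g \<otimes> s) = \<omega> g ^ r" "\<And>g. g \<in> carrier G \<Longrightarrow> \<omega> (g \<otimes> t) = \<omega> g"
      "\<And>g. g \<in> carrier G \<Longrightarrow> \<omega> (g \<otimes> b) = \<omega> g"
    and omega': "\<And>g. g \<in> carrier G \<Longrightarrow> \<omega>' (g \<otimes> s) = \<omega>' g" "\<And>g. g \<in> carrier G \<Longrightarrow> \<omega>' (g \<otimes> t) = \<omega>' g ^ r"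
    and orbit_sum: "\<And>g. g \<in> carrier G \<Longrightarrow> (\<Sum>x<p. \<omega> g ^ (r ^ x)) = \<alpha>"
      "\<And>g. g \<in> carrier G \<Longrightarrow> (\<Sum>x<p. \<omega>' g ^ (r ^ x)) = \<alpha>'"
begin

lemma s_pow:
  assumes g: "g \<in> carrier G"
  shows "\<theta> (g \<otimes> s [^] (n::nat)) = \<theta> g" "\<omega> (g \<otimes> s [^] n) = \<omega> g ^ (r ^ n)" "\<omega>' (g \<otimes> s [^] n) = \<omega>' g"
proof -
  have "\<theta> (g \<otimes> s [^] n) = \<theta> g \<and> \<omega> (g \<otimes> s [^] n) = \<omega> g ^ (r ^ n) \<and> \<omega>' (g \<otimes> s [^] n) = \<omega>' g"
  proof (induction n)
    case (Suc n)
    have "g \<otimes> s [^] Suc n = g \<otimes> s [^] n \<otimes> s" "g \<otimes> s [^] n \<in> carrier G"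
      using g st by (simp_all add: m_assoc)
    with Suc.IH show ?case
      by (simp add: theta omega omega' power_mult[symmetric] mult.commute del: nat_pow_Suc)
  qed (use g in simp)
  then show "\<theta> (g \<otimes> s [^] n) = \<theta> g" "\<omega> (g \<otimes> s [^] n) = \<omega> g ^ (r ^ n)" "\<omega>' (g \<otimes> s [^] n) = \<omega>' g"
    by auto
qed

lemma t_pow:
  assumes g: "g \<in> carrier G"
  shows "\<theta> (g \<otimes> t [^] (n::nat)) = \<theta> g" "\<omega> (g \<otimes> t [^] n) = \<omega> g" "\<omega>' (g \<otimes> t [^] n) = \<omega>' g ^ (r ^ n)"
proof -
  have "\<theta> (g \<otimes> t [^] n) = \<theta> g \<and> \<omega> (g \<otimes> t [^] n) = \<omega> g \<and> \<omega>' (g \<otimes> t [^] n) = \<omega>' g ^ (r ^ n)"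
  proof (induction n)
    case (Suc n)
    have "g \<otimes> t [^] Suc n = g \<otimes> t [^] n \<otimes> t" "g \<otimes> t [^] n \<in> carrier G"
      using g st by (simp_all add: m_assoc)
    with Suc.IH show ?case
      by (simp add: theta omega omega' power_mult[symmetric] mult.commute del: nat_pow_Suc)
  qed (use g in simp)
  then show "\<theta> (g \<otimes> t [^] n) = \<theta> g" "\<omega> (g \<otimes> t [^] n) = \<omega> g" "\<omega>' (g \<otimes> t [^] n) = \<omega>' g ^ (r ^ n)"
    by auto
qed

text \<open>A right factor s^x is invisible to \<theta> and cancels the s^(-x) of the conjugate,
  which leaves g t^w s^x a.\<close>

lemma theta_conj_a:
  assumes g: "g \<in> carrier G"
  shows "\<theta> (g \<otimes> (t [^] int w \<otimes> s_conj a (int x))) = \<theta> g * \<omega> g ^ (r ^ x)"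
proof -
  let ?h = "g \<otimes> (t [^] int w \<otimes> s_conj a (int x))"
  have h: "?h \<in> carrier G" using g ab st by simp
  have "s [^] (- int x) \<otimes> s [^] x = \<one>" using st by (simp add: int_pow_neg int_pow_int)
  then have "?h \<otimes> s [^] x = g \<otimes> t [^] w \<otimes> s [^] x \<otimes> a"
    using g ab st st_int[of "- int x"] by (simp add: s_conj_def m_assoc int_pow_int)
  then have "\<theta> ?h = \<theta> (g \<otimes> t [^] w \<otimes> s [^] x \<otimes> a)" using s_pow(1)[OF h, of x] by simp
  then show ?thesis using g st by (simp add: theta s_pow t_pow)
qed

lemma conj_b:
  assumes g: "g \<in> carrier G"
  shows "\<theta> (g \<otimes> (s [^] int w \<otimes> commuting_pair.s_conj G t b (int x))) = \<theta> g * \<omega>' g ^ (r ^ x)"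
    and "\<omega> (g \<otimes> (s [^] int w \<otimes> commuting_pair.s_conj G t b (int x))) = \<omega> g ^ (r ^ w)"
proof -
  interpret sw: commuting_pair G p \<zeta> t s by unfold_locales (use st in auto)
  let ?h = "g \<otimes> (s [^] int w \<otimes> sw.s_conj b (int x))"
  have h: "?h \<in> carrier G" using g ab st by simp
  have "t [^] (- int x) \<otimes> t [^] x = \<one>" using st by (simp add: int_pow_neg int_pow_int)
  then have *: "?h \<otimes> t [^] x = g \<otimes> s [^] w \<otimes> t [^] x \<otimes> b"
    using g ab st st_int[of "- int x"] by (simp add: sw.s_conj_def m_assoc int_pow_int)
  then have "\<theta> ?h = \<theta> (g \<otimes> s [^] w \<otimes> t [^] x \<otimes> b)" using t_pow(1)[OF h, of x] by simp
  then show "\<theta> ?h = \<theta> g * \<omega>' g ^ (r ^ x)" using g st by (simp add: theta s_pow t_pow)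
  from * have "\<omega> ?h = \<omega> (g \<otimes> s [^] w \<otimes> t [^] x \<otimes> b)" using t_pow(2)[OF h, of x] by simp
  then show "\<omega> ?h = \<omega> g ^ (r ^ w)" using g st by (simp add: omega s_pow t_pow)
qed

text \<open>\<theta> does not notice the power t^w, so the sum over w is a character sum that
  vanishes off the diagonal: a t-fixed vector is killed by every e_j with j nonzero.\<close>

lemma entry_value_a:
  assumes g: "g \<in> carrier G" and xz: "x < p" "z < p"
  shows "entry_value a (\<lambda>k. \<theta> (g \<otimes> k)) (int x) (int z) = (if x = z then \<theta> g * \<omega> g ^ (r ^ x) else 0)"
proof -
  have "entry_value a (\<lambda>k. \<theta> (g \<otimes> k)) (int x) (int z) =
      (\<Sum>w\<in>Zmod p. \<zeta> powi (w * (int x - int z))) / of_nat p * (\<theta> g * \<omega> g ^ (r ^ x))"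
    unfolding entry_value_def sum_divide_distrib sum_distrib_right sum_residues
    by (simp add: theta_conj_a[OF g] algebra_simps)
  moreover have "int p dvd int x - int z \<longleftrightarrow> x = z"
    using xz by (metis mod_eq_dvd_iff mod_less of_nat_eq_iff of_nat_mod)
  ultimately show ?thesis using p_pos by (simp add: sum_zeta_powi)
qed

text \<open>\<alpha> comes from averaging \<omega> over the powers of s in f_0, \<alpha>' from the
  conjugates of b, and 1 / p from the normalisation of f_0. The exponent r^x left by
  \<open>a\<close> is absorbed, since the orbit sum is the same at g and at g s^x.\<close>

lemma entry_value_b:
  assumes g: "g \<in> carrier G"
  shows "(\<Sum>i<p. commuting_pair.entry_value G p \<zeta> t s b (\<lambda>k. \<theta> (g \<otimes> k) * \<omega> (g \<otimes> k) ^ (r ^ x)) (int i) (int i)) =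
    \<theta> g * \<alpha> * \<alpha>' / of_nat p"
proof -
  interpret sw: commuting_pair G p \<zeta> t s by unfold_locales (use st in auto)
  have "(\<Sum>w<p. (\<omega> g ^ (r ^ w)) ^ (r ^ x)) = (\<Sum>w<p. \<omega> (g \<otimes> s [^] x) ^ (r ^ w))"
    by (simp add: s_pow[OF g] mult.commute flip: power_mult)
  then have \<alpha>: "(\<Sum>w<p. (\<omega> g ^ (r ^ w)) ^ (r ^ x)) = \<alpha>" using orbit_sum(1) g st by simp
  have "(\<Sum>i<p. sw.entry_value b (\<lambda>k. \<theta> (g \<otimes> k) * \<omega> (g \<otimes> k) ^ (r ^ x)) (int i) (int i)) =
      (\<Sum>i<p. \<Sum>w<p. \<theta> g * \<omega>' g ^ (r ^ i) * (\<omega> g ^ (r ^ w)) ^ (r ^ x) / of_nat p)"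
    unfolding sw.entry_value_def sum_residues by (simp add: conj_b[OF g])
  also have "\<dots> = \<theta> g * (\<Sum>i<p. \<omega>' g ^ (r ^ i)) * (\<Sum>w<p. (\<omega> g ^ (r ^ w)) ^ (r ^ x)) / of_nat p"
    by (simp add: sum_divide_distrib sum_distrib_left sum_distrib_right mult.assoc)
      (subst sum.swap, simp)
  finally show ?thesis by (simp add: \<alpha> orbit_sum(2)[OF g] mult_ac)
qed

end

context group_twist
begin

text \<open>\<open>A\<close> and \<open>B\<close> below are x and y, and \<theta>1 \<otimes>
  \<theta>2 is an eigenfunctional of right multiplication by \<open>Z\<close>. The two actions have
  independent parameters, so that all four periods vary separately.\<close>

lemma orbit_sums_integral:
  assumes frame: "integral_frame H n x F"
    and at: "a \<otimes> t = t \<otimes> a" and bs: "b \<otimes> s = s \<otimes> b"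
    and act1: "state_action G p \<zeta> s t a b r \<theta>1 \<omega>1 \<omega>1' \<alpha>1 \<alpha>1'"
    and act2: "state_action G p \<zeta> s t a b r \<theta>2 \<omega>2 \<omega>2' \<alpha>2 \<alpha>2'"
  shows "algebraic_int (\<alpha>1 * \<alpha>1' * (\<alpha>2 * \<alpha>2') / of_nat p)"
proof -
  interpret fr: integral_frame H n x F by fact
  interpret sw: commuting_pair G p \<zeta> t s by (rule swapped)
  interpret A1: state_action G p \<zeta> s t a b r \<theta>1 \<omega>1 \<omega>1' \<alpha>1 \<alpha>1' by fact
  interpret A2: state_action G p \<zeta> s t a b r \<theta>2 \<omega>2 \<omega>2' \<alpha>2 \<alpha>2' by fact
  note a = A1.ab(1) and b = A1.ab(2)
  let ?C = "carrier G"
  define A where "A = (\<lambda>k. \<Sum>i<p. matrix_entry a (int i) (int i) k)"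
  define B where "B = (\<lambda>k. \<Sum>i<p. sw.matrix_entry b (int i) (int i) k)"
  define Z where "Z = hmult2 H (vtensor B B) (hcomult H A)"
  define P where "P = vtensor \<theta>1 \<theta>2"
  have Z: "Z \<in> fr.integral_elements2"
    unfolding Z_def A_def B_def
    by (intro fr.hmult2_integral fr.vtensor_integral fr.hcomult_integral
        cocharacter_s_integral cocharacter_t_integral a at b bs) (fact frame)+
  have pair_A: "pairing (?C \<times> ?C) (vtensor (\<lambda>k. \<theta>1 (g \<otimes> k)) (\<lambda>k. \<theta>2 (g' \<otimes> k))) (hcomult H A) =
      (\<Sum>i<p. (\<theta>1 g * \<omega>1 g ^ (r ^ i)) * (\<theta>2 g' * \<omega>2 g' ^ (r ^ i)))"
    if g: "g \<in> ?C" "g' \<in> ?C" for g g'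
  proof -
    have "pairing (?C \<times> ?C) (vtensor (\<lambda>k. \<theta>1 (g \<otimes> k)) (\<lambda>k. \<theta>2 (g' \<otimes> k))) (hcomult H A) =
        (\<Sum>i<p. 1 * pairing (?C \<times> ?C) (vtensor (\<lambda>k. \<theta>1 (g \<otimes> k)) (\<lambda>k. \<theta>2 (g' \<otimes> k)))
          (hcomult H (matrix_entry a (int i) (int i))))"
      using lin_ext_sum[of "basis H" "bcomult H" "\<lambda>_. 1" "\<lambda>i. matrix_entry a (int i) (int i)" "{..<p}"]
      by (simp only: A_def hcomult_def pairing_sum[symmetric]) simp
    also have "\<dots> = (\<Sum>i<p. \<Sum>z<p. entry_value a (\<lambda>k. \<theta>1 (g \<otimes> k)) (int i) (int z) *
        entry_value a (\<lambda>k. \<theta>2 (g' \<otimes> k)) (int z) (int i))"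
      unfolding vtensor_def pairing_hcomult_entry[OF a] matrix_entry_comult[OF a at]
      unfolding sum_residues by simp
    also have "\<dots> = (\<Sum>i<p. \<Sum>z<p. if i = z then (\<theta>1 g * \<omega>1 g ^ (r ^ i)) * (\<theta>2 g' * \<omega>2 g' ^ (r ^ i)) else 0)"
      by (intro sum.cong refl) (auto simp: A1.entry_value_a A2.entry_value_a g)
    finally show ?thesis by simp
  qed
  have pair_B: "pairing ?C f B = (\<Sum>i<p. sw.entry_value b f (int i) (int i))" for f
    using pairing_sum[of ?C f "\<lambda>_. 1" "\<lambda>i. sw.matrix_entry b (int i) (int i)" "{..<p}"]
    by (simp add: B_def sw.pairing_matrix_entry[OF finite_G b])
  have P_Z: "pairing (?C \<times> ?C) (\<lambda>k. P (gg \<otimes>\<^bsub>G \<times>\<times> G\<^esub> k)) Z = \<alpha>1 * \<alpha>1' * (\<alpha>2 * \<alpha>2') / of_nat p * P gg"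
    if gg: "gg \<in> ?C \<times> ?C" for gg
  proof -
    obtain g g' where gg': "gg = (g, g')" "g \<in> ?C" "g' \<in> ?C" using gg by auto
    have "pairing (?C \<times> ?C) (\<lambda>k. P (gg \<otimes>\<^bsub>G \<times>\<times> G\<^esub> k)) Z =
        pairing (?C \<times> ?C) (\<lambda>h. pairing (?C \<times> ?C) (\<lambda>k. P (gg \<otimes>\<^bsub>G \<times>\<times> G\<^esub> (h \<otimes>\<^bsub>G \<times>\<times> G\<^esub> k))) (hcomult H A)) (vtensor B B)"
      using pairing_bilin_ext_group[OF GG_finite GG.m_closed, of "\<lambda>k. P (gg \<otimes>\<^bsub>G \<times>\<times> G\<^esub> k)" "vtensor B B" "hcomult H A"]
      unfolding Z_def hmult2_H by (simp only: carrier_DirProd)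
    also have "\<dots> = pairing (?C \<times> ?C) (\<lambda>h. \<Sum>i<p. vtensor (\<lambda>k. \<theta>1 (g \<otimes> k) * \<omega>1 (g \<otimes> k) ^ (r ^ i))
        (\<lambda>k. \<theta>2 (g' \<otimes> k) * \<omega>2 (g' \<otimes> k) ^ (r ^ i)) h) (vtensor B B)"
    proof (rule pairing_cong)
      fix h assume "h \<in> ?C \<times> ?C"
      then obtain h1 h2 where h: "h = (h1, h2)" "h1 \<in> ?C" "h2 \<in> ?C" by auto
      have "pairing (?C \<times> ?C) (\<lambda>k. P (gg \<otimes>\<^bsub>G \<times>\<times> G\<^esub> (h \<otimes>\<^bsub>G \<times>\<times> G\<^esub> k))) (hcomult H A) =
          pairing (?C \<times> ?C) (vtensor (\<lambda>k. \<theta>1 (g \<otimes> h1 \<otimes> k)) (\<lambda>k. \<theta>2 (g' \<otimes> h2 \<otimes> k))) (hcomult H A)"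
        by (rule pairing_cong) (auto simp: P_def vtensor_def gg' h m_assoc)
      then show "pairing (?C \<times> ?C) (\<lambda>k. P (gg \<otimes>\<^bsub>G \<times>\<times> G\<^esub> (h \<otimes>\<^bsub>G \<times>\<times> G\<^esub> k))) (hcomult H A) =
        (\<Sum>i<p. vtensor (\<lambda>k. \<theta>1 (g \<otimes> k) * \<omega>1 (g \<otimes> k) ^ (r ^ i)) (\<lambda>k. \<theta>2 (g' \<otimes> k) * \<omega>2 (g' \<otimes> k) ^ (r ^ i)) h)"
        using pair_A[of "g \<otimes> h1" "g' \<otimes> h2"] gg' h by (simp add: vtensor_def)
    qed
    \<comment> \<open>The summand no longer depends on \<open>i\<close>: p equal terms with
      denominator p^2.\<close>
    also have "\<dots> = (\<Sum>i<p. (\<theta>1 g * \<alpha>1 * \<alpha>1' / of_nat p) * (\<theta>2 g' * \<alpha>2 * \<alpha>2' / of_nat p))"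
      by (simp only: pairing_sum_left pairing_vtensor pair_B A1.entry_value_b[OF gg'(2)] A2.entry_value_b[OF gg'(3)])
    finally show ?thesis using p_pos by (simp add: P_def vtensor_def gg'(1))
  qed
  have basis: "basis H \<times> basis H = carrier (G \<times>\<times> G)" by (simp add: H_simps)
  show ?thesis
  proof (rule fr.integral_eigenvalue2[OF Z])
    fix h assume "h \<in> hspace2 H"
    have "pairing (basis H \<times> basis H) P (hmult2 H h Z) =
        pairing (?C \<times> ?C) (\<lambda>gg. pairing (?C \<times> ?C) (\<lambda>k. P (gg \<otimes>\<^bsub>G \<times>\<times> G\<^esub> k)) Z) h"
      using pairing_bilin_ext_group[OF GG_finite GG.m_closed, of P h Z]
      unfolding basis hmult2_H by (simp only: carrier_DirProd)
    also have "\<dots> = pairing (?C \<times> ?C) (\<lambda>gg. \<alpha>1 * \<alpha>1' * (\<alpha>2 * \<alpha>2') / of_nat p * P gg) h"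
      by (rule pairing_cong) (rule P_Z)
    also have "\<dots> = \<alpha>1 * \<alpha>1' * (\<alpha>2 * \<alpha>2') / of_nat p * pairing (?C \<times> ?C) P h"
      by (rule pairing_mult_left)
    finally show "pairing (basis H \<times> basis H) P (hmult2 H h Z) =
        \<alpha>1 * \<alpha>1' * (\<alpha>2 * \<alpha>2') / of_nat p * pairing (basis H \<times> basis H) P h"
      by (simp only: H_simps(2))
  next
    show "unit_vec (\<one>, \<one>) \<in> hspace2 H"
      by (auto simp: fr.hspace_eq H_simps coord_space_UNIV_iff unit_vec_def)
    show "pairing (basis H \<times> basis H) P (unit_vec (\<one>, \<one>)) \<noteq> 0"
      using finite_G by (simp add: H_simps pairing_unit_vec P_def vtensor_def A1.theta A2.theta)
  qed
qed

end

section \<open>The presented group and its action\<close>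

text \<open>\<open>G\<close> acts from the right on triples \<open>(z, w, w')\<close> with \<open>w\<^sup>q = w'\<^sup>q = 1\<close>. The \<open>z\<close>-component
  of \<open>(1, w, w') g\<close> is a matrix coefficient, at a vector fixed by \<open>\<sigma>\<close> and \<open>\<tau>\<close>, of the representation
  induced from the character \<open>a \<mapsto> w\<close>, \<open>b \<mapsto> w'\<close>; this avoids a normal form in \<open>G\<close>.
  The exponent \<open>r\<^sup>p\<^sup>-\<^sup>1\<close> inverts \<open>r\<close> modulo \<open>q\<close>.\<close>

type_synonym state = "complex \<times> complex \<times> complex"

fun state_step :: "nat \<Rightarrow> nat \<Rightarrow> state \<Rightarrow> bgen \<times> bool \<Rightarrow> state" where
  "state_step p r (z, w, w') (Sigma_gen, e) = (z, w ^ (if e then r else r ^ (p - 1)), w')"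
| "state_step p r (z, w, w') (Tau_gen, e) = (z, w, w' ^ (if e then r else r ^ (p - 1)))"
| "state_step p r (z, w, w') (A_gen, e) = (if e then z * w else z / w, w, w')"
| "state_step p r (z, w, w') (B_gen, e) = (if e then z * w' else z / w', w, w')"

definition state_act :: "nat \<Rightarrow> nat \<Rightarrow> state \<Rightarrow> bgen gword \<Rightarrow> state" where
  "state_act p r = foldl (state_step p r)"

lemma state_act_append: "state_act p r st (u @ v) = state_act p r (state_act p r st u) v"
  by (simp add: state_act_def)

lemma state_act_simps [simp]:
  "state_act p r st [] = st" "state_act p r st (l # u) = state_act p r (state_step p r st l) u"
  by (simp_all add: state_act_def)

lemma state_act_gpow:
  "state_act p r (z, w, w') (gpow Sigma_gen n) = (z, w ^ (r ^ n), w')"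
  "state_act p r (z, w, w') (gpow Tau_gen n) = (z, w, w' ^ (r ^ n))"
  "state_act p r (z, w, w') (gpow A_gen n) = (z * w ^ n, w, w')"
  "state_act p r (z, w, w') (gpow B_gen n) = (z * w' ^ n, w, w')"
  unfolding gpow_def
  by (induction n arbitrary: z w w') (simp_all add: mult_ac flip: power_mult)

lemma power_mod_exponent:
  fixes w :: complex
  assumes "w ^ q = 1"
  shows "w ^ n = w ^ (n mod q)"
proof -
  have "w ^ n = w ^ (q * (n div q) + n mod q)" by simp
  also have "\<dots> = w ^ (n mod q)" using assms by (simp only: power_add power_mult) simp
  finally show ?thesis .
qed

text \<open>For a primitive q-th root of unity w, a Gauss period of the subgroup generated by r; for
  w = 1 it is p.\<close>

definition orbit_sum :: "nat \<Rightarrow> nat \<Rightarrow> complex \<Rightarrow> complex" where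
  "orbit_sum p r w = (\<Sum>x<p. w ^ (r ^ x))"

locale Bpq_params =
  fixes p q r :: nat
  assumes p: "Factorial_Ring.prime p" and q: "Factorial_Ring.prime q" and pq: "p dvd q - 1"
    and ord_r: "Pocklington.ord q r = p"
begin

lemma p_gt0: "p > 0" and q_gt1: "q > 1"
  using p q prime_gt_0_nat prime_gt_1_nat by auto

lemma r_pow_mod: "r ^ p mod q = 1"
  using ord_works[of r q] q_gt1 by (simp add: ord_r cong_def)

lemma r_pow_eq: 
  fixes w :: complex
  assumes "w ^ q = 1"
  shows "w ^ (r ^ p) = w" "(w ^ r) ^ (r ^ (p - 1)) = w" "(w ^ (r ^ (p - 1))) ^ r = w"
proof -
  show 1: "w ^ (r ^ p) = w" using power_mod_exponent[OF assms, of "r ^ p"] by (simp add: r_pow_mod)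
  have "r * r ^ (p - 1) = r ^ p" using p_gt0 by (cases p) auto
  with 1 show "(w ^ r) ^ (r ^ (p - 1)) = w" "(w ^ (r ^ (p - 1))) ^ r = w"
    by (simp_all add: mult.commute flip: power_mult)
qed

text \<open>On these triples the exponent r^p acts trivially and w, w' are nonzero, so opposite
  letters undo each other.\<close>

definition valid :: "state \<Rightarrow> bool" where
  "valid st \<longleftrightarrow> (case st of (z, w, w') \<Rightarrow> w ^ q = 1 \<and> w' ^ q = 1)"

lemma valid_nonzero: "valid (z, w, w') \<Longrightarrow> w \<noteq> 0 \<and> w' \<noteq> 0"
  using q_gt1 by (auto simp: valid_def power_0_left)

lemma power_root: "(w :: complex) ^ q = 1 \<Longrightarrow> (w ^ n) ^ q = 1"
  by (metis mult.commute power_mult power_one)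

lemma valid_step: "valid st \<Longrightarrow> valid (state_step p r st l)"
  by (induction p r st l rule: state_step.induct) (auto simp: valid_def power_root)

lemma valid_act: "valid st \<Longrightarrow> valid (state_act p r st u)"
  by (induction u arbitrary: st) (simp_all only: state_act_simps valid_step)

abbreviation "rels \<equiv> Bpq_relations p q r"

text \<open>For instance \<sigma> a \<sigma>^(-1) multiplies z by w^r and restores w, which is the
  effect of a^r.\<close>

lemma state_act_rel:
  assumes "(u, v) \<in> rels" "valid st"
  shows "state_act p r st u = state_act p r st v"
proof -
  obtain z w w' where st: "st = (z, w, w')" by (cases st)
  have w: "w ^ q = 1" "w' ^ q = 1" "w \<noteq> 0" "w' \<noteq> 0"
    using assms(2) valid_nonzero by (auto simp: st valid_def)
  note pw = r_pow_eq[OF w(1)] r_pow_eq[OF w(2)]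
  show ?thesis
    using assms(1) w unfolding Bpq_relations_def st
    by (auto simp: state_act_gpow pw gconj_def gcomm_def simp del: One_nat_def)
qed

lemma state_act_pres_eq:
  assumes "pres_eq rels u v" "valid st"
  shows "state_act p r st u = state_act p r st v"
  using assms
proof (induction arbitrary: st)
  case (pres_cancel x e)
  obtain z w w' where st: "st = (z, w, w')" by (cases st)
  have w: "w ^ q = 1" "w' ^ q = 1" "w \<noteq> 0" "w' \<noteq> 0"
    using pres_cancel valid_nonzero by (auto simp: st valid_def)
  show ?case
    using w r_pow_eq[OF w(1)] r_pow_eq[OF w(2)] by (cases x; cases e) (auto simp: st simp del: One_nat_def)
next
  case (pres_append u u' v v')
  then show ?case by (simp add: state_act_append valid_act)
qed (auto simp: state_act_rel)

text \<open>Passing to w^r shifts the sum cyclically: the new last term w^(r^p) is the old first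
  term w. Adding w on both sides completes each to a sum over p + 1 terms.\<close>

lemma orbit_sum_power_r:
  assumes "w ^ q = 1"
  shows "orbit_sum p r (w ^ r) = orbit_sum p r w"
proof -
  have "orbit_sum p r (w ^ r) + w = (\<Sum>x<p. w ^ (r ^ Suc x)) + w ^ (r ^ 0)"
    by (simp add: orbit_sum_def flip: power_mult)
  also have "\<dots> = (\<Sum>x<Suc p. w ^ (r ^ x))" by (subst sum.lessThan_Suc_shift) simp
  also have "\<dots> = orbit_sum p r w + w" by (simp add: orbit_sum_def r_pow_eq(1)[OF assms])
  finally show ?thesis by simp
qed

lemma orbit_sum_step:
  assumes "valid (z, w, w')" "state_step p r (z, w, w') l = (z1, w1, w1')"
  shows "orbit_sum p r w1 = orbit_sum p r w" "orbit_sum p r w1' = orbit_sum p r w'"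
proof -
  obtain x e where l: "l = (x, e)" by (cases l)
  have w: "w ^ q = 1" "w' ^ q = 1" using assms(1) by (auto simp: valid_def)
  have 1: "orbit_sum p r (w ^ (r ^ (p - 1))) = orbit_sum p r w" if "w ^ q = 1" for w
    using orbit_sum_power_r[OF power_root[OF that], of "r ^ (p - 1)"] r_pow_eq(3)[OF that] by simp
  show "orbit_sum p r w1 = orbit_sum p r w" "orbit_sum p r w1' = orbit_sum p r w'"
    using assms(2) 1[OF w(1)] 1[OF w(2)] orbit_sum_power_r[OF w(1)] orbit_sum_power_r[OF w(2)]
    by (cases x; cases e; auto simp: l simp del: One_nat_def)+
qed

text \<open>Words move w and w' only within their orbits under the powers of r, so the period in
  \<open>state_action\<close> does not depend on the group element.\<close>

lemma orbit_sum_act: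
  assumes "valid st"
  shows "orbit_sum p r (fst (snd (state_act p r st u))) = orbit_sum p r (fst (snd st)) \<and>
    orbit_sum p r (snd (snd (state_act p r st u))) = orbit_sum p r (snd (snd st))"
  using assms
proof (induction u arbitrary: st)
  case (Cons l u)
  obtain z w w' where st: "st = (z, w, w')" by (cases st)
  obtain z1 w1 w1' where st1: "state_step p r st l = (z1, w1, w1')" by (cases "state_step p r st l")
  show ?case
    using Cons.IH[OF valid_step[OF Cons.prems, of l]] orbit_sum_step[of z w w' l z1 w1 w1'] Cons.prems st1
    by (simp add: st)
qed simp

abbreviation "G \<equiv> Bpq_group p q r"
abbreviation "gen \<equiv> Bpq_gen p q r"
abbreviation "cls \<equiv> pres_class rels"

sublocale G: group G
  unfolding Bpq_group_def by (rule group_presented_group)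

lemma cls_mult: "cls u \<otimes>\<^bsub>G\<^esub> cls v = cls (u @ v)"
  by (simp add: Bpq_group_def presented_group_mult)

lemma cls_one: "\<one>\<^bsub>G\<^esub> = cls []"
  by (simp add: Bpq_group_def presented_group_def)

lemma carrier_G: "carrier G = range cls"
  by (simp add: Bpq_group_def presented_group_def)

lemma cls_in [simp]: "cls u \<in> carrier G" by (simp add: carrier_G)

lemma gen_in [simp]: "gen x \<in> carrier G" by (simp add: Bpq_gen_def)

lemma cls_gpow: "cls (gpow x n) = gen x [^]\<^bsub>G\<^esub> n"
proof (induction n)
  case (Suc n)
  have "gpow x (Suc n) = gpow x n @ [(x, True)]" by (simp add: gpow_def replicate_append_same)
  then show ?case using Suc by (simp add: cls_mult[symmetric] Bpq_gen_def)
qed (simp add: gpow_def cls_one)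

lemma cls_inverse: "cls [(x, False)] = inv\<^bsub>G\<^esub> gen x"
proof -
  have "cls [(x, True)] \<otimes>\<^bsub>G\<^esub> cls [(x, False)] = \<one>\<^bsub>G\<^esub>"
    using pres_cancel[of rels x True] by (simp add: cls_mult cls_one pres_class_eq_iff)
  then show ?thesis using G.inv_unique'[of "gen x" "cls [(x, False)]"]
    by (metis Bpq_gen_def G.inv_equality G.inv_inv cls_in)
qed

lemma cls_rel: "(u, v) \<in> rels \<Longrightarrow> cls u = cls v"
  by (simp add: pres_class_eq_iff pres_rel)

lemma cls_words:
  "cls (gconj x y) = gen x \<otimes>\<^bsub>G\<^esub> gen y \<otimes>\<^bsub>G\<^esub> inv\<^bsub>G\<^esub> gen x"
  "cls (gcomm x y) = gen x \<otimes>\<^bsub>G\<^esub> gen y \<otimes>\<^bsub>G\<^esub> inv\<^bsub>G\<^esub> gen x \<otimes>\<^bsub>G\<^esub> inv\<^bsub>G\<^esub> gen y"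
  unfolding cls_inverse[symmetric] by (simp_all add: Bpq_gen_def cls_mult gconj_def gcomm_def)

lemma gen_pow:
  "gen Sigma_gen [^]\<^bsub>G\<^esub> p = \<one>\<^bsub>G\<^esub>" "gen Tau_gen [^]\<^bsub>G\<^esub> p = \<one>\<^bsub>G\<^esub>"
  "gen A_gen [^]\<^bsub>G\<^esub> q = \<one>\<^bsub>G\<^esub>" "gen B_gen [^]\<^bsub>G\<^esub> q = \<one>\<^bsub>G\<^esub>"
  unfolding cls_gpow[symmetric] cls_one by (rule cls_rel; simp add: Bpq_relations_def)+

lemma gen_conj:
  assumes "(gconj x y, gpow y r) \<in> rels"
  shows "gen x \<otimes>\<^bsub>G\<^esub> gen y = gen y [^]\<^bsub>G\<^esub> r \<otimes>\<^bsub>G\<^esub> gen x"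
proof -
  have "gen x \<otimes>\<^bsub>G\<^esub> gen y \<otimes>\<^bsub>G\<^esub> inv\<^bsub>G\<^esub> gen x = gen y [^]\<^bsub>G\<^esub> r"
    using cls_rel[OF assms] by (simp add: cls_words cls_gpow)
  then have "gen x \<otimes>\<^bsub>G\<^esub> gen y \<otimes>\<^bsub>G\<^esub> inv\<^bsub>G\<^esub> gen x \<otimes>\<^bsub>G\<^esub> gen x = gen y [^]\<^bsub>G\<^esub> r \<otimes>\<^bsub>G\<^esub> gen x"
    by simp
  then show ?thesis by (simp add: G.m_assoc)
qed

lemma gen_comm:
  assumes "(gcomm x y, []) \<in> rels"
  shows "gen x \<otimes>\<^bsub>G\<^esub> gen y = gen y \<otimes>\<^bsub>G\<^esub> gen x"
proof -
  have "gen x \<otimes>\<^bsub>G\<^esub> gen y \<otimes>\<^bsub>G\<^esub> inv\<^bsub>G\<^esub> gen x \<otimes>\<^bsub>G\<^esub> inv\<^bsub>G\<^esub> gen y = \<one>\<^bsub>G\<^esub>"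
    using cls_rel[OF assms] by (simp add: cls_words cls_one)
  then have "(gen x \<otimes>\<^bsub>G\<^esub> gen y) \<otimes>\<^bsub>G\<^esub> inv\<^bsub>G\<^esub> (gen y \<otimes>\<^bsub>G\<^esub> gen x) = \<one>\<^bsub>G\<^esub>"
    by (simp add: G.inv_mult_group G.m_assoc)
  then show ?thesis by (metis G.inv_equality G.inv_inv G.inv_closed G.m_closed gen_in)
qed

lemmas gen_relations =
  gen_conj[of Sigma_gen A_gen, unfolded Bpq_relations_def, simplified]
  gen_conj[of Tau_gen B_gen, unfolded Bpq_relations_def, simplified]
  gen_comm[of Sigma_gen B_gen, unfolded Bpq_relations_def, simplified]
  gen_comm[of Tau_gen A_gen, unfolded Bpq_relations_def, simplified]
  gen_comm[of A_gen B_gen, unfolded Bpq_relations_def, simplified]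
  gen_comm[of Sigma_gen Tau_gen, unfolded Bpq_relations_def, simplified]

end

section \<open>Finiteness of the presented group\<close>

context Bpq_params
begin

lemma nat_pow_mod:
  fixes k n :: nat
  assumes "g \<in> carrier G" "g [^]\<^bsub>G\<^esub> n = \<one>\<^bsub>G\<^esub>"
  shows "g [^]\<^bsub>G\<^esub> k = g [^]\<^bsub>G\<^esub> (k mod n)"
proof -
  have "g [^]\<^bsub>G\<^esub> k = g [^]\<^bsub>G\<^esub> (n * (k div n) + k mod n)" by simp
  also have "\<dots> = g [^]\<^bsub>G\<^esub> (k mod n)"
    using assms by (simp only: G.nat_pow_mult[symmetric] G.nat_pow_pow[symmetric]) simp
  finally show ?thesis .
qed

lemma range_pow_finite:
  fixes n :: nat
  assumes "g \<in> carrier G" "g [^]\<^bsub>G\<^esub> n = \<one>\<^bsub>G\<^esub>" "n > 0"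
  shows "finite (range (\<lambda>k::nat. g [^]\<^bsub>G\<^esub> k))"
proof (rule finite_subset)
  show "range (\<lambda>k::nat. g [^]\<^bsub>G\<^esub> k) \<subseteq> (\<lambda>k::nat. g [^]\<^bsub>G\<^esub> k) ` {..<n}"
    using nat_pow_mod[OF assms(1,2)] assms(3) by (metis image_subsetI lessThan_iff mod_less_divisor imageI)
qed simp

text \<open>Existence of this form for every element bounds G from above; distinctions between
  elements come from the action on states.\<close>

definition normal_form :: "nat \<Rightarrow> nat \<Rightarrow> nat \<Rightarrow> nat \<Rightarrow> bgen gword set" where
  "normal_form k l i j = gen A_gen [^]\<^bsub>G\<^esub> k \<otimes>\<^bsub>G\<^esub> gen B_gen [^]\<^bsub>G\<^esub> l \<otimes>\<^bsub>G\<^esub>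
     gen Sigma_gen [^]\<^bsub>G\<^esub> i \<otimes>\<^bsub>G\<^esub> gen Tau_gen [^]\<^bsub>G\<^esub> j"

lemma conj_pow:
  assumes xy: "x \<in> carrier G" "y \<in> carrier G" "x \<otimes>\<^bsub>G\<^esub> y = y [^]\<^bsub>G\<^esub> m \<otimes>\<^bsub>G\<^esub> x"
  shows "x \<otimes>\<^bsub>G\<^esub> y [^]\<^bsub>G\<^esub> (k::nat) = y [^]\<^bsub>G\<^esub> (m * k) \<otimes>\<^bsub>G\<^esub> x"
proof (induction k)
  case (Suc k)
  have "x \<otimes>\<^bsub>G\<^esub> y [^]\<^bsub>G\<^esub> Suc k = (x \<otimes>\<^bsub>G\<^esub> y [^]\<^bsub>G\<^esub> k) \<otimes>\<^bsub>G\<^esub> y"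
    using xy by (simp add: G.m_assoc)
  also have "\<dots> = y [^]\<^bsub>G\<^esub> (m * k) \<otimes>\<^bsub>G\<^esub> (x \<otimes>\<^bsub>G\<^esub> y)"
    using xy(1,2) Suc by (simp add: G.m_assoc)
  also have "\<dots> = y [^]\<^bsub>G\<^esub> (m * k) \<otimes>\<^bsub>G\<^esub> y [^]\<^bsub>G\<^esub> m \<otimes>\<^bsub>G\<^esub> x"
    using xy by (simp add: G.m_assoc)
  also have "\<dots> = y [^]\<^bsub>G\<^esub> (m * Suc k) \<otimes>\<^bsub>G\<^esub> x"
    using xy by (simp add: G.nat_pow_mult add.commute)
  finally show ?case .
qed (use xy in simp)

text \<open>The letter moves right into its own block. On the way \<sigma> multiplies the exponent
  of a by r, \<tau> that of b, and every other block commutes with the letter. Exponents are not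
  reduced.\<close>

lemma gen_mult_normal_form: "\<exists>k' l' i' j'. gen x \<otimes>\<^bsub>G\<^esub> normal_form k l i j = normal_form k' l' i' j'"
proof -
  let ?a = "gen A_gen [^]\<^bsub>G\<^esub> k" and ?b = "gen B_gen [^]\<^bsub>G\<^esub> l"
    and ?s = "gen Sigma_gen [^]\<^bsub>G\<^esub> i" and ?t = "gen Tau_gen [^]\<^bsub>G\<^esub> j"
  have comm: "g \<otimes>\<^bsub>G\<^esub> h [^]\<^bsub>G\<^esub> m = h [^]\<^bsub>G\<^esub> m \<otimes>\<^bsub>G\<^esub> g"
    if "g \<otimes>\<^bsub>G\<^esub> h = h \<otimes>\<^bsub>G\<^esub> g" "g \<in> carrier G" "h \<in> carrier G" for g h and m :: nat
    using conj_pow[of g h 1 m] that by simp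
  have suc: "g \<otimes>\<^bsub>G\<^esub> g [^]\<^bsub>G\<^esub> m = g [^]\<^bsub>G\<^esub> Suc m" if "g \<in> carrier G" for g and m :: nat
    by (rule G.nat_pow_Suc2[OF that, symmetric])
  show ?thesis
  proof (cases x)
    case A_gen
    have "gen A_gen \<otimes>\<^bsub>G\<^esub> normal_form k l i j = (gen A_gen \<otimes>\<^bsub>G\<^esub> ?a) \<otimes>\<^bsub>G\<^esub> ?b \<otimes>\<^bsub>G\<^esub> ?s \<otimes>\<^bsub>G\<^esub> ?t"
      by (simp add: normal_form_def G.m_assoc)
    also have "\<dots> = normal_form (Suc k) l i j" by (simp only: suc gen_in normal_form_def)
    finally show ?thesis using A_gen by blast
  next
    case B_gen
    have "gen B_gen \<otimes>\<^bsub>G\<^esub> normal_form k l i j = (gen B_gen \<otimes>\<^bsub>G\<^esub> ?a) \<otimes>\<^bsub>G\<^esub> ?b \<otimes>\<^bsub>G\<^esub> ?s \<otimes>\<^bsub>G\<^esub> ?t"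
      by (simp add: normal_form_def G.m_assoc)
    also have "gen B_gen \<otimes>\<^bsub>G\<^esub> ?a = ?a \<otimes>\<^bsub>G\<^esub> gen B_gen" by (rule comm) (simp_all add: gen_relations)
    also have "?a \<otimes>\<^bsub>G\<^esub> gen B_gen \<otimes>\<^bsub>G\<^esub> ?b \<otimes>\<^bsub>G\<^esub> ?s \<otimes>\<^bsub>G\<^esub> ?t = ?a \<otimes>\<^bsub>G\<^esub> (gen B_gen \<otimes>\<^bsub>G\<^esub> ?b) \<otimes>\<^bsub>G\<^esub> ?s \<otimes>\<^bsub>G\<^esub> ?t"
      by (simp add: G.m_assoc)
    also have "\<dots> = normal_form k (Suc l) i j" by (simp only: suc gen_in normal_form_def)
    finally show ?thesis using B_gen by blast
  next
    case Sigma_gen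
    have "gen Sigma_gen \<otimes>\<^bsub>G\<^esub> normal_form k l i j = (gen Sigma_gen \<otimes>\<^bsub>G\<^esub> ?a) \<otimes>\<^bsub>G\<^esub> ?b \<otimes>\<^bsub>G\<^esub> ?s \<otimes>\<^bsub>G\<^esub> ?t"
      by (simp add: normal_form_def G.m_assoc)
    also have "gen Sigma_gen \<otimes>\<^bsub>G\<^esub> ?a = gen A_gen [^]\<^bsub>G\<^esub> (r * k) \<otimes>\<^bsub>G\<^esub> gen Sigma_gen"
      by (rule conj_pow) (simp_all add: gen_relations)
    also have "\<dots> \<otimes>\<^bsub>G\<^esub> ?b \<otimes>\<^bsub>G\<^esub> ?s \<otimes>\<^bsub>G\<^esub> ?t =
        gen A_gen [^]\<^bsub>G\<^esub> (r * k) \<otimes>\<^bsub>G\<^esub> (gen Sigma_gen \<otimes>\<^bsub>G\<^esub> ?b) \<otimes>\<^bsub>G\<^esub> ?s \<otimes>\<^bsub>G\<^esub> ?t"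
      by (simp add: G.m_assoc)
    also have "gen Sigma_gen \<otimes>\<^bsub>G\<^esub> ?b = ?b \<otimes>\<^bsub>G\<^esub> gen Sigma_gen"
      by (rule comm) (simp_all add: gen_relations)
    also have "gen A_gen [^]\<^bsub>G\<^esub> (r * k) \<otimes>\<^bsub>G\<^esub> (?b \<otimes>\<^bsub>G\<^esub> gen Sigma_gen) \<otimes>\<^bsub>G\<^esub> ?s \<otimes>\<^bsub>G\<^esub> ?t =
        gen A_gen [^]\<^bsub>G\<^esub> (r * k) \<otimes>\<^bsub>G\<^esub> ?b \<otimes>\<^bsub>G\<^esub> (gen Sigma_gen \<otimes>\<^bsub>G\<^esub> ?s) \<otimes>\<^bsub>G\<^esub> ?t"
      by (simp add: G.m_assoc)
    also have "\<dots> = normal_form (r * k) l (Suc i) j" by (simp only: suc gen_in normal_form_def)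
    finally show ?thesis using Sigma_gen by blast
  next
    case Tau_gen
    have "gen Tau_gen \<otimes>\<^bsub>G\<^esub> normal_form k l i j = (gen Tau_gen \<otimes>\<^bsub>G\<^esub> ?a) \<otimes>\<^bsub>G\<^esub> ?b \<otimes>\<^bsub>G\<^esub> ?s \<otimes>\<^bsub>G\<^esub> ?t"
      by (simp add: normal_form_def G.m_assoc)
    also have "gen Tau_gen \<otimes>\<^bsub>G\<^esub> ?a = ?a \<otimes>\<^bsub>G\<^esub> gen Tau_gen"
      by (rule comm) (simp_all add: gen_relations)
    also have "?a \<otimes>\<^bsub>G\<^esub> gen Tau_gen \<otimes>\<^bsub>G\<^esub> ?b \<otimes>\<^bsub>G\<^esub> ?s \<otimes>\<^bsub>G\<^esub> ?t =
        ?a \<otimes>\<^bsub>G\<^esub> (gen Tau_gen \<otimes>\<^bsub>G\<^esub> ?b) \<otimes>\<^bsub>G\<^esub> ?s \<otimes>\<^bsub>G\<^esub> ?t"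
      by (simp add: G.m_assoc)
    also have "gen Tau_gen \<otimes>\<^bsub>G\<^esub> ?b = gen B_gen [^]\<^bsub>G\<^esub> (r * l) \<otimes>\<^bsub>G\<^esub> gen Tau_gen"
      by (rule conj_pow) (simp_all add: gen_relations)
    also have "?a \<otimes>\<^bsub>G\<^esub> (gen B_gen [^]\<^bsub>G\<^esub> (r * l) \<otimes>\<^bsub>G\<^esub> gen Tau_gen) \<otimes>\<^bsub>G\<^esub> ?s \<otimes>\<^bsub>G\<^esub> ?t =
        ?a \<otimes>\<^bsub>G\<^esub> gen B_gen [^]\<^bsub>G\<^esub> (r * l) \<otimes>\<^bsub>G\<^esub> (gen Tau_gen \<otimes>\<^bsub>G\<^esub> ?s) \<otimes>\<^bsub>G\<^esub> ?t"
      by (simp add: G.m_assoc)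
    also have "gen Tau_gen \<otimes>\<^bsub>G\<^esub> ?s = ?s \<otimes>\<^bsub>G\<^esub> gen Tau_gen"
      by (rule comm) (simp_all add: gen_relations)
    also have "?a \<otimes>\<^bsub>G\<^esub> gen B_gen [^]\<^bsub>G\<^esub> (r * l) \<otimes>\<^bsub>G\<^esub> (?s \<otimes>\<^bsub>G\<^esub> gen Tau_gen) \<otimes>\<^bsub>G\<^esub> ?t =
        ?a \<otimes>\<^bsub>G\<^esub> gen B_gen [^]\<^bsub>G\<^esub> (r * l) \<otimes>\<^bsub>G\<^esub> ?s \<otimes>\<^bsub>G\<^esub> (gen Tau_gen \<otimes>\<^bsub>G\<^esub> ?t)"
      by (simp add: G.m_assoc)
    also have "\<dots> = normal_form k (r * l) i (Suc j)" by (simp only: suc gen_in normal_form_def)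
    finally show ?thesis using Tau_gen by blast
  qed
qed

lemma gen_pow_mult_normal_form:
  "\<exists>k' l' i' j'. gen x [^]\<^bsub>G\<^esub> (m::nat) \<otimes>\<^bsub>G\<^esub> normal_form k l i j = normal_form k' l' i' j'"
proof (induction m)
  case 0
  have "normal_form k l i j \<in> carrier G" by (simp add: normal_form_def)
  then show ?case using G.l_one by auto
next
  case (Suc m)
  then obtain k' l' i' j' where IH: "gen x [^]\<^bsub>G\<^esub> m \<otimes>\<^bsub>G\<^esub> normal_form k l i j = normal_form k' l' i' j'"
    by blast
  have "normal_form k l i j \<in> carrier G" by (simp add: normal_form_def)
  then have "gen x [^]\<^bsub>G\<^esub> Suc m \<otimes>\<^bsub>G\<^esub> normal_form k l i j =
      gen x \<otimes>\<^bsub>G\<^esub> (gen x [^]\<^bsub>G\<^esub> m \<otimes>\<^bsub>G\<^esub> normal_form k l i j)"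
    by (simp only: G.nat_pow_Suc2 gen_in G.m_assoc G.nat_pow_closed)
  then show ?case unfolding IH using gen_mult_normal_form by metis
qed

text \<open>Generators have finite order, so inverse letters are nonnegative powers too, and words
  can be treated by left multiplication with generators.\<close>

lemma cls_letter: "\<exists>m::nat. cls [l] = gen (fst l) [^]\<^bsub>G\<^esub> m"
proof -
  obtain x e where l: "l = (x, e)" by (cases l)
  have "\<exists>n. gen x [^]\<^bsub>G\<^esub> Suc n = \<one>\<^bsub>G\<^esub>"
    using gen_pow p_gt0 q_gt1 by (cases x) (metis Suc_pred' gr_implies_not0 neq0_conv)+
  then obtain n :: nat where "gen x [^]\<^bsub>G\<^esub> n \<otimes>\<^bsub>G\<^esub> gen x = \<one>\<^bsub>G\<^esub>" by auto
  then have "inv\<^bsub>G\<^esub> gen x = gen x [^]\<^bsub>G\<^esub> n" by (intro G.inv_equality) simp_all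
  moreover have "cls [(x, True)] = gen x [^]\<^bsub>G\<^esub> (1::nat)" by (simp add: Bpq_gen_def)
  ultimately show ?thesis using cls_inverse[of x] unfolding l by (cases e) (metis fst_conv)+
qed

lemma cls_normal_form: "\<exists>k l i j. cls u = normal_form k l i j"
proof (induction u)
  case Nil
  have "cls [] = normal_form 0 0 0 0" by (simp add: normal_form_def cls_one[symmetric])
  then show ?case by blast
next
  case (Cons l u)
  then obtain k l' i j where IH: "cls u = normal_form k l' i j" by blast
  obtain m :: nat where "cls [l] = gen (fst l) [^]\<^bsub>G\<^esub> m" using cls_letter by blast
  then have "cls (l # u) = gen (fst l) [^]\<^bsub>G\<^esub> m \<otimes>\<^bsub>G\<^esub> normal_form k l' i j"
    using cls_mult[of "[l]" u] IH by simp
  then show ?case using gen_pow_mult_normal_form by metis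
qed

lemma finite_carrier: "finite (carrier G)"
proof (rule finite_subset)
  let ?P = "\<lambda>x. range (\<lambda>k::nat. gen x [^]\<^bsub>G\<^esub> k)"
  let ?N = "(\<lambda>(a, b, s, t). a \<otimes>\<^bsub>G\<^esub> b \<otimes>\<^bsub>G\<^esub> s \<otimes>\<^bsub>G\<^esub> t) ` (?P A_gen \<times> ?P B_gen \<times> ?P Sigma_gen \<times> ?P Tau_gen)"
  have fin: "finite (?P x)" for x
    using gen_pow p_gt0 q_gt1 by (cases x) (auto simp only: intro!: range_pow_finite[OF gen_in])
  have nf: "normal_form k l i j \<in> ?N" for k l i j
    unfolding normal_form_def by (intro image_eqI[of _ _ "(_, _, _, _)"]) auto
  show "carrier G \<subseteq> ?N"
  proof
    fix g assume "g \<in> carrier G"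
    then obtain u where "g = cls u" by (auto simp: carrier_G)
    then obtain k l i j where "g = normal_form k l i j" using cls_normal_form by blast
    then show "g \<in> ?N" by (simp only: nf)
  qed
  show "finite ?N"
    by (rule finite_imageI[OF finite_cartesian_product[OF _ finite_cartesian_product[OF _
            finite_cartesian_product]]]) (rule fin)+
qed

text \<open>Uses an arbitrary word of the class; on valid states \<open>class_act_cls\<close> makes
  the choice irrelevant.\<close>

definition class_act :: "state \<Rightarrow> bgen gword set \<Rightarrow> state" where
  "class_act st g = state_act p r st (SOME u. u \<in> g)"

lemma class_act_cls:
  assumes "valid st"
  shows "class_act st (cls u) = state_act p r st u"
proof -
  have "(SOME v. v \<in> cls u) \<in> cls u"
    by (rule someI[of _ u]) (simp add: pres_class_def pres_refl)
  then have "pres_eq rels u (SOME v. v \<in> cls u)" by (simp add: pres_class_def)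
  from state_act_pres_eq[OF this assms] show ?thesis by (simp add: class_act_def)
qed

lemma class_act_gen:
  assumes "valid st" "g \<in> carrier G"
  shows "class_act st (g \<otimes>\<^bsub>G\<^esub> gen x) = state_step p r (class_act st g) (x, True)"
proof -
  obtain u where u: "g = cls u" using assms(2) carrier_G by auto
  have "g \<otimes>\<^bsub>G\<^esub> gen x = cls (u @ [(x, True)])" by (simp add: u Bpq_gen_def cls_mult)
  then show ?thesis by (simp add: class_act_cls[OF assms(1)] u state_act_append)
qed

lemma commuting_pair_Bpq:
  assumes "primitive_root_of_unity p \<zeta>"
  shows "commuting_pair G p \<zeta> (gen Sigma_gen) (gen Tau_gen)"
  by unfold_locales (use assms p_gt0 gen_pow gen_relations in auto)

lemma state_action_Bpq:
  assumes \<zeta>: "primitive_root_of_unity p \<zeta>" and w: "w ^ q = 1" "w' ^ q = 1"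
  shows "state_action G p \<zeta> (gen Sigma_gen) (gen Tau_gen) (gen A_gen) (gen B_gen) r
    (\<lambda>g. fst (class_act (1, w, w') g)) (\<lambda>g. fst (snd (class_act (1, w, w') g)))
    (\<lambda>g. snd (snd (class_act (1, w, w') g))) (orbit_sum p r w) (orbit_sum p r w')"
proof -
  interpret commuting_pair G p \<zeta> "gen Sigma_gen" "gen Tau_gen" by (rule commuting_pair_Bpq[OF \<zeta>])
  have valid: "valid (1, w, w')" using w by (simp add: valid_def)
  have step: "state_step p r st (x, True) = (case st of (z, w, w') \<Rightarrow>
      (case x of Sigma_gen \<Rightarrow> (z, w ^ r, w') | Tau_gen \<Rightarrow> (z, w, w' ^ r)
        | A_gen \<Rightarrow> (z * w, w, w') | B_gen \<Rightarrow> (z * w', w, w')))" for st x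
    by (cases st; cases x) simp_all
  show ?thesis
  proof
    fix g assume g: "g \<in> carrier G"
    then obtain u where u: "g = cls u" using carrier_G by auto
    show "(\<Sum>x<p. fst (snd (class_act (1, w, w') g)) ^ r ^ x) = orbit_sum p r w"
      "(\<Sum>x<p. snd (snd (class_act (1, w, w') g)) ^ r ^ x) = orbit_sum p r w'"
      using orbit_sum_act[OF valid, of u] by (simp_all add: u class_act_cls[OF valid] orbit_sum_def)
  next
    show "fst (class_act (1, w, w') \<one>\<^bsub>G\<^esub>) = 1"
      by (simp add: cls_one class_act_cls[OF valid])
  qed (auto simp: class_act_gen[OF valid] step split: prod.splits)
qed

section \<open>Arithmetic of roots of unity and Gauss periods\<close>

lemma algebraic_int_root_of_unity:
  assumes "\<eta> ^ q = (1::complex)"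
  shows "algebraic_int \<eta>"
  by (rule algebraic_int_root[of 1 "monom 1 q"]) (use assms q_gt1 in \<open>auto simp: poly_monom degree_monom_eq\<close>)

lemma primitive_root_exists: "\<exists>\<eta>. primitive_root_of_unity q \<eta>"
proof -
  let ?c = "\<lambda>k. cis (2 * pi * real k / real q)"
  have bij: "bij_betw ?c {..<q} {z. z ^ q = 1}" using q_gt1 by (intro bij_betw_roots_unity) simp
  have pow: "?c 1 ^ k = ?c k" for k by (simp add: DeMoivre mult_ac)
  have "?c k \<noteq> 1" if "0 < k" "k < q" for k
    using bij_betw_imp_inj_on[OF bij] that inj_onD[of ?c "{..<q}" k 0] by auto
  moreover have "?c 1 ^ q = 1" unfolding pow using q_gt1 by simp
  ultimately show ?thesis unfolding primitive_root_of_unity_def using pow by metis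
qed

lemma r_pow_cong_1: "x < p \<Longrightarrow> int q dvd int (r ^ x) - 1 \<longleftrightarrow> x = 0"
proof -
  assume x: "x < p"
  have "int q dvd int (r ^ x) - 1 \<longleftrightarrow> [r ^ x = 1] (mod q)"
    by (metis cong_iff_dvd_diff cong_int_iff of_nat_1)
  also have "\<dots> \<longleftrightarrow> p dvd x" using ord_divides[of r x q] by (simp add: ord_r)
  finally show ?thesis using x by (auto dest: dvd_imp_le)
qed

text \<open>The exponent (q - 1) c stands for - c modulo q. By orthogonality over c only those x
  survive for which r^x is 1 modulo q, and this is x = 0 alone because r has order p.\<close>

lemma weighted_orbit_sum:
  assumes "primitive_root_of_unity q \<eta>"
  shows "(\<Sum>c<q. \<eta> ^ ((q - 1) * c) * orbit_sum p r (\<eta> ^ c)) = of_nat q"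
proof -
  interpret root_of_unity q \<eta> by unfold_locales (use assms q_gt1 in auto)
  have "(\<Sum>c<q. \<eta> ^ ((q - 1) * c) * orbit_sum p r (\<eta> ^ c)) =
      (\<Sum>c<q. \<Sum>x<p. \<eta> powi (int c * (int (r ^ x) - 1)))"
    unfolding orbit_sum_def sum_distrib_left
  proof (intro sum.cong refl)
    fix c x
    have "\<eta> ^ ((q - 1) * c) * (\<eta> ^ c) ^ (r ^ x) = \<eta> ^ ((q - 1) * c + c * r ^ x)"
      by (simp add: power_add power_mult)
    also have "\<dots> = \<eta> powi int ((q - 1) * c + c * r ^ x)"
      by (rule power_int_of_nat[symmetric])
    also have "int ((q - 1) * c + c * r ^ x) = int c * (int (r ^ x) - 1) + int q * int c"
      using q_gt1 by (cases q) (simp_all add: algebra_simps)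
    finally show "\<eta> ^ ((q - 1) * c) * (\<eta> ^ c) ^ (r ^ x) = \<eta> powi (int c * (int (r ^ x) - 1))"
      by (simp only: zeta_powi_period)
  qed
  also have "\<dots> = (\<Sum>x<p. \<Sum>c<q. \<eta> powi (int c * (int (r ^ x) - 1)))" by (rule sum.swap)
  also have "\<dots> = (\<Sum>x<p. if x = 0 then of_nat q else 0)"
    unfolding sum_residues[where f = "\<lambda>c. \<eta> powi (c * (int (r ^ _) - 1))", symmetric] sum_zeta_powi
    by (intro sum.cong refl) (simp add: r_pow_cong_1 del: of_nat_power)
  also have "\<dots> = of_nat q" using p_gt0 by simp
  finally show ?thesis .
qed

text \<open>A rational algebraic integer is an integer, so p would divide q^4. This forces p = q,
  against p dividing q - 1.\<close>

lemma not_algebraic_int: "\<not> algebraic_int (of_nat q ^ 4 / of_nat p :: complex)"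
proof
  assume "algebraic_int (of_nat q ^ 4 / of_nat p :: complex)"
  then have "(of_nat q ^ 4 / of_nat p :: complex) \<in> \<int>"
    by (rule rational_algebraic_int_is_int) (auto intro!: Rats_divide Rats_power)
  then obtain m where "(of_nat q ^ 4 / of_nat p :: complex) = of_int m" by (auto elim: Ints_cases)
  then have "(of_nat q ^ 4 :: complex) = of_int m * of_nat p" using p_gt0 by (simp add: field_simps)
  then have "(of_int (int q ^ 4) :: complex) = of_int (m * int p)" by simp
  then have "int q ^ 4 = m * int p" by (simp only: of_int_eq_iff)
  then have "int p dvd int (q ^ 4)" by simp
  then have "p dvd q ^ 4" by (simp only: int_dvd_int_iff)
  then have "p dvd q" using p prime_dvd_power by blast
  then have "p = q" using p q primes_dvd_imp_eq by blast
  then show False using pq q_gt1 by (auto dest: dvd_imp_le)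
qed

end

theorem corollary2p4:
  fixes p q r :: nat and \<zeta> :: complex
  assumes "Factorial_Ring.prime p" and "Factorial_Ring.prime q" and "p dvd q - 1"
    and "Pocklington.ord q r = p"
    and "primitive_root_of_unity p \<zeta>"
  shows "\<not> (\<exists>R Y. number_ring R \<and> hopf_order (base_change UNIV (Bpq p q r \<zeta>)) R Y)"
proof
  assume "\<exists>R Y. number_ring R \<and> hopf_order (base_change UNIV (Bpq p q r \<zeta>)) R Y"
  then obtain R Y where R: "number_ring R" and order: "hopf_order (base_change UNIV (Bpq p q r \<zeta>)) R Y"
    by blast
  interpret Bpq_params p q r by unfold_locales (use assms in auto)
  let ?K = "generate_field complex_ring {\<zeta>}"
  interpret C: field complex_ring by (rule field_from_type_algebra)
  have K: "subfield ?K complex_ring" "\<zeta> \<in> ?K"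
    by (rule C.generate_field_is_subfield, simp add: ring_of_type_algebra_def)
      (rule generate_field.incl, simp)
  interpret T: group_twist G p \<zeta> "gen Sigma_gen" "gen Tau_gen" ?K
    by (intro group_twist.intro group_twist_axioms.intro commuting_pair_Bpq assms(5) finite_carrier K)
  have "base_change UNIV (Bpq p q r \<zeta>) = T.H"
    by (simp add: T.H_def Bpq_def Bpq_twist_def T.twist_def)
  with order have "hopf_order T.H R Y" by simp
  moreover have "algebraic_int z" if "z \<in> R" for z
    using R that by (auto simp: number_ring_def)
  ultimately obtain n x F where frame: "integral_frame T.H n x F"
    using T.hopf_order_integral_frame by blast
  obtain \<eta> where \<eta>: "primitive_root_of_unity q \<eta>" using primitive_root_exists by blast
  then have \<eta>q: "\<eta> ^ q = 1" by (simp add: primitive_root_of_unity_def)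
  define \<alpha> where "\<alpha> c = orbit_sum p r (\<eta> ^ c)" for c
  define \<beta> where "\<beta> c = \<eta> ^ ((q - 1) * c)" for c
  have \<alpha>: "algebraic_int (\<alpha> c * \<alpha> d * (\<alpha> c' * \<alpha> d') / of_nat p)" for c d c' d'
    unfolding \<alpha>_def
    by (rule T.orbit_sums_integral[OF frame _ _
          state_action_Bpq[OF assms(5) power_root[OF \<eta>q] power_root[OF \<eta>q]]
          state_action_Bpq[OF assms(5) power_root[OF \<eta>q] power_root[OF \<eta>q]]])
      (simp_all add: gen_relations)
  have \<beta>: "algebraic_int (\<beta> c)" for c
    unfolding \<beta>_def by (rule algebraic_int_root_of_unity) (rule power_root[OF \<eta>q])
  \<comment> \<open>Four independent indices, one for each of a and b in each tensor factor, let the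
    sum split into a fourth power. The weights \<beta> are roots of unity, so integrality is
    preserved.\<close>
  have "algebraic_int (\<Sum>c<q. \<Sum>d<q. \<Sum>c'<q. \<Sum>d'<q.
      \<beta> c * (\<beta> d * (\<beta> c' * \<beta> d')) * (\<alpha> c * \<alpha> d * (\<alpha> c' * \<alpha> d') / of_nat p))"
    by (intro algebraic_int_sum algebraic_int_mult \<beta> \<alpha>)
  also have "(\<Sum>c<q. \<Sum>d<q. \<Sum>c'<q. \<Sum>d'<q.
      \<beta> c * (\<beta> d * (\<beta> c' * \<beta> d')) * (\<alpha> c * \<alpha> d * (\<alpha> c' * \<alpha> d') / of_nat p)) =
      (\<Sum>c<q. \<beta> c * \<alpha> c) ^ 4 / of_nat p"
  proof -
    let ?S = "\<Sum>c<q. \<beta> c * \<alpha> c"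
    have "(\<Sum>c<q. \<Sum>d<q. \<Sum>c'<q. \<Sum>d'<q.
      \<beta> c * (\<beta> d * (\<beta> c' * \<beta> d')) * (\<alpha> c * \<alpha> d * (\<alpha> c' * \<alpha> d') / of_nat p)) =
      (\<Sum>c<q. \<Sum>d<q. \<Sum>c'<q. \<Sum>d'<q.
        (\<beta> c * \<alpha> c) * ((\<beta> d * \<alpha> d) * ((\<beta> c' * \<alpha> c') * ((\<beta> d' * \<alpha> d') / of_nat p))))"
      by (simp add: mult_ac)
    also have "\<dots> = ?S * (?S * (?S * (?S / of_nat p)))"
      unfolding sum_distrib_right sum_divide_distrib unfolding sum_distrib_left ..
    finally show ?thesis by (simp add: power4_eq_xxxx)
  qed
  also have "(\<Sum>c<q. \<beta> c * \<alpha> c) = of_nat q"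
    unfolding \<alpha>_def \<beta>_def by (rule weighted_orbit_sum[OF \<eta>])
  finally show False using not_algebraic_int by simp
qed

end
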